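(* Let $q\ge0$ be an integer and let $G$ be a polycyclic group given by a consistent polycyclic presentation $G=F_n/R$. Let $E_q(G)=F_n/R^q[F_n,R]$ and let $T_q=R/R^q[R,F_n]\le E_q(G)$. Then: (i) $G\wedge^qG\cong E_q(G)'\,E_q(G)^q$; (ii) $H_2(G,\mathbb Z_q)\cong\big(E_q(G)'\,E_q(G)^q\big)\cap T_q$.
   Context: Conventions: $y^x=x^{-1}yx$, $[x,y]=x^{-1}y^{-1}xy$. For a group $X$, $X'$ is the derived subgroup and $X^q$ the subgroup generated by all $q$-th powers of elements of $X$ (trivial if $q=0$). $\mathbb Z_q=\mathbb Z/q\mathbb Z$ (so $\mathbb Z_0=\mathbb Z$) is regarded as a trivial $G$-module and $H_2(G,\mathbb Z_q)$ is the second homology group. $F_n$ is the free group on $g_1,\dots,g_n$ and $R$ is the normal closure of the relators. A polycyclic presentation on $g_1,\dots,g_n$ has relations of the form $g_i^{e_i}=g_{i+1}^{\alpha_{i,i+1}}\cdots g_n^{\alpha_{i,n}}$ for $i\in I$; $g_j^{-1}g_ig_j=g_{j+1}^{\beta_{i,j,j+1}}\cdots g_n^{\beta_{i,j,n}}$ for $j<i$; $g_jg_ig_j^{-1}=g_{j+1}^{\gamma_{i,j,j+1}}\cdots g_n^{\gamma_{i,j,n}}$ for $j<i$, $j\notin I$, where $I\subseteq\{1,\dots,n\}$, $e_i\in\mathbb N$ and other exponents are integers. It is consistent if every element is uniquely of the form $g_1^{a_1}\cdots g_n^{a_n}$ with $a_i\in\mathbb Z$, $0\le a_i<e_i$ for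 $i\in I$. For $q\ge1$ the $q$-tensor square $G\otimes^qG$ is the group generated by symbols $g\otimes h$ and $\widehat k$ ($g,h,k\in G$) subject to, for all $g,g_1,h,h_1,k,k_1\in G$: (1) $g\otimes hh_1=(g\otimes h_1)(g^{h_1}\otimes h^{h_1})$; (2) $gg_1\otimes h=(g^{g_1}\otimes h^{g_1})(g_1\otimes h)$; (3) $(g\otimes h)^{\widehat k}=g^{k^q}\otimes h^{k^q}$; (4) $\widehat{kk_1}=\widehat k\prod_{i=1}^{q-1}(k\otimes k_1^{-i})^{k^{q-1-i}}\widehat{k_1}$, where $(g\otimes h)^x=g^x\otimes h^x$ for $x\in G$; (5) $[\widehat k,\widehat{k_1}]=k^q\otimes k_1^q$; (6) $\widehat{[g,h]}=(g\otimes h)^q$. For $q=0$ it is generated by the symbols $g\otimes h$ subject to (1), (2) only. The $q$-exterior square is $G\wedge^qG=(G\otimes^qG)/\nabla^q(G)$ with $\nabla^q(G)=\langle g\otimes g\mid g\in G\rangle$. *)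

theory Defs
  imports "HOL-Algebra.Generated_Groups" "HOL-Algebra.Product_Groups" "HOL-Algebra.Elementary_Groups"
    "HOL-Algebra.FiniteProduct"
begin

section \<open>Generalities on groups\<close>

definition conj_by :: "('a, 'm) monoid_scheme \<Rightarrow> 'a \<Rightarrow> 'a \<Rightarrow> 'a" where
  "conj_by G y x = inv\<^bsub>G\<^esub> x \<otimes>\<^bsub>G\<^esub> y \<otimes>\<^bsub>G\<^esub> x"

definition commutator :: "('a, 'm) monoid_scheme \<Rightarrow> 'a \<Rightarrow> 'a \<Rightarrow> 'a" where
  "commutator G x y = inv\<^bsub>G\<^esub> x \<otimes>\<^bsub>G\<^esub> inv\<^bsub>G\<^esub> y \<otimes>\<^bsub>G\<^esub> x \<otimes>\<^bsub>G\<^esub> y"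

definition list_prod :: "('a, 'm) monoid_scheme \<Rightarrow> 'a list \<Rightarrow> 'a" where
  "list_prod G xs = foldr (\<otimes>\<^bsub>G\<^esub>) xs \<one>\<^bsub>G\<^esub>"

definition normal_closure :: "('a, 'm) monoid_scheme \<Rightarrow> 'a set \<Rightarrow> 'a set" where
  "normal_closure G S = generate G {conj_by G s x | s x. s \<in> S \<and> x \<in> carrier G}"

definition commutator_subgroup :: "('a, 'm) monoid_scheme \<Rightarrow> 'a set \<Rightarrow> 'a set \<Rightarrow> 'a set" where
  "commutator_subgroup G A B = generate G {commutator G a b | a b. a \<in> A \<and> b \<in> B}"

text \<open>For \<open>q = 0\<close> this is the trivial subgroup, since then every \<open>x [^] q\<close> is the identity.\<close>

definition power_subgroup :: "('a, 'm) monoid_scheme \<Rightarrow> 'a set \<Rightarrow> nat \<Rightarrow> 'a set" where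
  "power_subgroup G X q = generate G {x [^]\<^bsub>G\<^esub> q | x. x \<in> X}"

lemma (in group) normal_closure_normal:
  assumes "S \<subseteq> carrier G"
  shows "normal_closure G S \<lhd> G"
proof -
  let ?C = "{conj_by G s x | s x. s \<in> S \<and> x \<in> carrier G}"
  have C: "?C \<subseteq> carrier G"
    using assms by (auto simp: conj_by_def)
  show ?thesis
    unfolding normal_closure_def
  proof (rule normal_generateI[OF C])
    fix h g assume "h \<in> ?C" and g: "g \<in> carrier G"
    then obtain s x where h: "h = inv x \<otimes> s \<otimes> x" and s: "s \<in> S" and x: "x \<in> carrier G"
      by (auto simp: conj_by_def)
    have "s \<in> carrier G" using s assms by auto
    then have "g \<otimes> h \<otimes> inv g = conj_by G s (x \<otimes> inv g)"
      using g x by (simp add: h conj_by_def inv_mult_group m_assoc)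
    then show "g \<otimes> h \<otimes> inv g \<in> ?C" using s x g by auto
  qed
qed


section \<open>Free groups and presentations\<close>

text \<open>A letter \<open>(x, True)\<close> stands for \<open>x\<close> and \<open>(x, False)\<close> for its inverse.\<close>

type_synonym 'x word = "('x \<times> bool) list"

definition letter_inv :: "'x \<times> bool \<Rightarrow> 'x \<times> bool" where
  "letter_inv a = (fst a, \<not> snd a)"

definition reduced :: "'x word \<Rightarrow> bool" where
  "reduced w \<longleftrightarrow> successively (\<lambda>a b. b \<noteq> letter_inv a) w"

fun push :: "'x \<times> bool \<Rightarrow> 'x word \<Rightarrow> 'x word" where
  "push a [] = [a]"
| "push a (b # w) = (if b = letter_inv a then w else a # b # w)"

definition free_group :: "'x set \<Rightarrow> 'x word monoid" where
  "free_group X =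
     \<lparr>carrier = {w. reduced w \<and> fst ` set w \<subseteq> X},
      monoid.mult = (\<lambda>u v. foldr push u v),
      one = []\<rparr>"

definition free_gen :: "'x \<Rightarrow> 'x word" where
  "free_gen x = [(x, True)]"

text \<open>Defining relations are pairs of elements (left-hand side, right-hand side) of the free group.\<close>

definition relators :: "('a, 'm) monoid_scheme \<Rightarrow> ('a \<times> 'a) set \<Rightarrow> 'a set" where
  "relators F rel = {l \<otimes>\<^bsub>F\<^esub> inv\<^bsub>F\<^esub> r | l r. (l, r) \<in> rel}"

definition presented_group :: "'x set \<Rightarrow> ('x word \<times> 'x word) set \<Rightarrow> 'x word set monoid" where
  "presented_group X rel =
     free_group X Mod normal_closure (free_group X) (relators (free_group X) rel)"

lemma letter_inv_letter_inv [simp]: "letter_inv (letter_inv a) = a"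
  by (simp add: letter_inv_def)

lemma letter_inv_eq_iff: "a = letter_inv b \<longleftrightarrow> b = letter_inv a"
  by auto

lemma fst_letter_inv [simp]: "fst (letter_inv a) = fst a"
  by (simp add: letter_inv_def)

lemma reduced_Nil [simp]: "reduced []"
  by (simp add: reduced_def)

lemma reduced_Cons:
  "reduced (a # w) \<longleftrightarrow> reduced w \<and> (w = [] \<or> hd w \<noteq> letter_inv a)"
  by (auto simp: reduced_def successively_Cons)

lemma reduced_push: "reduced w \<Longrightarrow> reduced (push a w)"
  by (cases w) (auto simp: reduced_Cons)

lemma push_push_inv: "reduced w \<Longrightarrow> push a (push (letter_inv a) w) = w"
  by (cases w; cases "tl w") (auto simp: reduced_Cons letter_inv_eq_iff)

lemma reduced_foldr_push: "reduced v \<Longrightarrow> reduced (foldr push u v)"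
  by (induction u) (auto simp: reduced_push)

lemma push_reduced: "reduced (a # w) \<Longrightarrow> push a w = a # w"
  by (cases w) (auto simp: reduced_Cons)

lemma foldr_push_Nil: "reduced u \<Longrightarrow> foldr push u [] = u"
  by (induction u) (auto simp: reduced_Cons intro: push_reduced)

lemma fst_set_push: "fst ` set (push a w) \<subseteq> insert (fst a) (fst ` set w)"
  by (cases w) auto

lemma fst_set_foldr_push: "fst ` set (foldr push u v) \<subseteq> fst ` set u \<union> fst ` set v"
proof (induction u)
  case (Cons a u)
  have "fst ` set (foldr push (a # u) v) \<subseteq> insert (fst a) (fst ` set (foldr push u v))"
    using fst_set_push[of a "foldr push u v"] by simp
  also have "\<dots> \<subseteq> fst ` set (a # u) \<union> fst ` set v"
    using Cons by (simp add: subset_insertI2)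
  finally show ?case .
qed simp

lemma foldr_push_push:
  assumes "reduced w"
  shows "foldr push (push a x) w = push a (foldr push x w)"
proof (cases x)
  case (Cons b y)
  then show ?thesis
    using push_push_inv[OF reduced_foldr_push[OF assms], of a y] by auto
qed simp

lemma foldr_push_assoc:
  "reduced w \<Longrightarrow> foldr push (foldr push u v) w = foldr push u (foldr push v w)"
  by (induction u) (auto simp: foldr_push_push)

lemma foldr_push_inverse: "foldr push (rev (map letter_inv u)) (foldr push u v) = v"
  if "reduced v"
proof (induction u)
  case (Cons a u)
  have "push (letter_inv a) (push a (foldr push u v)) = foldr push u v"
    using push_push_inv[OF reduced_foldr_push[OF that], of "letter_inv a"] by simp
  then show ?case using Cons by simp
qed (use that in simp)

lemma reduced_rev_inv: "reduced u \<Longrightarrow> reduced (rev (map letter_inv u))"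
  unfolding reduced_def successively_rev successively_map
  by (erule successively_mono) (metis letter_inv_letter_inv)

theorem group_free_group: "group (free_group X)"
proof (rule groupI)
  fix x y assume "x \<in> carrier (free_group X)" "y \<in> carrier (free_group X)"
  then show "x \<otimes>\<^bsub>free_group X\<^esub> y \<in> carrier (free_group X)"
    using order_trans[OF fst_set_foldr_push[of x y], of X]
    by (simp add: free_group_def reduced_foldr_push)
next
  fix x assume x: "x \<in> carrier (free_group X)"
  let ?y = "rev (map letter_inv x)"
  have "?y \<in> carrier (free_group X)"
    using x by (auto simp: free_group_def reduced_rev_inv image_image)
  moreover have "?y \<otimes>\<^bsub>free_group X\<^esub> x = \<one>\<^bsub>free_group X\<^esub>"
    using x foldr_push_inverse[of "[]" x] by (simp add: free_group_def foldr_push_Nil)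
  ultimately show "\<exists>y\<in>carrier (free_group X). y \<otimes>\<^bsub>free_group X\<^esub> x = \<one>\<^bsub>free_group X\<^esub>"
    by blast
qed (auto simp: free_group_def foldr_push_assoc)

theorem free_group_extend:
  fixes G (structure)
  assumes "group G" and f: "f ` X \<subseteq> carrier G"
  shows "\<exists>h \<in> hom (free_group X) G. \<forall>x\<in>X. h (free_gen x) = f x"
proof -
  interpret group G by fact
  define l where "l a = (if snd a then f (fst a) else inv (f (fst a)))" for a
  define h where "h w = list_prod G (map l w)" for w
  have h_simps: "h [] = \<one>" "h (a # w) = l a \<otimes> h w" for a w
    by (simp_all add: h_def list_prod_def)
  have l: "l a \<in> carrier G" "l (letter_inv a) = inv l a" if "fst a \<in> X" for a
    using that f by (auto simp: l_def letter_inv_def image_subset_iff)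
  have hc: "h w \<in> carrier G" if "fst ` set w \<subseteq> X" for w
    using that by (induction w) (auto simp: h_simps l)
  have push: "h (push a w) = l a \<otimes> h w" if "fst a \<in> X" "fst ` set w \<subseteq> X" for a w
    using that by (cases w) (auto simp: h_simps l hc simp flip: m_assoc)
  have mult: "h (foldr push u v) = h u \<otimes> h v" if "fst ` set u \<subseteq> X" "fst ` set v \<subseteq> X" for u v
    using that(1)
  proof (induction u)
    case (Cons a u)
    have "fst ` set (foldr push u v) \<subseteq> X"
      using order_trans[OF fst_set_foldr_push[of u v], of X] Cons.prems that(2) by simp
    then show ?case using Cons that(2) by (auto simp: push h_simps l hc m_assoc)
  qed (simp add: h_simps hc that(2))
  have "h \<in> hom (free_group X) G"
    by (auto simp: hom_def free_group_def hc mult)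
  moreover have "h (free_gen x) = f x" if "x \<in> X" for x
    using that f by (auto simp: free_gen_def h_simps l_def)
  ultimately show ?thesis by blast
qed


section \<open>Polycyclic presentations\<close>

text \<open>The word \<open>g\<^sub>m [^] f m \<otimes> \<dots> \<otimes> g\<^sub>n [^] f n\<close>, trivial if \<open>m > n\<close>.\<close>

definition gen_powers :: "nat \<Rightarrow> nat \<Rightarrow> (nat \<Rightarrow> int) \<Rightarrow> nat word" where
  "gen_powers n m f =
     list_prod (free_group {1..n}) (map (\<lambda>k. free_gen k [^]\<^bsub>free_group {1..n}\<^esub> f k) [m..<Suc n])"

definition pc_relations ::
  "nat \<Rightarrow> nat set \<Rightarrow> (nat \<Rightarrow> nat) \<Rightarrow> (nat \<Rightarrow> nat \<Rightarrow> int) \<Rightarrow> (nat \<Rightarrow> nat \<Rightarrow> nat \<Rightarrow> int)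
     \<Rightarrow> (nat \<Rightarrow> nat \<Rightarrow> nat \<Rightarrow> int) \<Rightarrow> (nat word \<times> nat word) set"
where
  "pc_relations n I e \<alpha> \<beta> \<gamma> =
     (let F = free_group {1..n}; g = free_gen in
        {(g i [^]\<^bsub>F\<^esub> e i, gen_powers n (Suc i) (\<alpha> i)) | i. i \<in> I}
      \<union> {(inv\<^bsub>F\<^esub> (g j) \<otimes>\<^bsub>F\<^esub> g i \<otimes>\<^bsub>F\<^esub> g j, gen_powers n (Suc j) (\<beta> i j)) | i j.
            1 \<le> j \<and> j < i \<and> i \<le> n}
      \<union> {(g j \<otimes>\<^bsub>F\<^esub> g i \<otimes>\<^bsub>F\<^esub> inv\<^bsub>F\<^esub> (g j), gen_powers n (Suc j) (\<gamma> i j)) | i j.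
            1 \<le> j \<and> j < i \<and> i \<le> n \<and> j \<notin> I})"

definition pc_kernel ::
  "nat \<Rightarrow> nat set \<Rightarrow> (nat \<Rightarrow> nat) \<Rightarrow> (nat \<Rightarrow> nat \<Rightarrow> int) \<Rightarrow> (nat \<Rightarrow> nat \<Rightarrow> nat \<Rightarrow> int)
     \<Rightarrow> (nat \<Rightarrow> nat \<Rightarrow> nat \<Rightarrow> int) \<Rightarrow> nat word set"
where
  "pc_kernel n I e \<alpha> \<beta> \<gamma> =
     normal_closure (free_group {1..n}) (relators (free_group {1..n}) (pc_relations n I e \<alpha> \<beta> \<gamma>))"

text \<open>
  Exponent vectors are functions on \<open>{1..n}\<close>, made extensional so that uniqueness refers to
  the exponents \<open>a\<^sub>1, \<dots>, a\<^sub>n\<close> only.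
\<close>

definition consistent_pc_presentation ::
  "nat \<Rightarrow> nat set \<Rightarrow> (nat \<Rightarrow> nat) \<Rightarrow> (nat \<Rightarrow> nat \<Rightarrow> int) \<Rightarrow> (nat \<Rightarrow> nat \<Rightarrow> nat \<Rightarrow> int)
     \<Rightarrow> (nat \<Rightarrow> nat \<Rightarrow> nat \<Rightarrow> int) \<Rightarrow> bool"
where
  "consistent_pc_presentation n I e \<alpha> \<beta> \<gamma> \<longleftrightarrow>
     (let F = free_group {1..n}; R = pc_kernel n I e \<alpha> \<beta> \<gamma> in
      \<forall>x \<in> carrier (F Mod R).
        \<exists>!a. a \<in> {1..n} \<rightarrow>\<^sub>E (UNIV :: int set) \<and>
             (\<forall>i\<in>I. 0 \<le> a i \<and> a i < int (e i)) \<and>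
             x = R #>\<^bsub>F\<^esub> gen_powers n 1 a)"


section \<open>The quotients \<open>E\<^sub>q(G)\<close> and \<open>T\<^sub>q\<close>\<close>

definition Eq_kernel :: "('a, 'm) monoid_scheme \<Rightarrow> 'a set \<Rightarrow> nat \<Rightarrow> 'a set" where
  "Eq_kernel F R q = power_subgroup F R q <#>\<^bsub>F\<^esub> commutator_subgroup F (carrier F) R"

definition Eq_group :: "('a, 'm) monoid_scheme \<Rightarrow> 'a set \<Rightarrow> nat \<Rightarrow> 'a set monoid" where
  "Eq_group F R q = F Mod Eq_kernel F R q"

definition Tq_subgroup :: "('a, 'm) monoid_scheme \<Rightarrow> 'a set \<Rightarrow> nat \<Rightarrow> 'a set set" where
  "Tq_subgroup F R q = (\<lambda>r. Eq_kernel F R q #>\<^bsub>F\<^esub> r) ` R"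

definition derived_power_subgroup :: "('a, 'm) monoid_scheme \<Rightarrow> nat \<Rightarrow> 'a set" where
  "derived_power_subgroup E q = derived E (carrier E) <#>\<^bsub>E\<^esub> power_subgroup E (carrier E) q"


section \<open>The \<open>q\<close>-tensor square and the \<open>q\<close>-exterior square\<close>

datatype 'g tensor_symbol = Tens 'g 'g | Hat 'g

definition qt_symbols :: "('g, 'm) monoid_scheme \<Rightarrow> nat \<Rightarrow> 'g tensor_symbol set" where
  "qt_symbols G q =
     {Tens g h | g h. g \<in> carrier G \<and> h \<in> carrier G}
     \<union> (if q = 0 then {} else {Hat k | k. k \<in> carrier G})"

definition qt_relations ::
  "('g, 'm) monoid_scheme \<Rightarrow> nat \<Rightarrow> ('g tensor_symbol word \<times> 'g tensor_symbol word) set"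
where
  "qt_relations G q =
    (let F = free_group (qt_symbols G q);
         t = (\<lambda>g h. free_gen (Tens g h));
         hat = (\<lambda>k. free_gen (Hat k))
     in
       {(t g (h \<otimes>\<^bsub>G\<^esub> h1), t g h1 \<otimes>\<^bsub>F\<^esub> t (conj_by G g h1) (conj_by G h h1)) | g h h1.
          g \<in> carrier G \<and> h \<in> carrier G \<and> h1 \<in> carrier G}
     \<union> {(t (g \<otimes>\<^bsub>G\<^esub> g1) h, t (conj_by G g g1) (conj_by G h g1) \<otimes>\<^bsub>F\<^esub> t g1 h) | g g1 h.
          g \<in> carrier G \<and> g1 \<in> carrier G \<and> h \<in> carrier G}
     \<union> (if q = 0 then {} else
         {(conj_by F (t g h) (hat k),
           t (conj_by G g (k [^]\<^bsub>G\<^esub> q)) (conj_by G h (k [^]\<^bsub>G\<^esub> q))) | g h k.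
            g \<in> carrier G \<and> h \<in> carrier G \<and> k \<in> carrier G}
       \<union> {(hat (k \<otimes>\<^bsub>G\<^esub> k1),
           hat k
           \<otimes>\<^bsub>F\<^esub> list_prod F
                 (map (\<lambda>i. t (conj_by G k (k [^]\<^bsub>G\<^esub> (q - 1 - i)))
                             (conj_by G (inv\<^bsub>G\<^esub> (k1 [^]\<^bsub>G\<^esub> i)) (k [^]\<^bsub>G\<^esub> (q - 1 - i))))
                      [1..<q])
           \<otimes>\<^bsub>F\<^esub> hat k1) | k k1.
            k \<in> carrier G \<and> k1 \<in> carrier G}
       \<union> {(commutator F (hat k) (hat k1), t (k [^]\<^bsub>G\<^esub> q) (k1 [^]\<^bsub>G\<^esub> q)) | k k1.
            k \<in> carrier G \<and> k1 \<in> carrier G}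
       \<union> {(hat (commutator G g h), t g h [^]\<^bsub>F\<^esub> q) | g h.
            g \<in> carrier G \<and> h \<in> carrier G}))"

definition q_tensor_square ::
  "('g, 'm) monoid_scheme \<Rightarrow> nat \<Rightarrow> 'g tensor_symbol word set monoid" where
  "q_tensor_square G q = presented_group (qt_symbols G q) (qt_relations G q)"

definition q_tensor ::
  "('g, 'm) monoid_scheme \<Rightarrow> nat \<Rightarrow> 'g \<Rightarrow> 'g \<Rightarrow> 'g tensor_symbol word set" where
  "q_tensor G q g h =
     (let F = free_group (qt_symbols G q) in
      normal_closure F (relators F (qt_relations G q)) #>\<^bsub>F\<^esub> free_gen (Tens g h))"

definition nabla_q :: "('g, 'm) monoid_scheme \<Rightarrow> nat \<Rightarrow> 'g tensor_symbol word set set" where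
  "nabla_q G q = generate (q_tensor_square G q) {q_tensor G q g g | g. g \<in> carrier G}"

definition q_exterior_square ::
  "('g, 'm) monoid_scheme \<Rightarrow> nat \<Rightarrow> 'g tensor_symbol word set set monoid" where
  "q_exterior_square G q = q_tensor_square G q Mod nabla_q G q"


section \<open>Second homology with trivial coefficients\<close>

text \<open>
  The homology of the (inhomogeneous, unnormalised) bar complex of \<open>G\<close> with coefficients in an
  abelian group \<open>A\<close> on which \<open>G\<close> acts trivially. The group of \<open>n\<close>-chains is the direct sum of
  copies of \<open>A\<close> indexed by \<open>G\<^sup>n\<close>, written multiplicatively, and the differentials are
  \<open>d[g|h] = [h] - [gh] + [g]\<close> and \<open>d[g|h|k] = [h|k] - [gh|k] + [g|hk] - [g|h]\<close>.
\<close>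

definition chain_group :: "'i set \<Rightarrow> ('a, 'm) monoid_scheme \<Rightarrow> ('i \<Rightarrow> 'a) monoid" where
  "chain_group I A = sum_group I (\<lambda>_. A)"

text \<open>The homomorphism of direct sums induced by a map \<open>f\<close> from the index set \<open>I\<close> to \<open>J\<close>.\<close>

definition chain_map ::
  "('a, 'm) monoid_scheme \<Rightarrow> 'i set \<Rightarrow> 'j set \<Rightarrow> ('i \<Rightarrow> 'j) \<Rightarrow> ('i \<Rightarrow> 'a) \<Rightarrow> 'j \<Rightarrow> 'a" where
  "chain_map A I J f c =
     (\<lambda>j\<in>J. finprod A c {i \<in> I. c i \<noteq> \<one>\<^bsub>A\<^esub> \<and> f i = j})"

abbreviation bar1 :: "('g, 'm) monoid_scheme \<Rightarrow> 'g set" where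
  "bar1 G \<equiv> carrier G"

abbreviation bar2 :: "('g, 'm) monoid_scheme \<Rightarrow> ('g \<times> 'g) set" where
  "bar2 G \<equiv> carrier G \<times> carrier G"

abbreviation bar3 :: "('g, 'm) monoid_scheme \<Rightarrow> ('g \<times> 'g \<times> 'g) set" where
  "bar3 G \<equiv> carrier G \<times> carrier G \<times> carrier G"

definition bar_d2 ::
  "('g, 'm) monoid_scheme \<Rightarrow> ('a, 'k) monoid_scheme \<Rightarrow> ('g \<times> 'g \<Rightarrow> 'a) \<Rightarrow> 'g \<Rightarrow> 'a" where
  "bar_d2 G A c =
     (let C = chain_group (bar1 G) A; p = chain_map A (bar2 G) (bar1 G) in
        p (\<lambda>(g, h). h) c
        \<otimes>\<^bsub>C\<^esub> inv\<^bsub>C\<^esub> (p (\<lambda>(g, h). g \<otimes>\<^bsub>G\<^esub> h) c)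
        \<otimes>\<^bsub>C\<^esub> p (\<lambda>(g, h). g) c)"

definition bar_d3 ::
  "('g, 'm) monoid_scheme \<Rightarrow> ('a, 'k) monoid_scheme \<Rightarrow> ('g \<times> 'g \<times> 'g \<Rightarrow> 'a) \<Rightarrow> 'g \<times> 'g \<Rightarrow> 'a"
where
  "bar_d3 G A c =
     (let C = chain_group (bar2 G) A; p = chain_map A (bar3 G) (bar2 G) in
        p (\<lambda>(g, h, k). (h, k)) c
        \<otimes>\<^bsub>C\<^esub> inv\<^bsub>C\<^esub> (p (\<lambda>(g, h, k). (g \<otimes>\<^bsub>G\<^esub> h, k)) c)
        \<otimes>\<^bsub>C\<^esub> p (\<lambda>(g, h, k). (g, h \<otimes>\<^bsub>G\<^esub> k)) c
        \<otimes>\<^bsub>C\<^esub> inv\<^bsub>C\<^esub> (p (\<lambda>(g, h, k). (g, h)) c))"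

definition H2 ::
  "('g, 'm) monoid_scheme \<Rightarrow> ('a, 'k) monoid_scheme \<Rightarrow> ('g \<times> 'g \<Rightarrow> 'a) set monoid" where
  "H2 G A =
     (chain_group (bar2 G) A)
       \<lparr>carrier := kernel (chain_group (bar2 G) A) (chain_group (bar1 G) A) (bar_d2 G A)\<rparr>
     Mod (bar_d3 G A ` carrier (chain_group (bar3 G) A))"

end

theory Submission
  imports Defs "HOL-Algebra.Free_Abelian_Groups" "HOL-Algebra.Zassenhaus" "HOL-Library.Function_Algebras"
begin

text \<open>
  Write \<open>G = F/R\<close> with \<open>F\<close> free, \<open>E = F/R\<^sup>q[F,R]\<close> and \<open>T = G \<and>\<^sup>q G\<close>. Then \<open>E\<close> is a central extension
  of \<open>G\<close> whose kernel \<open>R/R\<^sup>q[F,R]\<close> has exponent \<open>q\<close>, so commutators and \<open>q\<close>-th powers in \<open>E\<close> depend only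
  on the images of their arguments in \<open>G\<close>. They satisfy the relations of \<open>T\<close>
  (\<open>section_pairing\<close>), and the universal property of \<open>T\<close> gives a homomorphism \<open>\<Phi>\<close> from \<open>T\<close> onto \<open>E'E\<^sup>q\<close>.

  The point of (i) is that \<open>\<Phi>\<close> is injective, and this is where the freeness of \<open>F\<close> enters. The relations
  make \<open>T\<close> a crossed module over \<open>G\<close> (\<open>peiffer\<close>), with boundary \<open>g \<and> h \<mapsto> [g,h]\<close> and \<open>hat k \<mapsto> k\<^sup>q\<close>. If
  \<open>x\<^sub>1, \<dots>, x\<^sub>n\<close> are the images in \<open>G\<close> of the free generators, then multiplying a formal product
  \<open>x\<^sub>1\<^bsup>a\<^sub>1\<^esup> \<dots> x\<^sub>n\<^bsup>a\<^sub>n\<^esup> t\<close> with \<open>t\<close> in \<open>T\<close> by \<open>x\<^sub>i\<close> and collecting, where the commutators that arise are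
  replaced by their counterparts in \<open>T\<close>, defines a permutation \<open>X\<^sub>i\<close> of \<open>\<int>\<^sup>n \<times> T\<close>. Sending the generators
  to the \<open>X\<^sub>i\<close> defines an action of \<open>F\<close>; in it \<open>[f,h]\<close> acts as right multiplication by \<open>\<pi> f \<and> \<pi> h\<close>
  (\<open>commutator_P\<close>), and \<open>f\<^sup>q\<close> acts as right multiplication by \<open>hat (\<pi> f)\<close> up to a group \<open>Z\<close> of
  permutations that meets the right multiplications trivially (\<open>agrees_hat\<close>, \<open>agrees_one\<close>). Now if
  \<open>\<Phi> u = 1\<close>, then \<open>u\<close> is matched in this way with some \<open>f\<close> in \<open>R\<^sup>q[F,R]\<close>. But every element of
  \<open>R\<^sup>q[F,R]\<close> is matched with \<open>1\<close>, because \<open>\<pi> f \<and> 1 = 1\<close> and \<open>hat 1 = 1\<close>, and so \<open>u = 1\<close>.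

  For (ii) let \<open>\<Psi>\<close> be the homomorphism that sends the chain \<open>[g|h]\<close> to the factor set of \<open>E\<close> at
  \<open>(g, h)\<close>. It kills boundaries and maps cycles into \<open>E'E\<^sup>q\<close>. The class of \<open>[g|h]\<close> modulo boundaries is a
  2-cocycle of \<open>G\<close>; pulled back to \<open>F\<close> it is the coboundary of some \<open>\<mu>\<close>, since extensions of free groups
  split (\<open>free_group_splitting\<close>). Up to a constant, \<open>\<mu>\<close> restricts to a homomorphism on \<open>R\<close>
  that vanishes on \<open>R\<^sup>q[F,R]\<close> (\<open>\<kappa>_N\<close>) and inverts \<open>\<Psi>\<close> on cycles modulo boundaries (\<open>\<kappa>_bar_\<Psi>\<close>,
  \<open>\<Psi>_surjective\<close>).
\<close>

section \<open>Conjugation, commutators and powers\<close>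

context group
begin

lemma inv_cancel_left: "x \<in> carrier G \<Longrightarrow> y \<in> carrier G \<Longrightarrow> inv x \<otimes> (x \<otimes> y) = y"
  by (simp flip: m_assoc)

lemma inv_cancel_left': "x \<in> carrier G \<Longrightarrow> y \<in> carrier G \<Longrightarrow> x \<otimes> (inv x \<otimes> y) = y"
  by (simp flip: m_assoc)

lemmas word_simps = m_assoc inv_mult_group inv_cancel_left inv_cancel_left'

lemma conj_by_closed [simp, intro]:
  "y \<in> carrier G \<Longrightarrow> x \<in> carrier G \<Longrightarrow> conj_by G y x \<in> carrier G"
  by (simp add: conj_by_def)

lemma commutator_closed [simp, intro]:
  "x \<in> carrier G \<Longrightarrow> y \<in> carrier G \<Longrightarrow> commutator G x y \<in> carrier G"
  by (simp add: commutator_def)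

lemma commutator_one_left [simp]: "y \<in> carrier G \<Longrightarrow> commutator G \<one> y = \<one>"
  by (simp add: commutator_def)

lemma commutator_one_right [simp]: "x \<in> carrier G \<Longrightarrow> commutator G x \<one> = \<one>"
  by (simp add: commutator_def)

lemma conj_by_mult:
  "y \<in> carrier G \<Longrightarrow> z \<in> carrier G \<Longrightarrow> x \<in> carrier G \<Longrightarrow>
    conj_by G (y \<otimes> z) x = conj_by G y x \<otimes> conj_by G z x"
  by (simp add: conj_by_def word_simps)

lemma conj_by_hom: "x \<in> carrier G \<Longrightarrow> (\<lambda>y. conj_by G y x) \<in> hom G G"
  by (simp add: hom_def conj_by_mult)

lemma conj_by_conj_by:
  "y \<in> carrier G \<Longrightarrow> x \<in> carrier G \<Longrightarrow> z \<in> carrier G \<Longrightarrow>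
    conj_by G (conj_by G y x) z = conj_by G y (x \<otimes> z)"
  by (simp add: conj_by_def word_simps)

lemma conj_by_one [simp]: "y \<in> carrier G \<Longrightarrow> conj_by G y \<one> = y"
  by (simp add: conj_by_def)

lemma one_conj_by [simp]: "x \<in> carrier G \<Longrightarrow> conj_by G \<one> x = \<one>"
  by (simp add: conj_by_def)

lemma conj_by_self [simp]: "x \<in> carrier G \<Longrightarrow> conj_by G x x = x"
  by (simp add: conj_by_def)

lemma list_prod_Nil [simp]: "list_prod G [] = \<one>"
  by (simp add: list_prod_def)

lemma list_prod_Cons [simp]: "list_prod G (x # xs) = x \<otimes> list_prod G xs"
  by (simp add: list_prod_def)

lemma list_prod_closed: "set xs \<subseteq> carrier G \<Longrightarrow> list_prod G xs \<in> carrier G"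
  by (induction xs) auto

lemma list_prod_append:
  "set xs \<subseteq> carrier G \<Longrightarrow> set ys \<subseteq> carrier G \<Longrightarrow> list_prod G (xs @ ys) = list_prod G xs \<otimes> list_prod G ys"
  by (induction xs) (auto simp: m_assoc list_prod_closed)

lemma list_prod_ones: "set xs \<subseteq> {\<one>} \<Longrightarrow> list_prod G xs = \<one>"
  by (induction xs) auto

lemma list_prod_upt_Suc:
  assumes "\<And>i. f i \<in> carrier G" "m \<le> n"
  shows "list_prod G (map f [m..<Suc n]) = list_prod G (map f [m..<n]) \<otimes> f n"
  using assms by (simp add: list_prod_append image_subset_iff)

text \<open>One step of the telescoping product below, with \<open>X\<close> and \<open>Y\<close> in the place of powers of \<open>x\<close> and \<open>y\<close>.\<close>

lemma telescope_step:
  assumes "x \<in> carrier G" "y \<in> carrier G" "X \<in> carrier G" "Y \<in> carrier G" "A \<in> carrier G"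
    and comm: "X \<otimes> x = x \<otimes> X"
  shows "A \<otimes> x \<otimes> inv Y \<otimes> (X \<otimes> x) \<otimes> commutator G (conj_by G x X) (conj_by G (inv (Y \<otimes> y)) X)
    = A \<otimes> x \<otimes> y \<otimes> x \<otimes> inv (Y \<otimes> y) \<otimes> X"
proof -
  have "X \<otimes> (x \<otimes> z) = x \<otimes> (X \<otimes> z)" if "z \<in> carrier G" for z
    using comm that assms by (simp flip: m_assoc)
  moreover have "conj_by G x X = x"
    using assms by (simp add: conj_by_def m_assoc inv_cancel_left flip: comm)
  ultimately show ?thesis
    using assms(1-5) by (simp add: commutator_def conj_by_def word_simps)
qed

text \<open>Including the factor \<open>x\<^sup>q\<close>, the partial products up to \<open>i = j\<close> are
  \<open>(x \<otimes> y)\<^sup>j \<otimes> x \<otimes> y\<^sup>-\<^sup>j \<otimes> x\<^sup>q\<^sup>-\<^sup>1\<^sup>-\<^sup>j\<close>, so the product telescopes.\<close>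

lemma power_of_product:
  assumes x: "x \<in> carrier G" and y: "y \<in> carrier G"
  shows "(x \<otimes> y) [^] (q::nat) =
    x [^] q \<otimes> list_prod G (map (\<lambda>i. commutator G (conj_by G x (x [^] (q - 1 - i)))
        (conj_by G (inv (y [^] i)) (x [^] (q - 1 - i)))) [1..<q]) \<otimes> y [^] q"
proof (cases q)
  case (Suc p)
  define f where "f i = commutator G (conj_by G x (x [^] (p - i))) (conj_by G (inv (y [^] i)) (x [^] (p - i)))" for i
  have f: "f i \<in> carrier G" for i
    using x y by (auto simp: f_def)
  have P: "list_prod G (map f is) \<in> carrier G" for "is"
    using f by (intro list_prod_closed) auto
  have partial: "x [^] q \<otimes> list_prod G (map f [1..<Suc j])
      = (x \<otimes> y) [^] j \<otimes> x \<otimes> inv (y [^] j) \<otimes> x [^] (p - j)" if "j \<le> p" for j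
    using that
  proof (induction j)
    case 0
    then show ?case using x y nat_pow_Suc2[OF x, of p] by (simp add: Suc)
  next
    case (Suc j)
    then obtain r where r: "p - j = Suc r" "p - Suc j = r"
      by (metis Suc_diff_Suc Suc_le_lessD)
    have "x [^] q \<otimes> list_prod G (map f [1..<Suc (Suc j)])
        = x [^] q \<otimes> list_prod G (map f [1..<Suc j]) \<otimes> f (Suc j)"
      using x f P by (subst list_prod_upt_Suc) (simp_all add: m_assoc)
    also have "\<dots> = (x \<otimes> y) [^] j \<otimes> x \<otimes> inv (y [^] j) \<otimes> (x [^] r \<otimes> x) \<otimes> f (Suc j)"
      using Suc r by simp
    also have "\<dots> = (x \<otimes> y) [^] j \<otimes> x \<otimes> y \<otimes> x \<otimes> inv (y [^] j \<otimes> y) \<otimes> x [^] r"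
      using telescope_step[of x y "x [^] r" "y [^] j" "(x \<otimes> y) [^] j"] x y r(2)
        nat_pow_Suc2[OF x, of r] by (simp add: f_def)
    also have "\<dots> = (x \<otimes> y) [^] Suc j \<otimes> x \<otimes> inv (y [^] Suc j) \<otimes> x [^] (p - Suc j)"
      using x y r by (simp add: m_assoc)
    finally show ?case .
  qed
  have "x [^] q \<otimes> list_prod G (map f [1..<q]) \<otimes> y [^] q = (x \<otimes> y) [^] p \<otimes> x \<otimes> inv (y [^] p) \<otimes> (y [^] p \<otimes> y)"
    using partial[of p] x y Suc by simp
  also have "\<dots> = (x \<otimes> y) [^] q"
    using x y Suc by (simp add: m_assoc inv_cancel_left)
  finally show ?thesis
    by (simp add: f_def[abs_def] Suc del: upt_Suc nat_pow_Suc)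
qed simp

end

lemma (in group_hom) hom_conj_by:
  "y \<in> carrier G \<Longrightarrow> x \<in> carrier G \<Longrightarrow> h (conj_by G y x) = conj_by H (h y) (h x)"
  by (simp add: conj_by_def)

lemma (in group_hom) hom_commutator:
  "x \<in> carrier G \<Longrightarrow> y \<in> carrier G \<Longrightarrow> h (commutator G x y) = commutator H (h x) (h y)"
  by (simp add: commutator_def)

lemma (in group_hom) hom_list_prod:
  "set xs \<subseteq> carrier G \<Longrightarrow> h (list_prod G xs) = list_prod H (map h xs)"
  by (induction xs) (auto simp: G.list_prod_closed)


section \<open>The relations of the \<open>q\<close>-tensor square\<close>

text \<open>For \<open>t = tens\<close> these are the factors between \<open>hat x\<close> and \<open>hat y\<close> in the relation for \<open>hat (x \<otimes> y)\<close>.\<close>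

abbreviation power_factors ::
  "('a, 'm) monoid_scheme \<Rightarrow> nat \<Rightarrow> ('a \<Rightarrow> 'a \<Rightarrow> 't) \<Rightarrow> 'a \<Rightarrow> 'a \<Rightarrow> 't list" where
  "power_factors G q t x y \<equiv> map (\<lambda>i. t (conj_by G x (x [^]\<^bsub>G\<^esub> (q - 1 - i)))
     (conj_by G (inv\<^bsub>G\<^esub> (y [^]\<^bsub>G\<^esub> i)) (x [^]\<^bsub>G\<^esub> (q - 1 - i)))) [1..<q]"

text \<open>The relations hold in a group \<open>T\<close>. For \<open>q = 0\<close> they are satisfied by \<open>hat = \<one>\<close> as soon as the first two
  hold for \<open>tens\<close>, so this locale covers both cases of the presentation.\<close>

locale q_pairing = G?: group G + T: group T
  for G (structure) and T :: "('t, 'n) monoid_scheme" +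
  fixes q :: nat and tens :: "'a \<Rightarrow> 'a \<Rightarrow> 't" and hat :: "'a \<Rightarrow> 't"
  assumes tens_closed [simp]: "g \<in> carrier G \<Longrightarrow> h \<in> carrier G \<Longrightarrow> tens g h \<in> carrier T"
    and hat_closed [simp]: "k \<in> carrier G \<Longrightarrow> hat k \<in> carrier T"
    and tens_mult_right: "g \<in> carrier G \<Longrightarrow> h \<in> carrier G \<Longrightarrow> h1 \<in> carrier G \<Longrightarrow>
      tens g (h \<otimes> h1) = tens g h1 \<otimes>\<^bsub>T\<^esub> tens (conj_by G g h1) (conj_by G h h1)"
    and tens_mult_left: "g \<in> carrier G \<Longrightarrow> g1 \<in> carrier G \<Longrightarrow> h \<in> carrier G \<Longrightarrow>
      tens (g \<otimes> g1) h = tens (conj_by G g g1) (conj_by G h g1) \<otimes>\<^bsub>T\<^esub> tens g1 h"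
    and tens_conj_hat: "g \<in> carrier G \<Longrightarrow> h \<in> carrier G \<Longrightarrow> k \<in> carrier G \<Longrightarrow>
      conj_by T (tens g h) (hat k) = tens (conj_by G g (k [^] q)) (conj_by G h (k [^] q))"
    and hat_mult: "k \<in> carrier G \<Longrightarrow> k1 \<in> carrier G \<Longrightarrow>
      hat (k \<otimes> k1) = hat k \<otimes>\<^bsub>T\<^esub> list_prod T (power_factors G q tens k k1) \<otimes>\<^bsub>T\<^esub> hat k1"
    and hat_commutator: "k \<in> carrier G \<Longrightarrow> k1 \<in> carrier G \<Longrightarrow>
      commutator T (hat k) (hat k1) = tens (k [^] q) (k1 [^] q)"
    and hat_of_commutator: "g \<in> carrier G \<Longrightarrow> h \<in> carrier G \<Longrightarrow>
      hat (commutator G g h) = tens g h [^]\<^bsub>T\<^esub> q"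

text \<open>The relations are modelled on identities between commutators and powers.\<close>

theorem (in group) commutator_power_pairing:
  "q_pairing G G q (commutator G) (\<lambda>k. k [^] (q::nat))"
proof unfold_locales
  fix k k1 assume "k \<in> carrier G" "k1 \<in> carrier G"
  then show "(k \<otimes> k1) [^] q = k [^] q \<otimes> list_prod G (map (\<lambda>i. commutator G (conj_by G k (k [^] (q - 1 - i)))
           (conj_by G (inv (k1 [^] i)) (k [^] (q - 1 - i)))) [1..<q]) \<otimes> k1 [^] q"
    by (rule power_of_product)
qed (auto simp: commutator_def conj_by_def word_simps)

lemma (in q_pairing) compose_hom:
  assumes "group G'" "f \<in> hom G' G"
  shows "q_pairing G' T q (\<lambda>g h. tens (f g) (f h)) (\<lambda>k. hat (f k))"
proof -
  interpret f: group_hom G' G f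
    using assms by (simp add: group_hom_def group_hom_axioms_def)
  show ?thesis
  proof unfold_locales
    fix k k1 assume k: "k \<in> carrier G'" "k1 \<in> carrier G'"
    show "hat (f (k \<otimes>\<^bsub>G'\<^esub> k1)) =
        hat (f k) \<otimes>\<^bsub>T\<^esub> list_prod T (power_factors G' q (\<lambda>g h. tens (f g) (f h)) k k1) \<otimes>\<^bsub>T\<^esub> hat (f k1)"
      using k by (simp add: hat_mult f.hom_conj_by f.hom_nat_pow)
  qed (simp_all add: tens_mult_right tens_mult_left tens_conj_hat hat_commutator hat_of_commutator
      f.hom_conj_by f.hom_nat_pow f.hom_commutator)
qed

lemma (in q_pairing) hom_compose:
  assumes "group T'" "f \<in> hom T T'"
  shows "q_pairing G T' q (\<lambda>g h. f (tens g h)) (\<lambda>k. f (hat k))"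
proof -
  interpret f: group_hom T T' f
    using assms by (simp add: group_hom_def group_hom_axioms_def)
  show ?thesis
  proof unfold_locales
    fix k k1 assume k: "k \<in> carrier G" "k1 \<in> carrier G"
    show "f (hat (k \<otimes> k1)) =
        f (hat k) \<otimes>\<^bsub>T'\<^esub> list_prod T' (power_factors G q (\<lambda>g h. f (tens g h)) k k1) \<otimes>\<^bsub>T'\<^esub> f (hat k1)"
      using k by (simp add: hat_mult f.hom_list_prod T.list_prod_closed image_subset_iff comp_def)
  qed (simp_all add: tens_mult_right tens_mult_left hat_of_commutator f.hom_nat_pow
       flip: tens_conj_hat hat_commutator f.hom_conj_by f.hom_commutator)
qed

context q_pairing
begin

lemma tens_one_right [simp]: "g \<in> carrier G \<Longrightarrow> tens g \<one> = \<one>\<^bsub>T\<^esub>"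
  using tens_mult_right[of g \<one> \<one>] by simp

lemma tens_one_left [simp]: "g \<in> carrier G \<Longrightarrow> tens \<one> g = \<one>\<^bsub>T\<^esub>"
  using tens_mult_left[of \<one> \<one> g] by simp

lemma hat_one [simp]: "hat \<one> = \<one>\<^bsub>T\<^esub>"
  using hat_of_commutator[of \<one> \<one>] by (simp add: commutator_def)

text \<open>Expanding \<open>tens (a \<otimes> g1) (b \<otimes> h1)\<close> in both orders and cancelling the outer factors gives
  \<open>exchange\<close>; the claim is the case in which \<open>a\<close> and \<open>b\<close> are the conjugates of \<open>g\<close> and \<open>h\<close> by \<open>inv (h1 \<otimes> g1)\<close>.\<close>

lemma tens_conj_tens:
  assumes g: "g \<in> carrier G" and h: "h \<in> carrier G" and g1: "g1 \<in> carrier G" and h1: "h1 \<in> carrier G"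
  shows "conj_by T (tens g h) (tens g1 h1) =
      tens (conj_by G g (commutator G g1 h1)) (conj_by G h (commutator G g1 h1))"
proof -
  have exchange: "tens g1 h1 \<otimes>\<^bsub>T\<^esub> tens (conj_by G a (g1 \<otimes> h1)) (conj_by G b (g1 \<otimes> h1))
      = tens (conj_by G a (h1 \<otimes> g1)) (conj_by G b (h1 \<otimes> g1)) \<otimes>\<^bsub>T\<^esub> tens g1 h1"
    if a: "a \<in> carrier G" and b: "b \<in> carrier G" for a b
  proof -
    let ?A = "tens (conj_by G a g1) (conj_by G h1 g1)"
    let ?B = "tens (conj_by G g1 h1) (conj_by G b h1)"
    have "tens (a \<otimes> g1) (b \<otimes> h1) = tens (a \<otimes> g1) h1 \<otimes>\<^bsub>T\<^esub> tens (conj_by G a h1 \<otimes> conj_by G g1 h1) (conj_by G b h1)"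
      using a b g1 h1 by (simp add: tens_mult_right conj_by_mult)
    also have "\<dots> = ?A \<otimes>\<^bsub>T\<^esub> (tens g1 h1 \<otimes>\<^bsub>T\<^esub> tens (conj_by G (conj_by G a h1) (conj_by G g1 h1))
          (conj_by G (conj_by G b h1) (conj_by G g1 h1))) \<otimes>\<^bsub>T\<^esub> ?B"
      using a b g1 h1 by (simp add: tens_mult_left T.m_assoc)
    also have "\<dots> = ?A \<otimes>\<^bsub>T\<^esub> (tens g1 h1 \<otimes>\<^bsub>T\<^esub> tens (conj_by G a (g1 \<otimes> h1)) (conj_by G b (g1 \<otimes> h1))) \<otimes>\<^bsub>T\<^esub> ?B"
      using a b g1 h1 by (simp add: conj_by_def word_simps)
    finally have 1: "tens (a \<otimes> g1) (b \<otimes> h1) = \<dots>" .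
    have "tens (a \<otimes> g1) (b \<otimes> h1) = tens (conj_by G a g1) (conj_by G b g1 \<otimes> conj_by G h1 g1) \<otimes>\<^bsub>T\<^esub> tens g1 (b \<otimes> h1)"
      using a b g1 h1 by (simp add: tens_mult_left conj_by_mult)
    also have "\<dots> = ?A \<otimes>\<^bsub>T\<^esub> (tens (conj_by G (conj_by G a g1) (conj_by G h1 g1))
          (conj_by G (conj_by G b g1) (conj_by G h1 g1)) \<otimes>\<^bsub>T\<^esub> tens g1 h1) \<otimes>\<^bsub>T\<^esub> ?B"
      using a b g1 h1 by (simp add: tens_mult_right T.m_assoc)
    also have "\<dots> = ?A \<otimes>\<^bsub>T\<^esub> (tens (conj_by G a (h1 \<otimes> g1)) (conj_by G b (h1 \<otimes> g1)) \<otimes>\<^bsub>T\<^esub> tens g1 h1) \<otimes>\<^bsub>T\<^esub> ?B"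
      using a b g1 h1 by (simp add: conj_by_def word_simps)
    finally show ?thesis
      using 1 a b g1 h1 by simp
  qed
  define a b where "a = conj_by G g (inv (h1 \<otimes> g1))" and "b = conj_by G h (inv (h1 \<otimes> g1))"
  have "conj_by G g (commutator G g1 h1) = conj_by G a (g1 \<otimes> h1)"
    "conj_by G h (commutator G g1 h1) = conj_by G b (g1 \<otimes> h1)"
    "conj_by G a (h1 \<otimes> g1) = g" "conj_by G b (h1 \<otimes> g1) = h"
    using g h g1 h1 by (simp_all add: a_def b_def conj_by_def commutator_def word_simps)
  then show ?thesis
    using exchange[of a b] g h g1 h1
    by (simp add: a_def b_def conj_by_def[of T] T.m_assoc T.inv_solve_left')
qed


lemma tens_inv_left:
  assumes "g \<in> carrier G" "k \<in> carrier G"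
  shows "tens (inv g) k = inv\<^bsub>T\<^esub> tens g (conj_by G k (inv g))"
proof -
  have "tens (g \<otimes> inv g) k = tens g (conj_by G k (inv g)) \<otimes>\<^bsub>T\<^esub> tens (inv g) k"
    using assms by (simp only: tens_mult_left inv_closed) (simp add: conj_by_def word_simps)
  then show ?thesis
    using assms by (metis T.inv_equality T.inv_inv conj_by_closed inv_closed r_inv tens_closed tens_one_left)
qed

lemma tens_inv_right:
  assumes "g \<in> carrier G" "k \<in> carrier G"
  shows "tens k (inv g) = inv\<^bsub>T\<^esub> tens (conj_by G k (inv g)) g"
proof -
  have "tens k (g \<otimes> inv g) = tens k (inv g) \<otimes>\<^bsub>T\<^esub> tens (conj_by G k (inv g)) g"
    using assms by (simp only: tens_mult_right inv_closed) (simp add: conj_by_def word_simps)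
  then show ?thesis
    using assms by (metis T.inv_equality conj_by_closed inv_closed r_inv tens_closed tens_one_right)
qed

text \<open>After writing the commutator as \<open>inv g \<otimes> conj_by G g h\<close>, it remains to compare two expansions of
  \<open>tens g (h \<otimes> k)\<close>, with \<open>h \<otimes> k\<close> also read as \<open>(h \<otimes> k \<otimes> inv h) \<otimes> h\<close>.\<close>

lemma tens_commutator_left:
  assumes g: "g \<in> carrier G" and h: "h \<in> carrier G" and k: "k \<in> carrier G"
  shows "tens (commutator G g h) k = inv\<^bsub>T\<^esub> tens g h \<otimes>\<^bsub>T\<^esub> tens (conj_by G g k) (conj_by G h k)"
proof -
  define y where "y = conj_by G g h"
  have y: "y \<in> carrier G" using g h by (simp add: y_def)
  have "tens (commutator G g h) k = tens (inv g \<otimes> y) k"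
    using g h by (simp add: commutator_def y_def conj_by_def m_assoc)
  also have "\<dots> = tens (inv (conj_by G g y)) (conj_by G k y) \<otimes>\<^bsub>T\<^esub> tens y k"
    using g y k by (simp add: tens_mult_left) (simp add: conj_by_def word_simps)
  also have "tens (inv (conj_by G g y)) (conj_by G k y)
      = inv\<^bsub>T\<^esub> tens (conj_by G g (commutator G g h)) (conj_by G k (commutator G g h))"
    using g h y k by (simp add: tens_inv_left) (simp add: commutator_def y_def conj_by_def word_simps)
  also have "\<dots> = inv\<^bsub>T\<^esub> conj_by T (tens g k) (tens g h)"
    using g h k by (simp add: tens_conj_tens)
  finally have 1: "tens (commutator G g h) k
      = inv\<^bsub>T\<^esub> tens g h \<otimes>\<^bsub>T\<^esub> (inv\<^bsub>T\<^esub> tens g k \<otimes>\<^bsub>T\<^esub> (tens g h \<otimes>\<^bsub>T\<^esub> tens y k))"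
    using g h k y by (simp add: conj_by_def[of T] T.word_simps)
  have "tens g h \<otimes>\<^bsub>T\<^esub> tens y k = tens g (conj_by G k (inv h) \<otimes> h)"
    using g h k by (simp add: tens_mult_right conj_by_conj_by y_def)
  also have "conj_by G k (inv h) \<otimes> h = h \<otimes> k"
    using h k by (simp add: conj_by_def word_simps)
  also have "tens g (h \<otimes> k) = tens g k \<otimes>\<^bsub>T\<^esub> tens (conj_by G g k) (conj_by G h k)"
    using g h k by (rule tens_mult_right)
  finally show ?thesis
    using 1 g h k by (simp add: T.inv_cancel_left)
qed

text \<open>The mirror image of the preceding proof, with two expansions of \<open>tens (g \<otimes> k) h\<close>.\<close>

lemma tens_commutator_right:
  assumes g: "g \<in> carrier G" and h: "h \<in> carrier G" and k: "k \<in> carrier G"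
  shows "tens k (commutator G g h) = inv\<^bsub>T\<^esub> tens (conj_by G g k) (conj_by G h k) \<otimes>\<^bsub>T\<^esub> tens g h"
proof -
  define y where "y = conj_by G h g"
  have y: "y \<in> carrier G" using g h by (simp add: y_def)
  have "tens k (commutator G g h) = tens k (inv y \<otimes> h)"
    using g h by (simp add: commutator_def y_def conj_by_def word_simps)
  also have "\<dots> = tens k h \<otimes>\<^bsub>T\<^esub> tens (conj_by G k h) (inv (conj_by G y h))"
    using h y k by (simp add: tens_mult_right) (simp add: conj_by_def word_simps)
  also have "tens (conj_by G k h) (inv (conj_by G y h))
      = inv\<^bsub>T\<^esub> tens (conj_by G k (commutator G g h)) (conj_by G y (commutator G g h))"
    using g h y k by (simp add: tens_inv_right) (simp add: commutator_def y_def conj_by_def word_simps)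
  also have "\<dots> = inv\<^bsub>T\<^esub> conj_by T (tens k y) (tens g h)"
    using g h k y by (simp add: tens_conj_tens)
  finally have 1: "tens k (commutator G g h)
      = tens k h \<otimes>\<^bsub>T\<^esub> inv\<^bsub>T\<^esub> (tens k y \<otimes>\<^bsub>T\<^esub> tens g h) \<otimes>\<^bsub>T\<^esub> tens g h"
    using g h k y by (simp add: conj_by_def[of T] T.word_simps)
  have "tens k y \<otimes>\<^bsub>T\<^esub> tens g h = tens (conj_by G k (inv g) \<otimes> g) h"
    using g h k by (simp add: tens_mult_left conj_by_conj_by y_def)
  also have "conj_by G k (inv g) \<otimes> g = g \<otimes> k"
    using g k by (simp add: conj_by_def word_simps)
  also have "tens (g \<otimes> k) h = tens (conj_by G g k) (conj_by G h k) \<otimes>\<^bsub>T\<^esub> tens k h"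
    using g k h by (rule tens_mult_left)
  finally show ?thesis
    using 1 g h k by (simp add: T.word_simps)
qed

text \<open>Conjugating \<open>tens g g\<close> by a generator of \<open>T\<close> or by its inverse conjugates \<open>g\<close> by an element of \<open>G\<close>, so
  the set of these elements is invariant under conjugation.\<close>

lemma diagonal_normal:
  assumes gen: "carrier T = generate T ({tens g h | g h. g \<in> carrier G \<and> h \<in> carrier G} \<union> hat ` carrier G)"
  shows "generate T {tens g g | g. g \<in> carrier G} \<lhd> T"
proof -
  let ?D = "{tens g g | g. g \<in> carrier G}"
  have twisted: "conj_by T d u \<in> ?D \<and> conj_by T d (inv\<^bsub>T\<^esub> u) \<in> ?D"
    if d: "d \<in> ?D" and u: "u \<in> carrier T" and w: "w \<in> carrier G"
      and eq: "\<And>g. g \<in> carrier G \<Longrightarrow> conj_by T (tens g g) u = tens (conj_by G g w) (conj_by G g w)" for d u w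
  proof -
    obtain g where g: "g \<in> carrier G" "d = tens g g" using d by auto
    let ?g' = "conj_by G g (inv w)"
    have "d = conj_by T (tens ?g' ?g') u"
      using g w by (simp add: eq conj_by_conj_by)
    then have "conj_by T d (inv\<^bsub>T\<^esub> u) = tens ?g' ?g'"
      using g w u by (simp add: T.conj_by_conj_by)
    moreover have "conj_by G g w \<in> carrier G" "?g' \<in> carrier G" using g w by auto
    ultimately show ?thesis using g eq by blast
  qed
  have generator: "\<forall>d\<in>?D. conj_by T d u \<in> ?D \<and> conj_by T d (inv\<^bsub>T\<^esub> u) \<in> ?D"
    if u: "u \<in> {tens g h | g h. g \<in> carrier G \<and> h \<in> carrier G} \<union> hat ` carrier G" for u
  proof -
    obtain w where "w \<in> carrier G" "u \<in> carrier T"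
      "\<And>g. g \<in> carrier G \<Longrightarrow> conj_by T (tens g g) u = tens (conj_by G g w) (conj_by G g w)"
      using u
    proof (elim UnE)
      assume "u \<in> {tens g h | g h. g \<in> carrier G \<and> h \<in> carrier G}"
      then obtain g1 h1 where "u = tens g1 h1" "g1 \<in> carrier G" "h1 \<in> carrier G" by auto
      then show thesis
        by (intro that[of "commutator G g1 h1"]) (simp_all add: tens_conj_tens)
    next
      assume "u \<in> hat ` carrier G"
      then obtain k where "u = hat k" "k \<in> carrier G" by auto
      then show thesis
        by (intro that[of "k [^] q"]) (simp_all add: tens_conj_hat)
    qed
    then show ?thesis using twisted by blast
  qed
  have "\<forall>d\<in>?D. conj_by T d u \<in> ?D \<and> conj_by T d (inv\<^bsub>T\<^esub> u) \<in> ?D" if "u \<in> carrier T" for u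
    using that[unfolded gen]
  proof (induction u rule: generate.induct)
    case one
    show ?case by auto
  next
    case (incl u)
    then show ?case by (rule generator)
  next
    case (inv u)
    then have "u \<in> carrier T" by auto
    then show ?case using generator[OF inv] by simp
  next
    case (eng u v)
    then have uv: "u \<in> carrier T" "v \<in> carrier T" by (simp_all add: gen)
    show ?case
    proof
      fix d assume d: "d \<in> ?D"
      then have "d \<in> carrier T" by auto
      then have "conj_by T d (u \<otimes>\<^bsub>T\<^esub> v) = conj_by T (conj_by T d u) v"
        "conj_by T d (inv\<^bsub>T\<^esub> (u \<otimes>\<^bsub>T\<^esub> v)) = conj_by T (conj_by T d (inv\<^bsub>T\<^esub> v)) (inv\<^bsub>T\<^esub> u)"
        using uv by (simp_all add: T.conj_by_conj_by T.inv_mult_group)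
      then show "conj_by T d (u \<otimes>\<^bsub>T\<^esub> v) \<in> ?D \<and> conj_by T d (inv\<^bsub>T\<^esub> (u \<otimes>\<^bsub>T\<^esub> v)) \<in> ?D"
        using eng.IH d by simp
    qed
  qed
  then have "\<And>d u. d \<in> ?D \<Longrightarrow> u \<in> carrier T \<Longrightarrow> conj_by T d (inv\<^bsub>T\<^esub> u) \<in> ?D"
    by blast
  then show ?thesis
    by (intro T.normal_generateI) (auto simp: conj_by_def)
qed

end

section \<open>The \<open>q\<close>-exterior square as a crossed module\<close>

text \<open>The action \<open>act\<close> and the boundary \<open>del\<close> are parameters because they cannot be defined from the relations
  alone; the \<open>q\<close>-exterior square obtains them from its universal property. The last assumption is there because
  for \<open>q = 0\<close> the relations do not force \<open>hat\<close> to be trivial.\<close>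

locale q_exterior = q_pairing +
  fixes act :: "'a \<Rightarrow> 'c \<Rightarrow> 'c" and del :: "'c \<Rightarrow> 'a"
  assumes tens_self [simp]: "g \<in> carrier G \<Longrightarrow> tens g g = \<one>\<^bsub>T\<^esub>"
    and generated: "carrier T = generate T ({tens g h | g h. g \<in> carrier G \<and> h \<in> carrier G} \<union> hat ` carrier G)"
    and act_hom: "x \<in> carrier G \<Longrightarrow> act x \<in> hom T T"
    and act_tens: "x \<in> carrier G \<Longrightarrow> g \<in> carrier G \<Longrightarrow> h \<in> carrier G \<Longrightarrow>
      act x (tens g h) = tens (conj_by G g x) (conj_by G h x)"
    and act_hat: "x \<in> carrier G \<Longrightarrow> k \<in> carrier G \<Longrightarrow> act x (hat k) = hat (conj_by G k x)"
    and del_hom: "del \<in> hom T G"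
    and del_tens: "g \<in> carrier G \<Longrightarrow> h \<in> carrier G \<Longrightarrow> del (tens g h) = commutator G g h"
    and del_hat: "k \<in> carrier G \<Longrightarrow> del (hat k) = k [^] q"
    and hat_trivial: "q = 0 \<Longrightarrow> k \<in> carrier G \<Longrightarrow> hat k = \<one>\<^bsub>T\<^esub>"
begin

sublocale del: group_hom T G del
  using del_hom by unfold_locales

lemma act_group_hom: "x \<in> carrier G \<Longrightarrow> group_hom T T (act x)"
  using act_hom by (simp add: group_hom_def group_hom_axioms_def T.group_axioms)

lemma act_closed [simp]: "x \<in> carrier G \<Longrightarrow> t \<in> carrier T \<Longrightarrow> act x t \<in> carrier T"
  using group_hom.hom_closed[OF act_group_hom] .

lemma act_mult: "x \<in> carrier G \<Longrightarrow> t \<in> carrier T \<Longrightarrow> u \<in> carrier T \<Longrightarrow> act x (t \<otimes>\<^bsub>T\<^esub> u) = act x t \<otimes>\<^bsub>T\<^esub> act x u"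
  using group_hom.hom_mult[OF act_group_hom] .

lemma act_inv: "x \<in> carrier G \<Longrightarrow> t \<in> carrier T \<Longrightarrow> act x (inv\<^bsub>T\<^esub> t) = inv\<^bsub>T\<^esub> act x t"
  using group_hom.hom_inv[OF act_group_hom] .

lemma act_pow: "x \<in> carrier G \<Longrightarrow> t \<in> carrier T \<Longrightarrow> act x (t [^]\<^bsub>T\<^esub> (i::nat)) = act x t [^]\<^bsub>T\<^esub> i"
  using group_hom.hom_nat_pow[OF act_group_hom] .

lemma subgroup_eq_carrierI:
  assumes "subgroup H T" "\<And>g h. g \<in> carrier G \<Longrightarrow> h \<in> carrier G \<Longrightarrow> tens g h \<in> H"
    "\<And>k. k \<in> carrier G \<Longrightarrow> hat k \<in> H" "t \<in> carrier T"
  shows "t \<in> H"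
proof -
  have "{tens g h | g h. g \<in> carrier G \<and> h \<in> carrier G} \<union> hat ` carrier G \<subseteq> H"
    using assms(2,3) by auto
  from T.generate_subgroup_incl[OF this assms(1)] show ?thesis
    using assms(4) generated by auto
qed

lemma hom_eqI:
  assumes "group H" "f1 \<in> hom T H" "f2 \<in> hom T H"
    and "\<And>g h. g \<in> carrier G \<Longrightarrow> h \<in> carrier G \<Longrightarrow> f1 (tens g h) = f2 (tens g h)"
    and "\<And>k. k \<in> carrier G \<Longrightarrow> f1 (hat k) = f2 (hat k)"
    and "t \<in> carrier T"
  shows "f1 t = f2 t"
proof -
  interpret f1: group_hom T H f1 using assms by (simp add: group_hom_def group_hom_axioms_def)
  interpret f2: group_hom T H f2 using assms by (simp add: group_hom_def group_hom_axioms_def)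
  have "subgroup {t \<in> carrier T. f1 t = f2 t} T"
    by unfold_locales auto
  from subgroup_eq_carrierI[OF this _ _ assms(6)] show ?thesis
    using assms(4,5) by simp
qed

lemma act_act:
  assumes x: "x \<in> carrier G" and y: "y \<in> carrier G" and t: "t \<in> carrier T"
  shows "act y (act x t) = act (x \<otimes> y) t"
proof (rule hom_eqI[OF T.group_axioms _ act_hom _ _ t])
  show "(\<lambda>t. act y (act x t)) \<in> hom T T"
    using x y by (simp add: hom_def act_mult)
qed (use x y in \<open>simp_all add: act_tens act_hat conj_by_conj_by\<close>)

lemma act_one [simp]: "t \<in> carrier T \<Longrightarrow> act \<one> t = t"
  by (rule hom_eqI[OF T.group_axioms act_hom]) (simp_all add: act_tens act_hat hom_def)

lemma del_act:
  assumes x: "x \<in> carrier G" and t: "t \<in> carrier T"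
  shows "del (act x t) = conj_by G (del t) x"
proof (rule hom_eqI[OF G.group_axioms _ _ _ _ t])
  show "(\<lambda>t. del (act x t)) \<in> hom T G" "(\<lambda>t. conj_by G (del t) x) \<in> hom T G"
    using x by (simp_all add: hom_def act_mult conj_by_mult)
  show "del (act x (tens g h)) = conj_by G (del (tens g h)) x" if "g \<in> carrier G" "h \<in> carrier G" for g h
    using that x by (simp add: act_tens del_tens) (simp add: conj_by_def commutator_def word_simps)
  show "del (act x (hat k)) = conj_by G (del (hat k)) x" if "k \<in> carrier G" for k
    using that x group_hom.hom_nat_pow[of G G "\<lambda>y. conj_by G y x"]
    by (simp add: act_hat del_hat group_hom_def group_hom_axioms_def conj_by_hom)
qed

lemma tens_swap:
  assumes "g \<in> carrier G" "h \<in> carrier G"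
  shows "tens h g = inv\<^bsub>T\<^esub> tens g h"
proof -
  let ?s = "tens g h \<otimes>\<^bsub>T\<^esub> tens h g"
  have "tens (g \<otimes> h) h = act h (tens g h)"
    using assms by (simp add: tens_mult_left act_tens)
  moreover have "tens (g \<otimes> h) g = tens h g"
    using assms by (simp add: tens_mult_left)
  moreover have "tens (g \<otimes> h) (g \<otimes> h) = tens (g \<otimes> h) h \<otimes>\<^bsub>T\<^esub> act h (tens (g \<otimes> h) g)"
    using assms by (simp only: tens_mult_right act_tens m_closed)
  ultimately have "act h ?s = \<one>\<^bsub>T\<^esub>"
    using assms by (simp add: act_mult)
  then have "act (inv h) (act h ?s) = act (inv h) \<one>\<^bsub>T\<^esub>"
    using assms by simp
  then have "?s = \<one>\<^bsub>T\<^esub>"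
    using assms group_hom.hom_one[OF act_group_hom] by (simp add: act_act)
  then show ?thesis
    using assms by (metis T.inv_equality T.inv_inv tens_closed)
qed

text \<open>These are, up to conjugation, the factors by which \<open>hat (k \<otimes> d)\<close> differs from \<open>hat k \<otimes> hat d\<close> for
  \<open>d = commutator G k x\<close>. They are computable because \<open>d\<close> acts on all \<open>tens a b\<close> as conjugation by
  \<open>tens k x\<close>.\<close>

lemma tens_inv_commutator_pow:
  fixes i :: nat
  assumes k: "k \<in> carrier G" and x: "x \<in> carrier G"
  shows "tens k (inv (commutator G k x [^] i))
    = act k (tens k x [^]\<^bsub>T\<^esub> i) \<otimes>\<^bsub>T\<^esub> inv\<^bsub>T\<^esub> (tens k x [^]\<^bsub>T\<^esub> i)"
proof -
  define c d where "c = tens k x" and "d = commutator G k x"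
  have c: "c \<in> carrier T" and d: "d \<in> carrier G" using k x by (simp_all add: c_def d_def)
  have act_d: "act d (tens a b) = conj_by T (tens a b) c" if "a \<in> carrier G" "b \<in> carrier G" for a b
    using that k x by (simp add: c_def d_def act_tens tens_conj_tens)
  have act_pow: "act (d [^] j) (tens a b) = conj_by T (tens a b) (c [^]\<^bsub>T\<^esub> j)"
    if "a \<in> carrier G" "b \<in> carrier G" for a b and j :: nat
    using that
  proof (induction j)
    case (Suc j)
    have "act (d [^] Suc j) (tens a b) = act d (act (d [^] j) (tens a b))"
      using d Suc.prems by (simp add: act_act)
    also have "\<dots> = conj_by T (act (d [^] j) (tens a b)) c"
      using d Suc.prems by (simp add: act_tens[of "d [^] j"] act_d)
    also have "\<dots> = conj_by T (tens a b) (c [^]\<^bsub>T\<^esub> Suc j)"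
      using Suc c by (simp add: T.conj_by_conj_by)
    finally show ?case .
  qed simp
  have pow: "tens k (d [^] j) = inv\<^bsub>T\<^esub> act k (c [^]\<^bsub>T\<^esub> j) \<otimes>\<^bsub>T\<^esub> c [^]\<^bsub>T\<^esub> j" for j :: nat
  proof (induction j)
    case 0
    show ?case using k group_hom.hom_one[OF act_group_hom[OF k]] by simp
  next
    case (Suc j)
    have "tens k (d [^] j \<otimes> d) = tens k d \<otimes>\<^bsub>T\<^esub> act d (tens k (d [^] j))"
      using k d by (simp only: tens_mult_right act_tens G.nat_pow_closed)
    also have "tens k d = inv\<^bsub>T\<^esub> act k c \<otimes>\<^bsub>T\<^esub> c"
      using k x by (simp add: d_def c_def tens_commutator_right act_tens)
    also have "act d (tens k (d [^] j)) = conj_by T (tens k (d [^] j)) c"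
      using act_d k d by simp
    finally show ?case
      using c k by (simp add: Suc conj_by_def[of T] act_mult T.word_simps)
  qed
  let ?D = "d [^] i" and ?C = "c [^]\<^bsub>T\<^esub> i"
  have D: "?D \<in> carrier G" and C: "?C \<in> carrier T" using c d by simp_all
  have "\<one>\<^bsub>T\<^esub> = tens k (inv ?D \<otimes> ?D)"
    using k D by simp
  also have "\<dots> = tens k ?D \<otimes>\<^bsub>T\<^esub> act ?D (tens k (inv ?D))"
    using k D by (simp only: tens_mult_right act_tens inv_closed)
  also have "\<dots> = inv\<^bsub>T\<^esub> act k ?C \<otimes>\<^bsub>T\<^esub> (tens k (inv ?D) \<otimes>\<^bsub>T\<^esub> ?C)"
    using k C D pow act_pow by (simp add: conj_by_def[of T] T.word_simps)
  finally have "act k ?C = tens k (inv ?D) \<otimes>\<^bsub>T\<^esub> ?C"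
    using k C D by (metis T.inv_solve_left T.m_closed T.one_closed T.r_one act_closed inv_closed tens_closed)
  then show ?thesis
    using k C D by (simp add: T.m_assoc flip: c_def d_def)
qed

text \<open>Since \<open>conj_by G k x = k \<otimes> commutator G k x\<close>, the relation for \<open>hat\<close> of a product applies. By
  the preceding lemma its partial products telescope against
  \<open>tens (k\<^sup>q) x = a\<^sub>q\<^sub>-\<^sub>1 \<otimes> \<dots> \<otimes> a\<^sub>0\<close>, where \<open>a\<^sub>j = act (k\<^sup>j) (tens k x)\<close>, leaving
  only \<open>(tens k x)\<^sup>-\<^sup>q\<close>, which cancels \<open>hat (commutator G k x)\<close>.\<close>

lemma hat_conj:
  assumes k: "k \<in> carrier G" and x: "x \<in> carrier G"
  shows "hat (conj_by G k x) = hat k \<otimes>\<^bsub>T\<^esub> tens (k [^] q) x"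
proof -
  define c d where "c = tens k x" and "d = commutator G k x"
  have c: "c \<in> carrier T" and d: "d \<in> carrier G" using k x by (simp_all add: c_def d_def)
  have hat_d: "hat d = c [^]\<^bsub>T\<^esub> q"
    using k x by (simp add: c_def d_def hat_of_commutator)
  have "conj_by G k x = k \<otimes> d"
    using k x by (simp add: d_def conj_by_def commutator_def word_simps)
  then have expand: "hat (conj_by G k x) = hat k \<otimes>\<^bsub>T\<^esub> list_prod T (power_factors G q tens k d) \<otimes>\<^bsub>T\<^esub> c [^]\<^bsub>T\<^esub> q"
    using k d by (simp add: hat_mult hat_d)
  show ?thesis
  proof (cases q)
    case 0
    then show ?thesis using expand k x by simp
  next
    case (Suc p)
    define a where "a j = act (k [^] j) c" for j :: nat
    define D where "D j = tens (k [^] j) x" for j :: nat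
    define f where "f i = tens (conj_by G k (k [^] (p - i))) (conj_by G (inv (d [^] i)) (k [^] (p - i)))" for i
    have a: "a j \<in> carrier T" and D: "D j \<in> carrier T" and f: "f j \<in> carrier T" for j
      using k x c d by (simp_all add: a_def D_def f_def)
    have D_Suc: "D (Suc j) = a j \<otimes>\<^bsub>T\<^esub> D j" for j
    proof -
      have "k [^] Suc j = k \<otimes> k [^] j"
        using k by (simp only: nat_pow_Suc2)
      then show ?thesis
        using k x by (simp only: D_def a_def c_def) (simp add: tens_mult_left act_tens)
    qed
    have f_eq: "f i = a (Suc (p - i)) [^]\<^bsub>T\<^esub> i \<otimes>\<^bsub>T\<^esub> inv\<^bsub>T\<^esub> (a (p - i) [^]\<^bsub>T\<^esub> i)" for i
    proof -
      have "f i = act (k [^] (p - i)) (tens k (inv (d [^] i)))"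
        using k d by (simp add: f_def act_tens)
      also have "\<dots> = act (k [^] (p - i)) (act k c [^]\<^bsub>T\<^esub> i \<otimes>\<^bsub>T\<^esub> inv\<^bsub>T\<^esub> (c [^]\<^bsub>T\<^esub> i))"
        using tens_inv_commutator_pow[OF k x, of i] k c by (simp add: act_pow flip: c_def d_def)
      also have "act (k [^] (p - i)) (act k c) = a (Suc (p - i))"
        using k c nat_pow_Suc2[OF k, of "p - i"] by (simp add: a_def act_act)
      ultimately show ?thesis
        using k c by (simp add: act_mult act_inv act_pow a_def)
    qed
    have P: "list_prod T (map f is) \<in> carrier T" for "is"
      using f by (intro T.list_prod_closed) auto
    have partial: "list_prod T (map f [1..<Suc j])
        = D q \<otimes>\<^bsub>T\<^esub> inv\<^bsub>T\<^esub> D (q - j) \<otimes>\<^bsub>T\<^esub> inv\<^bsub>T\<^esub> (a (p - j) [^]\<^bsub>T\<^esub> j)" if "j \<le> p" for j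
      using that
    proof (induction j)
      case 0
      then show ?case using D by simp
    next
      case (Suc j)
      then obtain r where r: "p - j = Suc r" "p - Suc j = r" "q - j = Suc (Suc r)" "q - Suc j = Suc r"
        using \<open>q = Suc p\<close> by (metis Suc_diff_Suc Suc_diff_le Suc_leD Suc_le_lessD diff_Suc_Suc)
      have pow: "a (Suc r) [^]\<^bsub>T\<^esub> Suc j = a (Suc r) [^]\<^bsub>T\<^esub> j \<otimes>\<^bsub>T\<^esub> a (Suc r)" by simp
      have "list_prod T (map f [1..<Suc (Suc j)]) = list_prod T (map f [1..<Suc j]) \<otimes>\<^bsub>T\<^esub> f (Suc j)"
        using f by (subst T.list_prod_upt_Suc) simp_all
      also have "\<dots> = D q \<otimes>\<^bsub>T\<^esub> inv\<^bsub>T\<^esub> (a (Suc r) \<otimes>\<^bsub>T\<^esub> D (Suc r)) \<otimes>\<^bsub>T\<^esub> inv\<^bsub>T\<^esub> (a (Suc r) [^]\<^bsub>T\<^esub> j)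
          \<otimes>\<^bsub>T\<^esub> (a (Suc r) [^]\<^bsub>T\<^esub> j \<otimes>\<^bsub>T\<^esub> a (Suc r) \<otimes>\<^bsub>T\<^esub> inv\<^bsub>T\<^esub> (a r [^]\<^bsub>T\<^esub> Suc j))"
        using Suc r f_eq[of "Suc j"] D_Suc[of "Suc r"] pow by simp
      also have "\<dots> = D q \<otimes>\<^bsub>T\<^esub> inv\<^bsub>T\<^esub> D (Suc r) \<otimes>\<^bsub>T\<^esub> inv\<^bsub>T\<^esub> (a r [^]\<^bsub>T\<^esub> Suc j)"
        using a D T.nat_pow_closed by (simp add: T.word_simps)
      finally show ?case by (simp only: r)
    qed
    have "a 0 = c" "D (Suc 0) = c" "D q = tens (k [^] q) x"
      using c k x by (simp_all add: a_def D_def c_def)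
    moreover from this have "list_prod T (map f [1..<q]) \<otimes>\<^bsub>T\<^esub> c [^]\<^bsub>T\<^esub> q = D q \<otimes>\<^bsub>T\<^esub> inv\<^bsub>T\<^esub> c \<otimes>\<^bsub>T\<^esub> inv\<^bsub>T\<^esub> (c [^]\<^bsub>T\<^esub> p) \<otimes>\<^bsub>T\<^esub> (c [^]\<^bsub>T\<^esub> p \<otimes>\<^bsub>T\<^esub> c)"
      using partial[of p] Suc by simp
    moreover have "D q \<otimes>\<^bsub>T\<^esub> inv\<^bsub>T\<^esub> c \<otimes>\<^bsub>T\<^esub> inv\<^bsub>T\<^esub> (c [^]\<^bsub>T\<^esub> p) \<otimes>\<^bsub>T\<^esub> (c [^]\<^bsub>T\<^esub> p \<otimes>\<^bsub>T\<^esub> c) = D q"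
      using c D by (simp add: T.word_simps)
    ultimately have "list_prod T (map f [1..<q]) \<otimes>\<^bsub>T\<^esub> c [^]\<^bsub>T\<^esub> q = tens (k [^] q) x" by simp
    moreover have "hat (conj_by G k x) = hat k \<otimes>\<^bsub>T\<^esub> (list_prod T (map f [1..<q]) \<otimes>\<^bsub>T\<^esub> c [^]\<^bsub>T\<^esub> q)"
      using expand k c P[of "[1..<q]"] by (simp add: f_def[abs_def] Suc T.m_assoc del: upt_Suc T.nat_pow_Suc)
    ultimately show ?thesis by simp
  qed
qed

text \<open>Both sides are homomorphisms in \<open>t\<close> and compatible with products in \<open>u\<close>, so it suffices to check
  generators. For \<open>t = tens g h\<close> the claim is a relation or \<open>tens_conj_tens\<close>. For \<open>t = hat k\<close>, the left side is
  \<open>hat k \<otimes> commutator T (hat k) u\<close>, the right side is given by \<open>hat_conj\<close>, and the two agree by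
  \<open>tens_commutator_right\<close> or by the relation for commutators of hats.\<close>

theorem peiffer:
  assumes t: "t \<in> carrier T" and u: "u \<in> carrier T"
  shows "conj_by T t u = act (del u) t"
proof -
  let ?H = "{u \<in> carrier T. \<forall>t\<in>carrier T. conj_by T t u = act (del u) t}"
  have "subgroup ?H T"
  proof unfold_locales
    fix u v assume u: "u \<in> ?H" and v: "v \<in> ?H"
    then have uv: "u \<in> carrier T" "v \<in> carrier T" by simp_all
    have "conj_by T t (u \<otimes>\<^bsub>T\<^esub> v) = act (del (u \<otimes>\<^bsub>T\<^esub> v)) t" if t: "t \<in> carrier T" for t
    proof -
      have "conj_by T t (u \<otimes>\<^bsub>T\<^esub> v) = conj_by T (conj_by T t u) v"
        using t uv by (simp add: T.conj_by_conj_by)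
      also have "\<dots> = act (del v) (act (del u) t)"
        using t u v by simp
      also have "\<dots> = act (del (u \<otimes>\<^bsub>T\<^esub> v)) t"
        using t u v by (simp add: act_act)
      finally show ?thesis .
    qed
    then show "u \<otimes>\<^bsub>T\<^esub> v \<in> ?H" using u v by simp
  next
    fix u assume u: "u \<in> ?H"
    then have uc: "u \<in> carrier T" by simp
    have "conj_by T t (inv\<^bsub>T\<^esub> u) = act (del (inv\<^bsub>T\<^esub> u)) t" if t: "t \<in> carrier T" for t
    proof -
      have "conj_by T (act (inv (del u)) t) u = t"
        using u t by (simp add: act_act)
      moreover have "conj_by T (conj_by T (act (inv (del u)) t) u) (inv\<^bsub>T\<^esub> u) = act (inv (del u)) t"
        using uc t by (simp add: T.conj_by_conj_by)
      ultimately show ?thesis using uc by simp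
    qed
    then show "inv\<^bsub>T\<^esub> u \<in> ?H" using u by simp
  qed auto
  moreover have "tens g h \<in> ?H" if gh: "g \<in> carrier G" "h \<in> carrier G" for g h
  proof -
    let ?u = "tens g h" and ?d = "commutator G g h"
    have "conj_by T t ?u = act ?d t" if "t \<in> carrier T" for t
    proof (rule hom_eqI[OF T.group_axioms T.conj_by_hom act_hom _ _ that])
      fix k assume k: "k \<in> carrier G"
      let ?K = "k [^] q"
      have "conj_by T (hat k) ?u = hat k \<otimes>\<^bsub>T\<^esub> (inv\<^bsub>T\<^esub> conj_by T ?u (hat k) \<otimes>\<^bsub>T\<^esub> ?u)"
        using gh k by (simp add: conj_by_def[of T] T.word_simps)
      also have "\<dots> = hat k \<otimes>\<^bsub>T\<^esub> tens ?K ?d"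
        using gh k by (simp add: tens_conj_hat tens_commutator_right)
      finally show "conj_by T (hat k) ?u = act ?d (hat k)"
        using gh k by (simp add: act_hat hat_conj)
    qed (use gh in \<open>simp_all add: tens_conj_tens act_tens\<close>)
    then show ?thesis using gh by (simp add: del_tens)
  qed
  moreover have "hat k \<in> ?H" if k: "k \<in> carrier G" for k
  proof -
    have "conj_by T t (hat k) = act (k [^] q) t" if "t \<in> carrier T" for t
    proof (rule hom_eqI[OF T.group_axioms T.conj_by_hom act_hom _ _ that])
      fix k1 assume k1: "k1 \<in> carrier G"
      have "conj_by T (hat k1) (hat k) = hat k1 \<otimes>\<^bsub>T\<^esub> commutator T (hat k1) (hat k)"
        using k k1 by (simp add: conj_by_def commutator_def T.word_simps)
      then show "conj_by T (hat k1) (hat k) = act (k [^] q) (hat k1)"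
        using k k1 by (simp add: hat_commutator act_hat hat_conj)
    qed (use k in \<open>simp_all add: tens_conj_hat act_tens\<close>)
    then show ?thesis using k by (simp add: del_hat)
  qed
  ultimately have "u \<in> ?H"
    using subgroup_eq_carrierI u by blast
  then show ?thesis using t by simp
qed

text \<open>In the expansion of \<open>hat (k \<otimes> inv k) = \<one>\<close> all factors in between are conjugates of \<open>tens k (k\<^sup>i)\<close>, which
  is trivial because \<open>tens k k\<close> is.\<close>

lemma hat_inv:
  assumes k: "k \<in> carrier G"
  shows "hat (inv k) = inv\<^bsub>T\<^esub> hat k"
proof -
  have "tens (conj_by G k (k [^] r)) (conj_by G (inv (inv k [^] i)) (k [^] r)) = \<one>\<^bsub>T\<^esub>" for r i :: nat
  proof -
    have "tens k (k [^] i) = \<one>\<^bsub>T\<^esub>"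
    proof (induction i)
      case (Suc i)
      have "tens k (k [^] i \<otimes> k) = tens k k \<otimes>\<^bsub>T\<^esub> act k (tens k (k [^] i))"
        using k by (simp only: tens_mult_right act_tens G.nat_pow_closed)
      then show ?case
        using k Suc group_hom.hom_one[OF act_group_hom[OF k]] by simp
    qed (use k in simp)
    then have "act (k [^] r) (tens k (k [^] i)) = \<one>\<^bsub>T\<^esub>"
      using k group_hom.hom_one[OF act_group_hom] by simp
    then show ?thesis using k by (simp add: act_tens nat_pow_inv)
  qed
  then have "list_prod T (power_factors G q tens k (inv k)) = \<one>\<^bsub>T\<^esub>"
    by (intro T.list_prod_ones) auto
  then have "hat k \<otimes>\<^bsub>T\<^esub> hat (inv k) = \<one>\<^bsub>T\<^esub>"
    using hat_mult[OF k, of "inv k"] k by simp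
  then show ?thesis
    using k by (metis T.inv_equality T.inv_inv hat_closed inv_closed)
qed

end

section \<open>Products of powers of commuting elements\<close>

context group
begin

lemma centralizer_subgroup:
  assumes "S \<subseteq> carrier G"
  shows "subgroup {w \<in> carrier G. \<forall>v\<in>S. w \<otimes> v = v \<otimes> w} G"
proof unfold_locales
  fix w v assume w: "w \<in> {w \<in> carrier G. \<forall>v\<in>S. w \<otimes> v = v \<otimes> w}" and v: "v \<in> {w \<in> carrier G. \<forall>v\<in>S. w \<otimes> v = v \<otimes> w}"
  have "w \<otimes> v \<otimes> s = s \<otimes> (w \<otimes> v)" if s: "s \<in> S" for s
  proof -
    have sc: "s \<in> carrier G" "w \<in> carrier G" "v \<in> carrier G" using s assms w v by auto
    have "w \<otimes> v \<otimes> s = w \<otimes> (s \<otimes> v)" using sc v s by (simp add: m_assoc)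
    also have "\<dots> = s \<otimes> (w \<otimes> v)" using sc w s by (simp flip: m_assoc)
    finally show ?thesis .
  qed
  then show "w \<otimes> v \<in> {w \<in> carrier G. \<forall>v\<in>S. w \<otimes> v = v \<otimes> w}" using w v by simp
next
  fix w assume w: "w \<in> {w \<in> carrier G. \<forall>v\<in>S. w \<otimes> v = v \<otimes> w}"
  have "inv w \<otimes> s = s \<otimes> inv w" if s: "s \<in> S" for s
  proof -
    have sc: "s \<in> carrier G" "w \<in> carrier G" using s assms w by auto
    have "inv w \<otimes> (s \<otimes> w) = inv w \<otimes> (w \<otimes> s)" using w s by simp
    then show ?thesis using sc by (simp add: inv_cancel_left inv_solve_right flip: m_assoc)
  qed
  then show "inv w \<in> {w \<in> carrier G. \<forall>v\<in>S. w \<otimes> v = v \<otimes> w}" using w by simp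
qed (use assms in auto)

lemma subgroup_list_prod: "subgroup H G \<Longrightarrow> set xs \<subseteq> H \<Longrightarrow> list_prod G xs \<in> H"
  by (induction xs) (auto simp: subgroup.one_closed subgroup.m_closed)

lemma commuting_int_powers:
  assumes "x \<in> carrier G" "y \<in> carrier G" "x \<otimes> y = y \<otimes> x"
  shows "x [^] (i::int) \<otimes> y [^] (j::int) = y [^] j \<otimes> x [^] i"
proof -
  have 1: "x [^] i \<otimes> y = y \<otimes> x [^] i"
    using subgroup_int_pow_closed[OF centralizer_subgroup[of "{y}"], of x i] assms by simp
  show ?thesis
    using subgroup_int_pow_closed[OF centralizer_subgroup[of "{x [^] i}"], of y j] assms 1 by simp
qed

lemma list_prod_int_pow_mult:
  fixes k k' :: "'i \<Rightarrow> int"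
  assumes "\<And>i. i \<in> set is \<Longrightarrow> z i \<in> carrier G"
    and "\<And>i j. i \<in> set is \<Longrightarrow> j \<in> set is \<Longrightarrow> z i \<otimes> z j = z j \<otimes> z i"
  shows "list_prod G (map (\<lambda>i. z i [^] k i) is) \<otimes> list_prod G (map (\<lambda>i. z i [^] k' i) is)
    = list_prod G (map (\<lambda>i. z i [^] (k i + k' i)) is)"
  using assms
proof (induction "is")
  case (Cons i "is")
  let ?P = "\<lambda>k. list_prod G (map (\<lambda>i. z i [^] k i) is)"
  have z: "z i \<in> carrier G" and P: "?P k \<in> carrier G" for k :: "'i \<Rightarrow> int"
    using Cons.prems(1) by (auto intro!: list_prod_closed)
  have "?P k \<in> {w \<in> carrier G. \<forall>v\<in>{z i [^] k' i}. w \<otimes> v = v \<otimes> w}"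
    using Cons.prems z
    by (intro subgroup_list_prod[OF centralizer_subgroup]) (auto simp: commuting_int_powers)
  then have comm: "?P k \<otimes> z i [^] k' i = z i [^] k' i \<otimes> ?P k" by simp
  have "(z i [^] k i \<otimes> ?P k) \<otimes> (z i [^] k' i \<otimes> ?P k') = z i [^] k i \<otimes> (?P k \<otimes> z i [^] k' i) \<otimes> ?P k'"
    using z P by (simp add: m_assoc)
  also have "\<dots> = (z i [^] k i \<otimes> z i [^] k' i) \<otimes> (?P k \<otimes> ?P k')"
    using z P unfolding comm by (simp add: m_assoc)
  also have "?P k \<otimes> ?P k' = ?P (\<lambda>i. k i + k' i)"
    by (rule Cons.IH) (simp_all add: Cons.prems)
  finally show ?case
    using z by (simp add: int_pow_mult)
qed simp

lemma subgroup_list_prod_int_pow: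
  assumes "\<And>i. i \<in> set is \<Longrightarrow> z i \<in> carrier G"
    and "\<And>i j. i \<in> set is \<Longrightarrow> j \<in> set is \<Longrightarrow> z i \<otimes> z j = z j \<otimes> z i"
  shows "subgroup (range (\<lambda>k. list_prod G (map (\<lambda>i. z i [^] (k i :: int)) is))) G" (is "subgroup (range ?P) G")
proof
  have P: "?P k \<in> carrier G" for k :: "_ \<Rightarrow> int"
    using assms(1) by (auto intro!: list_prod_closed)
  then show "range ?P \<subseteq> carrier G" by auto
  have mult: "?P k \<otimes> ?P k' = ?P (\<lambda>i. k i + k' i)" for k k' :: "_ \<Rightarrow> int"
    by (rule list_prod_int_pow_mult) (simp_all add: assms)
  then show "x \<otimes> y \<in> range ?P" if "x \<in> range ?P" "y \<in> range ?P" for x y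
    using that by (auto simp only: mult)
  have one: "?P (\<lambda>_. 0) = \<one>" by (intro list_prod_ones) auto
  then show "\<one> \<in> range ?P" by (simp only: flip: one) (rule rangeI)
  fix x assume "x \<in> range ?P"
  then obtain k where k: "x = ?P k" by auto
  have "?P (\<lambda>i. - k i) \<otimes> ?P k = \<one>"
    unfolding mult using one by simp
  then have "inv x = ?P (\<lambda>i. - k i)"
    using P k by (simp add: inv_equality)
  then show "inv x \<in> range ?P" by simp
qed

end


section \<open>Generation of free groups\<close>

lemma free_gen_in_carrier [simp]: "x \<in> X \<Longrightarrow> free_gen x \<in> carrier (free_group X)"
  by (simp add: free_group_def free_gen_def reduced_def)

lemma free_group_generated: "carrier (free_group X) = generate (free_group X) (free_gen ` X)"
proof
  interpret F: group "free_group X" by (rule group_free_group)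
  show "generate (free_group X) (free_gen ` X) \<subseteq> carrier (free_group X)"
    by (intro F.generate_incl) auto
  have letter: "[a] \<in> generate (free_group X) (free_gen ` X)" if "fst a \<in> X" for a
  proof (cases "snd a")
    case True
    then show ?thesis
      using that by (intro generate.incl image_eqI[of _ _ "fst a"]) (simp_all add: free_gen_def prod_eq_iff)
  next
    case False
    have "[a] \<otimes>\<^bsub>free_group X\<^esub> free_gen (fst a) = \<one>\<^bsub>free_group X\<^esub>"
      using False by (simp add: free_group_def free_gen_def letter_inv_def)
    moreover have "[a] \<in> carrier (free_group X)"
      using that by (simp add: free_group_def reduced_def)
    ultimately have "inv\<^bsub>free_group X\<^esub> (free_gen (fst a)) = [a]"
      using that by (intro F.inv_equality) auto
    then show ?thesis
      using generate.inv[of "free_gen (fst a)" "free_gen ` X" "free_group X"] that by simp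
  qed
  show "carrier (free_group X) \<subseteq> generate (free_group X) (free_gen ` X)"
  proof
    fix w assume "w \<in> carrier (free_group X)"
    then have "reduced w" "fst ` set w \<subseteq> X" by (simp_all add: free_group_def)
    then show "w \<in> generate (free_group X) (free_gen ` X)"
    proof (induction w)
      case Nil
      then show ?case using generate.one[of "free_group X"] by (simp add: free_group_def)
    next
      case (Cons a w)
      then have "[a] \<otimes>\<^bsub>free_group X\<^esub> w = a # w"
        by (simp add: free_group_def push_reduced)
      moreover have "w \<in> generate (free_group X) (free_gen ` X)"
        using Cons by (simp add: reduced_Cons)
      ultimately show ?case
        using generate.eng[OF letter[of a], of w] Cons.prems by simp
    qed
  qed
qed

lemma free_group_hom_eqI:
  assumes "group H" "f1 \<in> hom (free_group X) H" "f2 \<in> hom (free_group X) H"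
    and "\<And>x. x \<in> X \<Longrightarrow> f1 (free_gen x) = f2 (free_gen x)" and w: "w \<in> carrier (free_group X)"
  shows "f1 w = f2 w"
proof -
  interpret f1: group_hom "free_group X" H f1
    using assms by (simp add: group_hom_def group_hom_axioms_def group_free_group)
  interpret f2: group_hom "free_group X" H f2
    using assms by (simp add: group_hom_def group_hom_axioms_def group_free_group)
  have "subgroup {w \<in> carrier (free_group X). f1 w = f2 w} (free_group X)"
    by unfold_locales auto
  moreover have "free_gen ` X \<subseteq> {w \<in> carrier (free_group X). f1 w = f2 w}"
    using assms(4) by auto
  ultimately have "generate (free_group X) (free_gen ` X) \<subseteq> {w \<in> carrier (free_group X). f1 w = f2 w}"
    by (intro f1.G.generate_subgroup_incl)
  then show ?thesis
    using w free_group_generated[of X] by blast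
qed


section \<open>Realising the exterior square by commutators and powers over a free group\<close>

locale generated_q_exterior = q_exterior +
  fixes n :: nat and x :: "nat \<Rightarrow> 'a"
  assumes x_closed [simp]: "i \<in> {1..n} \<Longrightarrow> x i \<in> carrier G"
begin

text \<open>The triple \<open>(b, g, c)\<close> induces the permutation \<open>(a, t) \<mapsto> (a + b, c a \<otimes> act g t)\<close> of \<open>\<int>\<^sup>n \<times> T\<close>, and
  the product of two triples is the first permutation followed by the second. Keeping \<open>g\<close> as a
  component makes the projection to \<open>G\<close> a homomorphism.\<close>

definition W :: "((nat \<Rightarrow> int) \<times> 'a \<times> ((nat \<Rightarrow> int) \<Rightarrow> 'c)) monoid" where
  "W = \<lparr>carrier = {(b, g, c). g \<in> carrier G \<and> range c \<subseteq> carrier T},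
        monoid.mult = (\<lambda>(b, g, c) (b', g', c'). (b + b', g \<otimes> g', \<lambda>a. c' (a + b) \<otimes>\<^bsub>T\<^esub> act g' (c a))),
        one = (0, \<one>, \<lambda>_. \<one>\<^bsub>T\<^esub>)\<rparr>"

lemma carrier_W: "(b, g, c) \<in> carrier W \<longleftrightarrow> g \<in> carrier G \<and> (\<forall>a. c a \<in> carrier T)"
  by (auto simp: W_def)

lemma mult_W: "(b, g, c) \<otimes>\<^bsub>W\<^esub> (b', g', c') = (b + b', g \<otimes> g', \<lambda>a. c' (a + b) \<otimes>\<^bsub>T\<^esub> act g' (c a))"
  by (simp add: W_def)

lemma one_W: "\<one>\<^bsub>W\<^esub> = (0, \<one>, \<lambda>_. \<one>\<^bsub>T\<^esub>)"
  by (simp add: W_def)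

lemma group_W: "group W"
proof (rule groupI)
  show "\<one>\<^bsub>W\<^esub> \<in> carrier W" by (simp add: one_W carrier_W)
  fix w1 assume w1: "w1 \<in> carrier W"
  obtain b1 g1 c1 where 1: "w1 = (b1, g1, c1)" by (cases w1)
  have c1: "g1 \<in> carrier G" "\<And>a. c1 a \<in> carrier T" using w1 by (simp_all add: 1 carrier_W)
  show "\<one>\<^bsub>W\<^esub> \<otimes>\<^bsub>W\<^esub> w1 = w1"
    using c1 group_hom.hom_one[OF act_group_hom] by (simp add: 1 one_W mult_W)
  have "(- b1, inv g1, \<lambda>a. inv\<^bsub>T\<^esub> act (inv g1) (c1 (a - b1))) \<otimes>\<^bsub>W\<^esub> w1 = \<one>\<^bsub>W\<^esub>"
    using c1 by (simp add: 1 one_W mult_W act_inv act_act)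
  moreover have "(- b1, inv g1, \<lambda>a. inv\<^bsub>T\<^esub> act (inv g1) (c1 (a - b1))) \<in> carrier W"
    using c1 by (simp add: carrier_W)
  ultimately show "\<exists>y\<in>carrier W. y \<otimes>\<^bsub>W\<^esub> w1 = \<one>\<^bsub>W\<^esub>" by blast
  fix w2 assume w2: "w2 \<in> carrier W"
  obtain b2 g2 c2 where 2: "w2 = (b2, g2, c2)" by (cases w2)
  have c2: "g2 \<in> carrier G" "\<And>a. c2 a \<in> carrier T" using w2 by (simp_all add: 2 carrier_W)
  show "w1 \<otimes>\<^bsub>W\<^esub> w2 \<in> carrier W"
    using c1 c2 by (simp add: 1 2 mult_W carrier_W)
  fix w3 assume w3: "w3 \<in> carrier W"
  obtain b3 g3 c3 where 3: "w3 = (b3, g3, c3)" by (cases w3)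
  have c3: "g3 \<in> carrier G" "\<And>a. c3 a \<in> carrier T" using w3 by (simp_all add: 3 carrier_W)
  show "w1 \<otimes>\<^bsub>W\<^esub> w2 \<otimes>\<^bsub>W\<^esub> w3 = w1 \<otimes>\<^bsub>W\<^esub> (w2 \<otimes>\<^bsub>W\<^esub> w3)"
    using c1 c2 c3 by (simp add: 1 2 3 mult_W act_mult act_act m_assoc T.m_assoc add.assoc)
qed

sublocale W: group W by (rule group_W)

definition shift :: "(nat \<Rightarrow> int) \<times> 'a \<times> ((nat \<Rightarrow> int) \<Rightarrow> 'c) \<Rightarrow> nat \<Rightarrow> int" where
  "shift w = fst w"

definition proj :: "(nat \<Rightarrow> int) \<times> 'a \<times> ((nat \<Rightarrow> int) \<Rightarrow> 'c) \<Rightarrow> 'a" where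
  "proj w = fst (snd w)"

text \<open>Right multiplication by \<open>u\<close>: by the Peiffer identity, \<open>u \<otimes> act (del u) t = t \<otimes> u\<close>.\<close>

definition \<rho> :: "'c \<Rightarrow> (nat \<Rightarrow> int) \<times> 'a \<times> ((nat \<Rightarrow> int) \<Rightarrow> 'c)" where
  "\<rho> u = (0, del u, \<lambda>_. u)"

lemma proj_hom: "proj \<in> hom W G"
  by (auto simp: hom_def proj_def W_def)

sublocale proj: group_hom W G proj
  using proj_hom by unfold_locales

lemma shift_mult: "shift (w \<otimes>\<^bsub>W\<^esub> v) = shift w + shift v"
  by (cases w; cases v) (simp add: shift_def mult_W)

lemma shift_one: "shift \<one>\<^bsub>W\<^esub> = 0"
  by (simp add: shift_def one_W)

lemma shift_inv: "w \<in> carrier W \<Longrightarrow> shift (inv\<^bsub>W\<^esub> w) = - shift w"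
  by (metis W.l_inv add.inverse_unique add.commute shift_mult shift_one)

lemma shift_nat_pow: "w \<in> carrier W \<Longrightarrow> shift (w [^]\<^bsub>W\<^esub> (k::nat)) = (\<lambda>j. int k * shift w j)"
  by (induction k) (auto simp: shift_mult shift_one fun_eq_iff algebra_simps)

lemma shift_int_pow: "w \<in> carrier W \<Longrightarrow> shift (w [^]\<^bsub>W\<^esub> (k::int)) = (\<lambda>j. k * shift w j)"
  by (cases k rule: int_cases4) (auto simp: shift_nat_pow shift_inv W.int_pow_neg_int int_pow_int fun_eq_iff)

lemma \<rho>_hom: "\<rho> \<in> hom T W"
proof (rule homI)
  fix u v assume "u \<in> carrier T" "v \<in> carrier T"
  then show "\<rho> (u \<otimes>\<^bsub>T\<^esub> v) = \<rho> u \<otimes>\<^bsub>W\<^esub> \<rho> v"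
    by (simp add: \<rho>_def mult_W flip: peiffer) (simp add: conj_by_def T.word_simps)
qed (simp add: \<rho>_def carrier_W)

sublocale \<rho>: group_hom T W \<rho>
  using \<rho>_hom by unfold_locales

lemma \<rho>_eq_one: "\<rho> u = \<one>\<^bsub>W\<^esub> \<Longrightarrow> u = \<one>\<^bsub>T\<^esub>"
  by (simp add: \<rho>_def one_W fun_eq_iff)

lemma shift_\<rho>: "shift (\<rho> u) = 0"
  by (simp add: shift_def \<rho>_def)

lemma proj_\<rho>: "proj (\<rho> u) = del u"
  by (simp add: proj_def \<rho>_def)

lemma \<rho>_act:
  assumes u: "u \<in> carrier T" and w: "w \<in> carrier W"
  shows "\<rho> u \<otimes>\<^bsub>W\<^esub> w = w \<otimes>\<^bsub>W\<^esub> \<rho> (act (proj w) u)"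
proof (cases w)
  case (fields b g c)
  then have g: "g \<in> carrier G" "\<And>a. c a \<in> carrier T" using w by (simp_all add: carrier_W)
  have "act g u \<otimes>\<^bsub>T\<^esub> act (del (act g u)) (c a) = c a \<otimes>\<^bsub>T\<^esub> act g u" for a
    using g u by (simp flip: peiffer) (simp add: conj_by_def T.word_simps)
  then show ?thesis
    using g u by (simp add: fields \<rho>_def mult_W proj_def del_act) (simp add: conj_by_def word_simps)
qed

lemma conj_by_\<rho>:
  "u \<in> carrier T \<Longrightarrow> w \<in> carrier W \<Longrightarrow> conj_by W (\<rho> u) w = \<rho> (act (proj w) u)"
  by (simp add: conj_by_def \<rho>_act W.word_simps)

text \<open>The part of \<open>x\<^sub>1\<^bsup>a\<^sub>1\<^esup> \<dots> x\<^sub>n\<^bsup>a\<^sub>n\<^esup>\<close> that \<open>x\<^sub>i\<close> has to pass when it is multiplied from the right and moved to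
  its place.\<close>

definition tail :: "nat \<Rightarrow> (nat \<Rightarrow> int) \<Rightarrow> 'a" where
  "tail i a = list_prod G (map (\<lambda>k. x k [^] a k) [Suc i..<Suc n])"

definition unit :: "nat \<Rightarrow> nat \<Rightarrow> int" where
  "unit i = (\<lambda>j. if j = i then 1 else 0)"

text \<open>Collecting \<open>x\<^sub>1\<^bsup>a\<^sub>1\<^esup> \<dots> x\<^sub>n\<^bsup>a\<^sub>n\<^esup> t x\<^sub>i\<close>: moving \<open>x\<^sub>i\<close> to the left past \<open>t\<close> replaces \<open>t\<close> by \<open>act (x i) t\<close>, and
  moving it past the tail produces the commutator of the tail and \<open>x\<^sub>i\<close>.\<close>

definition X :: "nat \<Rightarrow> (nat \<Rightarrow> int) \<times> 'a \<times> ((nat \<Rightarrow> int) \<Rightarrow> 'c)" where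
  "X i = (unit i, x i, \<lambda>a. tens (tail i a) (x i))"

lemma powers_closed [simp]:
  "set is \<subseteq> {1..n} \<Longrightarrow> list_prod G (map (\<lambda>k. x k [^] (a k :: int)) is) \<in> carrier G"
  by (intro list_prod_closed) auto

lemma tail_closed [simp]: "tail i a \<in> carrier G"
  unfolding tail_def by (intro powers_closed) auto

lemma X_closed [simp]: "i \<in> {1..n} \<Longrightarrow> X i \<in> carrier W"
  by (simp add: X_def carrier_W)

lemma proj_X [simp]: "proj (X i) = x i"
  by (simp add: X_def proj_def)

lemma shift_X: "shift (X i) = unit i"
  by (simp add: X_def shift_def)

lemma tail_plus_unit:
  assumes "j \<le> i"
  shows "tail i (a + unit j) = tail i a"
  unfolding tail_def using assms by (intro arg_cong[where f = "list_prod G"] map_cong) (auto simp: unit_def)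

lemma tail_insert:
  assumes ij: "j < i" and i: "i \<in> {1..n}"
  shows "tail j (a + unit i) = tail j a \<otimes> x i \<otimes> commutator G (x i) (tail i a)"
proof -
  have split: "[Suc j..<Suc n] = [Suc j..<i] @ [i] @ [Suc i..<Suc n]"
    using upt_add_eq_append[of "Suc j" i "Suc n - i"] upt_conv_Cons[of i "Suc n"] ij i by simp
  define u where "u a = list_prod G (map (\<lambda>k. x k [^] a k) [Suc j..<i])" for a :: "nat \<Rightarrow> int"
  have u: "u a \<in> carrier G" for a
    unfolding u_def using i by (intro powers_closed) auto
  have tail_j: "tail j a = u a \<otimes> x i [^] a i \<otimes> tail i a" for a
  proof -
    have "tail j a = list_prod G (map (\<lambda>k. x k [^] a k) [Suc j..<i] @ map (\<lambda>k. x k [^] a k) ([i] @ [Suc i..<Suc n]))"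
      unfolding tail_def split by simp
    also have "\<dots> = u a \<otimes> list_prod G (map (\<lambda>k. x k [^] a k) ([i] @ [Suc i..<Suc n]))"
      unfolding u_def using i ij by (intro list_prod_append) auto
    also have "\<dots> = u a \<otimes> (x i [^] a i \<otimes> tail i a)"
      unfolding tail_def by simp
    finally show ?thesis using u i by (simp add: m_assoc)
  qed
  have "u (a + unit i) = u a"
    unfolding u_def by (intro arg_cong[where f = "list_prod G"] map_cong) (auto simp: unit_def)
  moreover have "x i [^] (a + unit i) i = x i [^] a i \<otimes> x i"
    using int_pow_mult[of "x i" "a i" 1] i by (simp add: unit_def)
  ultimately have "tail j (a + unit i) = u a \<otimes> (x i [^] a i \<otimes> x i) \<otimes> tail i a"
    using tail_j[of "a + unit i"] tail_plus_unit[of i i a] by simp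
  then show ?thesis
    using u i by (simp add: tail_j commutator_def word_simps)
qed

text \<open>The identity in \<open>T\<close> behind \<open>commutator_X_less\<close>. It holds because \<open>commutator G y m\<close> acts on
  \<open>tens (M \<otimes> y) z\<close> as conjugation by \<open>tens y m\<close>, and by \<open>tens_commutator_left\<close> the product of
  \<open>tens (commutator G y m) z\<close> with the last factor is \<open>tens m y\<close>.\<close>

lemma tens_exchange:
  assumes M: "M \<in> carrier G" and m: "m \<in> carrier G" and y: "y \<in> carrier G" and z: "z \<in> carrier G"
  shows "tens (M \<otimes> y \<otimes> commutator G y m) z \<otimes>\<^bsub>T\<^esub> act z (tens m y)
    = tens m y \<otimes>\<^bsub>T\<^esub> act y (tens M z) \<otimes>\<^bsub>T\<^esub> tens y z"
proof -
  let ?c = "tens y m" and ?s = "tens (M \<otimes> y) z"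
  have "tens (M \<otimes> y \<otimes> commutator G y m) z
      = conj_by T ?s ?c \<otimes>\<^bsub>T\<^esub> (inv\<^bsub>T\<^esub> ?c \<otimes>\<^bsub>T\<^esub> act z ?c)"
    using M m y z by (simp only: tens_mult_left[of "M \<otimes> y"] m_closed commutator_closed
        tens_commutator_left tens_conj_tens act_tens)
  then have "tens (M \<otimes> y \<otimes> commutator G y m) z \<otimes>\<^bsub>T\<^esub> act z (tens m y) = tens m y \<otimes>\<^bsub>T\<^esub> ?s"
    using M m y z by (simp add: tens_swap[of y m] act_inv conj_by_def[of T] T.word_simps)
  then show ?thesis
    using M m y z by (simp add: tens_mult_left act_tens T.m_assoc)
qed

text \<open>For \<open>j < i\<close> the permutation \<open>X j\<close> does not change the tail at \<open>i\<close>, while \<open>X i\<close> inserts \<open>x i\<close> into the tail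
  at \<open>j\<close>, as computed in \<open>tail_insert\<close>.\<close>

lemma commutator_X_less:
  assumes ij: "j < i" and i: "i \<in> {1..n}" and j: "j \<in> {1..n}"
  shows "X i \<otimes>\<^bsub>W\<^esub> X j = X j \<otimes>\<^bsub>W\<^esub> X i \<otimes>\<^bsub>W\<^esub> \<rho> (tens (x i) (x j))"
proof -
  let ?v = "tens (x i) (x j)"
  have "tens (tail j (a + unit i)) (x j) \<otimes>\<^bsub>T\<^esub> act (x j) (tens (tail i a) (x i))
      = ?v \<otimes>\<^bsub>T\<^esub> act (del ?v) (tens (tail i (a + unit j)) (x i) \<otimes>\<^bsub>T\<^esub> act (x i) (tens (tail j a) (x j)))" for a
  proof -
    have "tens (tail j (a + unit i)) (x j) \<otimes>\<^bsub>T\<^esub> act (x j) (tens (tail i a) (x i))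
        = tens (tail i a) (x i) \<otimes>\<^bsub>T\<^esub> act (x i) (tens (tail j a) (x j)) \<otimes>\<^bsub>T\<^esub> ?v" (is "_ = ?s \<otimes>\<^bsub>T\<^esub> ?v")
      using i j ij by (simp only: tail_insert tens_exchange tail_closed x_closed)
    also have "?s \<otimes>\<^bsub>T\<^esub> ?v = ?v \<otimes>\<^bsub>T\<^esub> conj_by T ?s ?v"
      using i j by (simp add: conj_by_def T.word_simps)
    also have "\<dots> = ?v \<otimes>\<^bsub>T\<^esub> act (del ?v) ?s"
      using i j by (simp add: peiffer)
    finally show ?thesis using ij by (simp add: tail_plus_unit)
  qed
  moreover have "x i \<otimes> x j = x j \<otimes> x i \<otimes> del ?v"
    using i j by (simp add: del_tens commutator_def word_simps)
  ultimately show ?thesis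
    by (simp add: X_def mult_W \<rho>_def add.commute)
qed

lemma commutator_X:
  assumes i: "i \<in> {1..n}" and j: "j \<in> {1..n}"
  shows "commutator W (X i) (X j) = \<rho> (tens (x i) (x j))"
proof -
  have less: "commutator W (X i) (X j) = \<rho> (tens (x i) (x j))"
    if "j < i" "i \<in> {1..n}" "j \<in> {1..n}" for i j
    using commutator_X_less[OF that] that
    by (simp add: commutator_def W.m_assoc W.inv_solve_left')
  consider "j < i" | "i = j" | "i < j" by linarith
  then show ?thesis
  proof cases
    case 1
    then show ?thesis using less i j by simp
  next
    case 2
    then show ?thesis using i by (simp add: commutator_def W.word_simps)
  next
    case 3
    have "commutator W (X i) (X j) = inv\<^bsub>W\<^esub> commutator W (X j) (X i)"
      using i j by (simp add: commutator_def W.word_simps)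
    then show ?thesis
      using less[OF 3] i j tens_swap[of "x i" "x j"] by simp
  qed
qed


definition P :: "((nat \<Rightarrow> int) \<times> 'a \<times> ((nat \<Rightarrow> int) \<Rightarrow> 'c)) set" where
  "P = generate W (X ` {1..n})"

lemma subgroup_P: "subgroup P W"
  unfolding P_def by (rule W.generate_is_subgroup) auto

lemma P_in_W [simp]: "w \<in> P \<Longrightarrow> w \<in> carrier W"
  using subgroup.subset[OF subgroup_P] by auto

lemma X_in_P: "i \<in> {1..n} \<Longrightarrow> X i \<in> P"
  unfolding P_def by (intro generate.incl) auto

text \<open>Both sides expand a product in the first argument by the same rule, so agreement is inherited by
  products and inverses.\<close>

lemma agreement_subgroup_left:
  assumes v: "v \<in> carrier W"
  shows "subgroup {w \<in> carrier W. commutator W w v = \<rho> (tens (proj w) (proj v))} W"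
proof -
  have mult: "commutator W (w \<otimes>\<^bsub>W\<^esub> u) v = conj_by W (commutator W w v) u \<otimes>\<^bsub>W\<^esub> commutator W u v"
    "\<rho> (tens (proj (w \<otimes>\<^bsub>W\<^esub> u)) (proj v))
      = conj_by W (\<rho> (tens (proj w) (proj v))) u \<otimes>\<^bsub>W\<^esub> \<rho> (tens (proj u) (proj v))"
    if "w \<in> carrier W" "u \<in> carrier W" for w u
    using that v by (simp add: commutator_def conj_by_def W.word_simps,
      simp add: tens_mult_left conj_by_\<rho> act_tens)
  show ?thesis
  proof unfold_locales
    fix w assume w: "w \<in> {w \<in> carrier W. commutator W w v = \<rho> (tens (proj w) (proj v))}"
    let ?K = "conj_by W (\<rho> (tens (proj w) (proj v))) (inv\<^bsub>W\<^esub> w)"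
    have "?K \<otimes>\<^bsub>W\<^esub> commutator W (inv\<^bsub>W\<^esub> w) v = \<one>\<^bsub>W\<^esub>"
      using mult(1)[of w "inv\<^bsub>W\<^esub> w"] w v by simp
    moreover have "?K \<otimes>\<^bsub>W\<^esub> \<rho> (tens (proj (inv\<^bsub>W\<^esub> w)) (proj v)) = \<one>\<^bsub>W\<^esub>"
      using mult(2)[of w "inv\<^bsub>W\<^esub> w"] w v by simp
    ultimately have "?K \<otimes>\<^bsub>W\<^esub> commutator W (inv\<^bsub>W\<^esub> w) v
        = ?K \<otimes>\<^bsub>W\<^esub> \<rho> (tens (proj (inv\<^bsub>W\<^esub> w)) (proj v))"
      by simp
    then have "commutator W (inv\<^bsub>W\<^esub> w) v = \<rho> (tens (proj (inv\<^bsub>W\<^esub> w)) (proj v))"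
      using w v by (subst (asm) W.Units_l_cancel) simp_all
    then show "inv\<^bsub>W\<^esub> w \<in> {w \<in> carrier W. commutator W w v = \<rho> (tens (proj w) (proj v))}"
      using w by simp
  qed (use v mult in auto)
qed

lemma commutator_W_swap:
  "w \<in> carrier W \<Longrightarrow> v \<in> carrier W \<Longrightarrow> commutator W v w = inv\<^bsub>W\<^esub> commutator W w v"
  by (simp add: commutator_def W.word_simps)

text \<open>For the generators \<open>X i\<close> this is \<open>commutator_X\<close>; it spreads to \<open>P\<close> first in the one argument and then in
  the other.\<close>

theorem commutator_P:
  assumes w: "w \<in> P" and v: "v \<in> P"
  shows "commutator W w v = \<rho> (tens (proj w) (proj v))"
proof -
  have gen: "commutator W w (X j) = \<rho> (tens (proj w) (proj (X j)))" if "w \<in> P" "j \<in> {1..n}" for w j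
  proof -
    have "X ` {1..n} \<subseteq> {w \<in> carrier W. commutator W w (X j) = \<rho> (tens (proj w) (proj (X j)))}"
      using that commutator_X by auto
    then have "P \<subseteq> {w \<in> carrier W. commutator W w (X j) = \<rho> (tens (proj w) (proj (X j)))}"
      unfolding P_def using that by (intro W.generate_subgroup_incl agreement_subgroup_left) auto
    then show ?thesis using that by auto
  qed
  have "commutator W (X j) w = \<rho> (tens (proj (X j)) (proj w))" if "j \<in> {1..n}" for j
    using gen[OF w that] w that commutator_W_swap[of w "X j"] by (simp add: tens_swap[of "proj w" "x j"])
  then have "X ` {1..n} \<subseteq> {v \<in> carrier W. commutator W v w = \<rho> (tens (proj v) (proj w))}"
    by auto
  then have "P \<subseteq> {v \<in> carrier W. commutator W v w = \<rho> (tens (proj v) (proj w))}"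
    unfolding P_def using w by (intro W.generate_subgroup_incl agreement_subgroup_left) auto
  then have "commutator W v w = \<rho> (tens (proj v) (proj w))" using v by auto
  then show ?thesis
    using w v commutator_W_swap[of v w] tens_swap[of "proj v" "proj w"] by simp
qed

text \<open>The discrepancy between the \<open>q\<close>-th power of \<open>X i\<close> and its counterpart in \<open>T\<close>. It is not trivial for
  \<open>q > 0\<close>, since \<open>X i [^] q\<close> then shifts the \<open>i\<close>-th exponent.\<close>

definition z :: "nat \<Rightarrow> (nat \<Rightarrow> int) \<times> 'a \<times> ((nat \<Rightarrow> int) \<Rightarrow> 'c)" where
  "z i = X i [^]\<^bsub>W\<^esub> q \<otimes>\<^bsub>W\<^esub> inv\<^bsub>W\<^esub> \<rho> (hat (x i))"

lemma z_closed [simp]: "i \<in> {1..n} \<Longrightarrow> z i \<in> carrier W"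
  by (simp add: z_def)

lemma z_commutes_\<rho>:
  assumes i: "i \<in> {1..n}" and u: "u \<in> carrier T"
  shows "z i \<otimes>\<^bsub>W\<^esub> \<rho> u = \<rho> u \<otimes>\<^bsub>W\<^esub> z i"
proof -
  have "proj (z i) = \<one>"
    using i by (simp add: z_def proj_\<rho> del_hat proj.hom_nat_pow)
  then show ?thesis using \<rho>_act[OF u z_closed[OF i]] u by simp
qed

text \<open>The two factors of \<open>z i\<close> have the same commutator with \<open>X j\<close>, by \<open>commutator_P\<close> for the \<open>q\<close>-th power and by
  \<open>hat_conj\<close> for the other factor.\<close>

lemma z_commutes_X:
  assumes i: "i \<in> {1..n}" and j: "j \<in> {1..n}"
  shows "z i \<otimes>\<^bsub>W\<^esub> X j = X j \<otimes>\<^bsub>W\<^esub> z i"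
proof -
  define A h t where "A = X i [^]\<^bsub>W\<^esub> q" and "h = \<rho> (hat (x i))" and "t = \<rho> (tens (x i [^] q) (x j))"
  have A: "A \<in> P"
    unfolding A_def using W.nat_pow_closed
    by (metis X_in_P[OF i] W.subgroup_int_pow_closed[OF subgroup_P] int_pow_int)
  have c: "A \<in> carrier W" "h \<in> carrier W" "t \<in> carrier W" "X j \<in> carrier W"
    using A i j by (simp_all add: h_def t_def)
  have "commutator W A (X j) = t"
    using commutator_P[OF A X_in_P[OF j]] i by (simp add: A_def t_def proj.hom_nat_pow)
  then have AX: "A \<otimes>\<^bsub>W\<^esub> X j = X j \<otimes>\<^bsub>W\<^esub> A \<otimes>\<^bsub>W\<^esub> t"
    using c by (auto simp: commutator_def W.word_simps)
  have hX: "h \<otimes>\<^bsub>W\<^esub> X j = X j \<otimes>\<^bsub>W\<^esub> h \<otimes>\<^bsub>W\<^esub> t"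
    using i j \<rho>_act[of "hat (x i)" "X j"] by (simp add: h_def t_def act_hat hat_conj W.m_assoc)
  have "z i \<otimes>\<^bsub>W\<^esub> X j = A \<otimes>\<^bsub>W\<^esub> (inv\<^bsub>W\<^esub> h \<otimes>\<^bsub>W\<^esub> X j)"
    using c by (simp add: z_def A_def h_def W.m_assoc)
  also have "inv\<^bsub>W\<^esub> h \<otimes>\<^bsub>W\<^esub> X j = inv\<^bsub>W\<^esub> h \<otimes>\<^bsub>W\<^esub> (h \<otimes>\<^bsub>W\<^esub> X j) \<otimes>\<^bsub>W\<^esub> inv\<^bsub>W\<^esub> t \<otimes>\<^bsub>W\<^esub> inv\<^bsub>W\<^esub> h"
    using c unfolding hX by (simp add: W.word_simps)
  also have "A \<otimes>\<^bsub>W\<^esub> \<dots> = A \<otimes>\<^bsub>W\<^esub> X j \<otimes>\<^bsub>W\<^esub> inv\<^bsub>W\<^esub> t \<otimes>\<^bsub>W\<^esub> inv\<^bsub>W\<^esub> h"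
    using c by (simp add: W.word_simps)
  also have "\<dots> = X j \<otimes>\<^bsub>W\<^esub> z i"
    using c unfolding AX by (simp add: W.word_simps z_def flip: A_def h_def)
  finally show ?thesis .
qed

lemma z_commutes_z:
  assumes i: "i \<in> {1..n}" and j: "j \<in> {1..n}"
  shows "z i \<otimes>\<^bsub>W\<^esub> z j = z j \<otimes>\<^bsub>W\<^esub> z i"
proof -
  have C: "subgroup {w \<in> carrier W. \<forall>v\<in>{z i}. w \<otimes>\<^bsub>W\<^esub> v = v \<otimes>\<^bsub>W\<^esub> w} W" (is "subgroup ?C W")
    using i by (intro W.centralizer_subgroup) simp
  have "X j \<in> ?C" "\<rho> (hat (x j)) \<in> ?C"
    using i j z_commutes_X[OF i j] z_commutes_\<rho>[OF i, of "hat (x j)"] by simp_all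
  then have "z j \<in> ?C"
    unfolding z_def[of j] using W.subgroup_int_pow_closed[OF C, of "X j" "int q"]
    by (intro subgroup.m_closed[OF C] subgroup.m_inv_closed[OF C]) (simp_all only: int_pow_int)
  then show ?thesis by simp
qed

definition Z :: "((nat \<Rightarrow> int) \<times> 'a \<times> ((nat \<Rightarrow> int) \<Rightarrow> 'c)) set" where
  "Z = range (\<lambda>k. list_prod W (map (\<lambda>i. z i [^]\<^bsub>W\<^esub> (k i :: int)) [1..<Suc n]))"

lemma subgroup_Z: "subgroup Z W"
  unfolding Z_def by (rule W.subgroup_list_prod_int_pow) (auto intro!: z_commutes_z simp del: upt_Suc)

lemma Z_in_W [simp]: "w \<in> Z \<Longrightarrow> w \<in> carrier W"
  using subgroup.subset[OF subgroup_Z] by auto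

lemma z_in_Z:
  assumes i: "i \<in> {1..n}"
  shows "z i \<in> Z"
proof -
  have "list_prod W (map (\<lambda>j. z j [^]\<^bsub>W\<^esub> (unit i j)) is) = (if i \<in> set is then z i else \<one>\<^bsub>W\<^esub>)"
    if "distinct is" for "is"
    using that i by (induction "is") (auto simp: unit_def)
  from this[of "[1..<Suc n]"] show ?thesis
    unfolding Z_def using i by (intro range_eqI[of _ _ "unit i"]) auto
qed

lemma Z_commutes_\<rho>:
  assumes w: "w \<in> Z" and u: "u \<in> carrier T"
  shows "w \<otimes>\<^bsub>W\<^esub> \<rho> u = \<rho> u \<otimes>\<^bsub>W\<^esub> w"
proof -
  have C: "subgroup {w \<in> carrier W. \<forall>v\<in>{\<rho> u}. w \<otimes>\<^bsub>W\<^esub> v = v \<otimes>\<^bsub>W\<^esub> w} W" (is "subgroup ?C W")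
    using u by (intro W.centralizer_subgroup) simp
  have "z i [^]\<^bsub>W\<^esub> (k::int) \<in> ?C" if "i \<in> {1..n}" for i k
    using that u by (intro W.subgroup_int_pow_closed[OF C]) (simp add: z_commutes_\<rho>)
  then have "list_prod W (map (\<lambda>i. z i [^]\<^bsub>W\<^esub> (k i :: int)) [1..<Suc n]) \<in> ?C" for k
    by (intro W.subgroup_list_prod[OF C]) auto
  then have "Z \<subseteq> ?C" unfolding Z_def by blast
  then show ?thesis using w by auto
qed

text \<open>The shift of \<open>\<Prod>\<^sub>i z\<^sub>i [^] k\<^sub>i\<close> is \<open>q k\<close>, so for \<open>q > 0\<close> an element of \<open>Z\<close> without shift
  has \<open>k = 0\<close>; for \<open>q = 0\<close> the group \<open>Z\<close> is trivial.\<close>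

lemma Z_shift_zero:
  assumes w: "w \<in> Z" and shift: "shift w = 0"
  shows "w = \<one>\<^bsub>W\<^esub>"
proof -
  obtain k where k: "w = list_prod W (map (\<lambda>i. z i [^]\<^bsub>W\<^esub> (k i :: int)) [1..<Suc n])"
    using w unfolding Z_def by blast
  have "z i [^]\<^bsub>W\<^esub> k i = \<one>\<^bsub>W\<^esub>" if i: "i \<in> {1..n}" for i
  proof (cases "q = 0")
    case True
    have "z i = \<one>\<^bsub>W\<^esub>"
      unfolding z_def using i hat_trivial[OF True] by (simp add: True)
    then show ?thesis by simp
  next
    case False
    have "shift (z i) = (\<lambda>j. int q * unit i j)" if "i \<in> {1..n}" for i
      using that by (simp add: z_def shift_mult shift_inv shift_nat_pow shift_X shift_\<rho>)
    then have shift_pow: "shift (z i [^]\<^bsub>W\<^esub> k i) = (\<lambda>j. k i * (int q * unit i j))" if "i \<in> {1..n}" for i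
      using that by (simp add: shift_int_pow)
    have "shift (list_prod W (map (\<lambda>i. z i [^]\<^bsub>W\<^esub> (k i :: int)) is)) j = (if j \<in> set is then k j * int q else 0)"
      if "distinct is" "set is \<subseteq> {1..n}" for "is" j
      using that
      by (induction "is") (auto simp: shift_one shift_mult shift_pow unit_def)
    from this[of "[1..<Suc n]" i] have "k i * int q = shift w i"
      unfolding k using i by (simp del: upt_Suc add: atLeastLessThanSuc_atLeastAtMost)
    then have "k i * int q = 0" using shift by simp
    then show ?thesis using False by simp
  qed
  then show ?thesis
    unfolding k by (intro W.list_prod_ones) (auto simp del: upt_Suc)
qed

text \<open>The permutation \<open>w\<close> is right multiplication by \<open>u\<close>, up to an element of \<open>Z\<close>.\<close>

definition agrees :: "(nat \<Rightarrow> int) \<times> 'a \<times> ((nat \<Rightarrow> int) \<Rightarrow> 'c) \<Rightarrow> 'c \<Rightarrow> bool" where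
  "agrees w u \<longleftrightarrow> u \<in> carrier T \<and> (\<exists>c\<in>Z. w = \<rho> u \<otimes>\<^bsub>W\<^esub> c)"

lemma agrees_\<rho>: "u \<in> carrier T \<Longrightarrow> agrees (\<rho> u) u"
  unfolding agrees_def using subgroup.one_closed[OF subgroup_Z] by force

lemma agrees_mult:
  assumes "agrees w u" "agrees w' u'"
  shows "agrees (w \<otimes>\<^bsub>W\<^esub> w') (u \<otimes>\<^bsub>T\<^esub> u')"
proof -
  obtain c c' where c: "c \<in> Z" "w = \<rho> u \<otimes>\<^bsub>W\<^esub> c" "c' \<in> Z" "w' = \<rho> u' \<otimes>\<^bsub>W\<^esub> c'"
    using assms unfolding agrees_def by blast
  have u: "u \<in> carrier T" "u' \<in> carrier T" using assms by (simp_all add: agrees_def)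
  have "w \<otimes>\<^bsub>W\<^esub> w' = \<rho> u \<otimes>\<^bsub>W\<^esub> (c \<otimes>\<^bsub>W\<^esub> \<rho> u') \<otimes>\<^bsub>W\<^esub> c'"
    using c u by (simp add: W.m_assoc)
  also have "\<dots> = \<rho> (u \<otimes>\<^bsub>T\<^esub> u') \<otimes>\<^bsub>W\<^esub> (c \<otimes>\<^bsub>W\<^esub> c')"
    using c u Z_commutes_\<rho>[of c u'] by (simp add: W.m_assoc)
  finally show ?thesis
    unfolding agrees_def using c u subgroup.m_closed[OF subgroup_Z] by blast
qed

lemma agrees_inv:
  assumes "agrees w u"
  shows "agrees (inv\<^bsub>W\<^esub> w) (inv\<^bsub>T\<^esub> u)"
proof -
  obtain c where c: "c \<in> Z" "w = \<rho> u \<otimes>\<^bsub>W\<^esub> c" and u: "u \<in> carrier T"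
    using assms unfolding agrees_def by blast
  have c': "inv\<^bsub>W\<^esub> c \<in> Z" using c subgroup.m_inv_closed[OF subgroup_Z] by simp
  have "inv\<^bsub>W\<^esub> w = inv\<^bsub>W\<^esub> c \<otimes>\<^bsub>W\<^esub> \<rho> (inv\<^bsub>T\<^esub> u)"
    using c u by (simp add: W.inv_mult_group)
  then show ?thesis
    unfolding agrees_def using Z_commutes_\<rho>[OF c', of "inv\<^bsub>T\<^esub> u"] c' u by auto
qed

text \<open>Right multiplications do not shift exponents, so \<open>Z_shift_zero\<close> applies to the part in \<open>Z\<close>.\<close>

lemma agrees_one: 
  assumes "agrees \<one>\<^bsub>W\<^esub> u"
  shows "u = \<one>\<^bsub>T\<^esub>"
proof -
  obtain c where c: "c \<in> Z" "\<one>\<^bsub>W\<^esub> = \<rho> u \<otimes>\<^bsub>W\<^esub> c" and u: "u \<in> carrier T"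
    using assms unfolding agrees_def by blast
  have "shift c = shift (\<rho> u \<otimes>\<^bsub>W\<^esub> c)"
    by (simp add: shift_mult shift_\<rho>)
  also have "\<dots> = 0"
    unfolding c(2)[symmetric] by (rule shift_one)
  finally have "shift c = 0" .
  then have "c = \<one>\<^bsub>W\<^esub>" using c Z_shift_zero by blast
  then have "\<rho> u = \<rho> u \<otimes>\<^bsub>W\<^esub> c" using u by simp
  then have "\<rho> u = \<one>\<^bsub>W\<^esub>" unfolding c(2)[symmetric] .
  then show ?thesis by (rule \<rho>_eq_one)
qed

text \<open>By definition of \<open>z i\<close> this holds for the generators. It passes to products since \<open>power_of_product\<close> and the
  relation for \<open>hat\<close> of a product have the same shape, with commutators of \<open>P\<close> matched by \<open>commutator_P\<close>.\<close>

theorem agrees_hat: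
  assumes "w \<in> P"
  shows "agrees (w [^]\<^bsub>W\<^esub> q) (hat (proj w))"
proof -
  let ?H = "{w \<in> P. agrees (w [^]\<^bsub>W\<^esub> q) (hat (proj w))}"
  have "subgroup ?H W"
  proof
    show "?H \<subseteq> carrier W" by auto
    show "\<one>\<^bsub>W\<^esub> \<in> ?H"
      using agrees_\<rho>[of "\<one>\<^bsub>T\<^esub>"] subgroup.one_closed[OF subgroup_P] by simp
    fix w assume w: "w \<in> ?H"
    then show "inv\<^bsub>W\<^esub> w \<in> ?H"
      using agrees_inv[of "w [^]\<^bsub>W\<^esub> q"] subgroup.m_inv_closed[OF subgroup_P]
      by (simp add: hat_inv W.nat_pow_inv)
    fix v assume v: "v \<in> ?H"
    let ?t = "\<lambda>i. tens (conj_by G (proj w) (proj w [^] (q - 1 - i)))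
           (conj_by G (inv (proj v [^] i)) (proj w [^] (q - 1 - i)))"
    let ?c = "\<lambda>i. commutator W (conj_by W w (w [^]\<^bsub>W\<^esub> (q - 1 - i)))
           (conj_by W (inv\<^bsub>W\<^esub> (v [^]\<^bsub>W\<^esub> i)) (w [^]\<^bsub>W\<^esub> (q - 1 - i)))"
    have pow: "a [^]\<^bsub>W\<^esub> k \<in> P" if "a \<in> P" for a and k :: nat
      using W.subgroup_int_pow_closed[OF subgroup_P that, of "int k"] by (simp add: int_pow_int)
    have conj: "conj_by W a b \<in> P" if "a \<in> P" "b \<in> P" for a b
      using that subgroup.m_closed[OF subgroup_P] subgroup.m_inv_closed[OF subgroup_P]
      by (simp add: conj_by_def)
    have wv: "proj w \<in> carrier G" "proj v \<in> carrier G" "w \<in> P" "v \<in> P" using w v by auto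
    have "?c i = \<rho> (?t i)" for i
      using w v by (subst commutator_P)
        (auto intro!: conj pow subgroup.m_inv_closed[OF subgroup_P] simp: proj.hom_conj_by proj.hom_nat_pow)
    then have "list_prod W (map ?c [1..<q]) = \<rho> (list_prod T (map ?t [1..<q]))"
      using wv by (subst \<rho>.hom_list_prod) (auto simp: comp_def)
    then have "(w \<otimes>\<^bsub>W\<^esub> v) [^]\<^bsub>W\<^esub> q
        = w [^]\<^bsub>W\<^esub> q \<otimes>\<^bsub>W\<^esub> \<rho> (list_prod T (map ?t [1..<q])) \<otimes>\<^bsub>W\<^esub> v [^]\<^bsub>W\<^esub> q"
      using W.power_of_product[of w v q] wv by simp
    moreover have "list_prod T (map ?t [1..<q]) \<in> carrier T"
      using wv by (intro T.list_prod_closed) auto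
    then have "agrees (w [^]\<^bsub>W\<^esub> q \<otimes>\<^bsub>W\<^esub> \<rho> (list_prod T (map ?t [1..<q])) \<otimes>\<^bsub>W\<^esub> v [^]\<^bsub>W\<^esub> q)
        (hat (proj w) \<otimes>\<^bsub>T\<^esub> list_prod T (map ?t [1..<q]) \<otimes>\<^bsub>T\<^esub> hat (proj v))"
      using w v by (intro agrees_mult agrees_\<rho>) auto
    ultimately show "w \<otimes>\<^bsub>W\<^esub> v \<in> ?H"
      using wv subgroup.m_closed[OF subgroup_P] by (simp add: hat_mult)
  qed
  moreover have "X ` {1..n} \<subseteq> ?H"
  proof
    fix w assume "w \<in> X ` {1..n}"
    then obtain i where i: "i \<in> {1..n}" "w = X i" by auto
    have h: "\<rho> (hat (x i)) \<in> carrier W" using i by simp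
    have "w [^]\<^bsub>W\<^esub> q = z i \<otimes>\<^bsub>W\<^esub> \<rho> (hat (x i))"
      using i by (simp add: z_def W.m_assoc)
    also have "\<dots> = \<rho> (hat (x i)) \<otimes>\<^bsub>W\<^esub> z i"
      using i by (simp add: z_commutes_\<rho>)
    finally show "w \<in> ?H"
      unfolding agrees_def using i X_in_P z_in_Z by auto
  qed
  ultimately have "P \<subseteq> ?H"
    using W.generate_subgroup_incl unfolding P_def by blast
  then show ?thesis using assms by auto
qed

text \<open>Because the group is free, sending its generators to the \<open>X i\<close> extends to a homomorphism
  into \<open>W\<close>; the relation \<open>S\<close> consists of the pairs \<open>(f, u)\<close> such that the image of \<open>f\<close> agrees with \<open>u\<close>.\<close>

theorem free_group_realisation:
  fixes \<pi> :: "nat word \<Rightarrow> 'a"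
  defines "F \<equiv> free_group {1..n}"
  assumes \<pi>: "\<pi> \<in> hom F G" and \<pi>_gen: "\<And>i. i \<in> {1..n} \<Longrightarrow> \<pi> (free_gen i) = x i"
  obtains S where "subgroup S (F \<times>\<times> T)"
    and "\<And>f h. f \<in> carrier F \<Longrightarrow> h \<in> carrier F \<Longrightarrow> (commutator F f h, tens (\<pi> f) (\<pi> h)) \<in> S"
    and "\<And>f. f \<in> carrier F \<Longrightarrow> (f [^]\<^bsub>F\<^esub> q, hat (\<pi> f)) \<in> S"
    and "\<And>u. (\<one>\<^bsub>F\<^esub>, u) \<in> S \<Longrightarrow> u = \<one>\<^bsub>T\<^esub>"
proof -
  interpret F: group F unfolding F_def by (rule group_free_group)
  have "X ` {1..n} \<subseteq> carrier W" by auto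
  from free_group_extend[OF group_W this] obtain \<Lambda>
    where hom: "\<Lambda> \<in> hom F W" and gen: "\<And>i. i \<in> {1..n} \<Longrightarrow> \<Lambda> (free_gen i) = X i"
    unfolding F_def by blast
  interpret \<Lambda>: group_hom F W \<Lambda>
    using hom by unfold_locales
  interpret FT: group "F \<times>\<times> T"
    by (rule DirProd_group) unfold_locales
  have proj: "proj (\<Lambda> f) = \<pi> f" if "f \<in> carrier F" for f
  proof (rule free_group_hom_eqI[OF G.group_axioms])
    show "(\<lambda>f. proj (\<Lambda> f)) \<in> hom (free_group {1..n}) G"
      using hom unfolding F_def[symmetric] by (auto simp: hom_def)
  qed (use \<pi> that gen \<pi>_gen in \<open>auto simp: F_def\<close>)
  have P: "\<Lambda> f \<in> P" if "f \<in> carrier F" for f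
  proof -
    have "\<Lambda> ` generate F (free_gen ` {1..n}) = generate W (\<Lambda> ` free_gen ` {1..n})"
      by (rule \<Lambda>.generate_img[symmetric]) (auto simp: F_def)
    also have "\<Lambda> ` free_gen ` {1..n} = X ` {1..n}"
      using gen by (force simp: image_image)
    finally show ?thesis
      using that free_group_generated[of "{1..n}"] unfolding P_def F_def by blast
  qed
  let ?S = "{(f, u). f \<in> carrier F \<and> agrees (\<Lambda> f) u}"
  have "subgroup ?S (F \<times>\<times> T)"
  proof
    show "?S \<subseteq> carrier (F \<times>\<times> T)" by (auto simp: agrees_def)
    show "\<one>\<^bsub>F \<times>\<times> T\<^esub> \<in> ?S"
      using agrees_\<rho>[of "\<one>\<^bsub>T\<^esub>"] by simp
    show "s \<otimes>\<^bsub>F \<times>\<times> T\<^esub> s' \<in> ?S" if "s \<in> ?S" "s' \<in> ?S" for s s'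
      using that agrees_mult[of "\<Lambda> (fst s)" "snd s" "\<Lambda> (fst s')" "snd s'"] by (auto split: prod.splits)
    show "inv\<^bsub>F \<times>\<times> T\<^esub> s \<in> ?S" if "s \<in> ?S" for s
    proof -
      obtain f u where s: "s = (f, u)" by (cases s)
      then have "f \<in> carrier F" "agrees (\<Lambda> f) u" "u \<in> carrier T" using that by (auto simp: agrees_def)
      then show ?thesis
        using agrees_inv[of "\<Lambda> f" u] by (simp add: s inv_DirProd[OF F.group_axioms T.group_axioms])
    qed
  qed
  moreover have "(commutator F f h, tens (\<pi> f) (\<pi> h)) \<in> ?S" if "f \<in> carrier F" "h \<in> carrier F" for f h
    using that commutator_P[of "\<Lambda> f" "\<Lambda> h"] P agrees_\<rho>[of "tens (\<pi> f) (\<pi> h)"] proj[of f] proj[of h]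
      hom_in_carrier[OF \<pi>]
    by (simp add: \<Lambda>.hom_commutator)
  moreover have "(f [^]\<^bsub>F\<^esub> q, hat (\<pi> f)) \<in> ?S" if "f \<in> carrier F" for f
    using that agrees_hat[of "\<Lambda> f"] P proj[of f] by (simp add: \<Lambda>.hom_nat_pow)
  moreover have "u = \<one>\<^bsub>T\<^esub>" if "(\<one>\<^bsub>F\<^esub>, u) \<in> ?S" for u
    using that agrees_one by simp
  ultimately show thesis by (rule that)
qed

end

section \<open>Groups given by generators and relations\<close>

locale presentation =
  fixes X :: "'x set" and rel :: "('x word \<times> 'x word) set"
  assumes rel_closed: "rel \<subseteq> carrier (free_group X) \<times> carrier (free_group X)"
begin

abbreviation "F \<equiv> free_group X"
abbreviation "N \<equiv> normal_closure F (relators F rel)"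

sublocale F: group F by (rule group_free_group)

lemma relators_closed: "relators F rel \<subseteq> carrier F"
  using rel_closed by (auto simp: relators_def)

sublocale N: normal N F
  by (rule F.normal_closure_normal[OF relators_closed])

lemma carrier_presented: "carrier (presented_group X rel) = (\<lambda>w. N #>\<^bsub>F\<^esub> w) ` carrier F"
  by (simp add: presented_group_def carrier_FactGroup)

lemma group_presented: "group (presented_group X rel)"
  unfolding presented_group_def by (rule N.factorgroup_is_group)

lemma coset_hom: "(\<lambda>w. N #>\<^bsub>F\<^esub> w) \<in> hom F (presented_group X rel)"
  unfolding presented_group_def by (rule N.r_coset_hom_Mod)

lemma relation_holds:
  assumes lr: "(l, r) \<in> rel"
  shows "N #>\<^bsub>F\<^esub> l = N #>\<^bsub>F\<^esub> r"
proof -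
  have c: "l \<in> carrier F" "r \<in> carrier F" using lr rel_closed by auto
  have "l \<otimes>\<^bsub>F\<^esub> inv\<^bsub>F\<^esub> r \<in> relators F rel"
    using lr by (auto simp: relators_def)
  moreover have "conj_by F (l \<otimes>\<^bsub>F\<^esub> inv\<^bsub>F\<^esub> r) \<one>\<^bsub>F\<^esub> = l \<otimes>\<^bsub>F\<^esub> inv\<^bsub>F\<^esub> r"
    using c by simp
  ultimately have "l \<otimes>\<^bsub>F\<^esub> inv\<^bsub>F\<^esub> r \<in> N"
    unfolding normal_closure_def by (intro generate.incl) (metis (mono_tags, lifting) F.one_closed mem_Collect_eq)
  then have "l \<in> N #>\<^bsub>F\<^esub> r"
    by (rule N.rcos_module_rev[OF F.group_axioms c(2,1)])
  then show ?thesis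
    by (rule F.repr_independence[OF _ c(2) N.subgroup_axioms, symmetric])
qed

lemma presented_generated:
  "carrier (presented_group X rel) = generate (presented_group X rel) ((\<lambda>x. N #>\<^bsub>F\<^esub> free_gen x) ` X)"
proof -
  interpret \<kappa>: group_hom F "presented_group X rel" "\<lambda>w. N #>\<^bsub>F\<^esub> w"
    using coset_hom group_presented by (simp add: group_hom_def group_hom_axioms_def)
  have "generate (presented_group X rel) ((\<lambda>w. N #>\<^bsub>F\<^esub> w) ` free_gen ` X)
      = (\<lambda>w. N #>\<^bsub>F\<^esub> w) ` generate F (free_gen ` X)"
    by (rule \<kappa>.generate_img) auto
  also have "generate F (free_gen ` X) = carrier F"
    by (rule free_group_generated[symmetric])
  finally show ?thesis
    by (simp add: carrier_presented image_image)
qed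


lemma presented_universal:
  assumes "group H" and h: "h \<in> hom F H" and rel: "\<And>l r. (l, r) \<in> rel \<Longrightarrow> h l = h r"
  obtains \<phi> where "\<phi> \<in> hom (presented_group X rel) H" "\<And>w. w \<in> carrier F \<Longrightarrow> \<phi> (N #>\<^bsub>F\<^esub> w) = h w"
proof -
  interpret h: group_hom F H h
    using assms by (simp add: group_hom_def group_hom_axioms_def F.group_axioms)
  have K: "normal (kernel F H h) F" by (rule h.normal_kernel)
  have "{conj_by F s x | s x. s \<in> relators F rel \<and> x \<in> carrier F} \<subseteq> kernel F H h"
  proof safe
    fix s x assume s: "s \<in> relators F rel" and x: "x \<in> carrier F"
    then obtain l r where "s = l \<otimes>\<^bsub>F\<^esub> inv\<^bsub>F\<^esub> r" "(l, r) \<in> rel" by (auto simp: relators_def)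
    then have "h s = \<one>\<^bsub>H\<^esub>" using rel rel_closed by auto
    then show "conj_by F s x \<in> kernel F H h"
      using s x relators_closed by (auto simp: kernel_def h.hom_conj_by)
  qed
  then have "N \<subseteq> kernel F H h"
    unfolding normal_closure_def
    by (rule F.generate_subgroup_incl) (rule normal_imp_subgroup[OF K])
  then show thesis
    using h.FactGroup_universal_kernel[OF N.normal_axioms] that unfolding presented_group_def by blast
qed

end

section \<open>The universal property of the \<open>q\<close>-exterior square\<close>

text \<open>For \<open>q = 0\<close> there are no symbols \<open>Hat k\<close>; the value is then the identity.\<close>

definition q_tensor_hat :: "('g, 'm) monoid_scheme \<Rightarrow> nat \<Rightarrow> 'g \<Rightarrow> 'g tensor_symbol word set" where
  "q_tensor_hat G q k =
     (let F = free_group (qt_symbols G q); N = normal_closure F (relators F (qt_relations G q)) in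
      if q = 0 then N else N #>\<^bsub>F\<^esub> free_gen (Hat k))"

definition q_wedge :: "('g, 'm) monoid_scheme \<Rightarrow> nat \<Rightarrow> 'g \<Rightarrow> 'g \<Rightarrow> 'g tensor_symbol word set set" where
  "q_wedge G q g h = nabla_q G q #>\<^bsub>q_tensor_square G q\<^esub> q_tensor G q g h"

definition q_wedge_hat :: "('g, 'm) monoid_scheme \<Rightarrow> nat \<Rightarrow> 'g \<Rightarrow> 'g tensor_symbol word set set" where
  "q_wedge_hat G q k = nabla_q G q #>\<^bsub>q_tensor_square G q\<^esub> q_tensor_hat G q k"

context group
begin

lemma qt_relations_closed:
  "qt_relations G q \<subseteq> carrier (free_group (qt_symbols G q)) \<times> carrier (free_group (qt_symbols G q))"
proof -
  define F where "F = free_group (qt_symbols G q)"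
  interpret F: group F unfolding F_def by (rule group_free_group)
  have t: "free_gen (Tens g h) \<in> carrier F" if "g \<in> carrier G" "h \<in> carrier G" for g h
    unfolding F_def using that by (intro free_gen_in_carrier) (simp add: qt_symbols_def)
  have hat: "free_gen (Hat k) \<in> carrier F" if "k \<in> carrier G" "q \<noteq> 0" for k
    unfolding F_def using that by (intro free_gen_in_carrier) (simp add: qt_symbols_def)
  show ?thesis
    unfolding qt_relations_def Let_def F_def[symmetric]
    by (auto intro!: F.m_closed F.list_prod_closed F.conj_by_closed F.commutator_closed F.nat_pow_closed t hat)
qed

lemma presentation_tensor: "presentation (qt_symbols G q) (qt_relations G q)"
  by unfold_locales (rule qt_relations_closed)

lemma q_tensor_square_pairing:
  "q_pairing G (q_tensor_square G q) q (q_tensor G q) (q_tensor_hat G q)"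
proof -
  interpret P: presentation "qt_symbols G q" "qt_relations G q" by (rule presentation_tensor)
  let ?T = "q_tensor_square G q"
  define \<kappa> where "\<kappa> w = P.N #>\<^bsub>P.F\<^esub> w" for w
  interpret \<kappa>: group_hom P.F ?T \<kappa>
    using P.coset_hom P.group_presented
    by (simp add: group_hom_def group_hom_axioms_def q_tensor_square_def \<kappa>_def[abs_def] P.F.group_axioms)
  have rel: "\<kappa> l = \<kappa> r" if "(l, r) \<in> qt_relations G q" for l r
    unfolding \<kappa>_def using P.relation_holds[OF that] .
  have tens: "q_tensor G q g h = \<kappa> (free_gen (Tens g h))" for g h
    by (simp add: q_tensor_def \<kappa>_def Let_def)
  have hat: "q_tensor_hat G q k = (if q = 0 then \<one>\<^bsub>?T\<^esub> else \<kappa> (free_gen (Hat k)))" for k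
    by (simp add: q_tensor_hat_def \<kappa>_def Let_def q_tensor_square_def presented_group_def)
  have t: "free_gen (Tens g h) \<in> carrier P.F" if "g \<in> carrier G" "h \<in> carrier G" for g h
    using that by (intro free_gen_in_carrier) (simp add: qt_symbols_def)
  have k: "free_gen (Hat k) \<in> carrier P.F" if "k \<in> carrier G" "q \<noteq> 0" for k
    using that by (intro free_gen_in_carrier) (simp add: qt_symbols_def)
  show ?thesis
  proof unfold_locales
    show "q_tensor G q g h \<in> carrier ?T" if "g \<in> carrier G" "h \<in> carrier G" for g h
      using that t by (simp add: tens)
    show "q_tensor_hat G q a \<in> carrier ?T" if "a \<in> carrier G" for a
    proof (cases "q = 0")
      case False
      show ?thesis
        unfolding hat if_not_P[OF False] by (rule \<kappa>.hom_closed[OF k[OF that False]])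
    next
      case True
      show ?thesis
        unfolding hat if_P[OF True] by (rule \<kappa>.H.one_closed)
    qed
    show "q_tensor G q g (h \<otimes> h1) = q_tensor G q g h1 \<otimes>\<^bsub>?T\<^esub> q_tensor G q (conj_by G g h1) (conj_by G h h1)"
      if "g \<in> carrier G" "h \<in> carrier G" "h1 \<in> carrier G" for g h h1
    proof -
      have "\<kappa> (free_gen (Tens g (h \<otimes> h1)))
          = \<kappa> (free_gen (Tens g h1) \<otimes>\<^bsub>P.F\<^esub> free_gen (Tens (conj_by G g h1) (conj_by G h h1)))"
        by (rule rel) (use that in \<open>unfold qt_relations_def Let_def, blast\<close>)
      then show ?thesis using that t by (simp add: tens)
    qed
    show "q_tensor G q (g \<otimes> g1) h = q_tensor G q (conj_by G g g1) (conj_by G h g1) \<otimes>\<^bsub>?T\<^esub> q_tensor G q g1 h"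
      if "g \<in> carrier G" "g1 \<in> carrier G" "h \<in> carrier G" for g g1 h
    proof -
      have "\<kappa> (free_gen (Tens (g \<otimes> g1) h))
          = \<kappa> (free_gen (Tens (conj_by G g g1) (conj_by G h g1)) \<otimes>\<^bsub>P.F\<^esub> free_gen (Tens g1 h))"
        by (rule rel) (use that in \<open>unfold qt_relations_def Let_def, blast\<close>)
      then show ?thesis using that t by (simp add: tens)
    qed
    show "conj_by ?T (q_tensor G q g h) (q_tensor_hat G q a)
        = q_tensor G q (conj_by G g (a [^] q)) (conj_by G h (a [^] q))"
      if "g \<in> carrier G" "h \<in> carrier G" "a \<in> carrier G" for g h a
    proof (cases "q = 0")
      case False
      have "\<kappa> (conj_by P.F (free_gen (Tens g h)) (free_gen (Hat a)))
          = \<kappa> (free_gen (Tens (conj_by G g (a [^] q)) (conj_by G h (a [^] q))))"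
        by (rule rel) (use that False in \<open>unfold qt_relations_def Let_def if_not_P[OF False], blast\<close>)
      then show ?thesis using that t k False by (simp add: tens hat \<kappa>.hom_conj_by)
    next
      case True
      have "a [^] q = \<one>" by (simp add: True)
      moreover have "q_tensor_hat G q a = \<one>\<^bsub>?T\<^esub>"
        unfolding hat if_P[OF True] ..
      ultimately show ?thesis using that t by (simp add: tens)
    qed
    show "q_tensor_hat G q (a \<otimes> b) = q_tensor_hat G q a \<otimes>\<^bsub>?T\<^esub>
          list_prod ?T (power_factors G q (q_tensor G q) a b) \<otimes>\<^bsub>?T\<^esub> q_tensor_hat G q b"
      if "a \<in> carrier G" "b \<in> carrier G" for a b
    proof (cases "q = 0")
      case False
      let ?l = "power_factors G q (\<lambda>g h. free_gen (Tens g h)) a b"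
      have l: "set ?l \<subseteq> carrier P.F" using that t by auto
      have "\<kappa> (free_gen (Hat (a \<otimes> b))) = \<kappa> (free_gen (Hat a) \<otimes>\<^bsub>P.F\<^esub> list_prod P.F ?l \<otimes>\<^bsub>P.F\<^esub> free_gen (Hat b))"
        by (rule rel) (use that False in \<open>unfold qt_relations_def Let_def if_not_P[OF False], blast\<close>)
      then show ?thesis
        using that t k False \<kappa>.hom_list_prod[OF l] P.F.list_prod_closed[OF l] by (simp add: tens hat comp_def)
    next
      case True
      then have empty: "[1..<q] = []" by simp
      show ?thesis
        unfolding hat if_P[OF True] empty by simp
    qed
    show "commutator ?T (q_tensor_hat G q a) (q_tensor_hat G q b) = q_tensor G q (a [^] q) (b [^] q)"
      if "a \<in> carrier G" "b \<in> carrier G" for a b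
    proof (cases "q = 0")
      case True
      have "\<kappa> (free_gen (Tens \<one> (\<one> \<otimes> \<one>)))
          = \<kappa> (free_gen (Tens \<one> \<one>) \<otimes>\<^bsub>P.F\<^esub> free_gen (Tens (conj_by G \<one> \<one>) (conj_by G \<one> \<one>)))"
        by (rule rel) (unfold qt_relations_def Let_def, blast)
      then have "q_tensor G q \<one> \<one> = \<one>\<^bsub>?T\<^esub>" using t[of \<one> \<one>] by (simp add: tens)
      moreover have "a [^] q = \<one>" "b [^] q = \<one>" by (simp_all add: True)
      ultimately show ?thesis unfolding hat if_P[OF True] by simp
    next
      case False
      have "\<kappa> (commutator P.F (free_gen (Hat a)) (free_gen (Hat b))) = \<kappa> (free_gen (Tens (a [^] q) (b [^] q)))"
        by (rule rel) (use that False in \<open>unfold qt_relations_def Let_def if_not_P[OF False], blast\<close>)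
      then show ?thesis using that t k False by (simp add: tens hat \<kappa>.hom_commutator)
    qed
    show "q_tensor_hat G q (commutator G g h) = q_tensor G q g h [^]\<^bsub>?T\<^esub> q"
      if "g \<in> carrier G" "h \<in> carrier G" for g h
    proof (cases "q = 0")
      case False
      have "\<kappa> (free_gen (Hat (commutator G g h))) = \<kappa> (free_gen (Tens g h) [^]\<^bsub>P.F\<^esub> q)"
        by (rule rel) (use that False in \<open>unfold qt_relations_def Let_def if_not_P[OF False], blast\<close>)
      then show ?thesis using that t False by (simp add: tens hat \<kappa>.hom_nat_pow)
    next
      case True
      have "q_tensor G q g h [^]\<^bsub>?T\<^esub> q = \<one>\<^bsub>?T\<^esub>" by (simp add: True)
      then show ?thesis unfolding hat if_P[OF True] by simp
    qed
  qed
qed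

lemma q_tensor_square_generated:
  "carrier (q_tensor_square G q) = generate (q_tensor_square G q)
     ({q_tensor G q g h | g h. g \<in> carrier G \<and> h \<in> carrier G} \<union> q_tensor_hat G q ` carrier G)"
    (is "_ = generate _ ?S")
proof
  interpret P: presentation "qt_symbols G q" "qt_relations G q" by (rule presentation_tensor)
  interpret T: q_pairing G "q_tensor_square G q" q "q_tensor G q" "q_tensor_hat G q"
    by (rule q_tensor_square_pairing)
  show "generate (q_tensor_square G q) ?S \<subseteq> carrier (q_tensor_square G q)"
    by (rule T.T.generate_incl) auto
  have "(\<lambda>x. P.N #>\<^bsub>P.F\<^esub> free_gen x) ` qt_symbols G q \<subseteq> ?S"
    by (auto simp: qt_symbols_def q_tensor_def q_tensor_hat_def Let_def split: if_splits)
  then show "carrier (q_tensor_square G q) \<subseteq> generate (q_tensor_square G q) ?S"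
    using P.presented_generated T.T.mono_generate unfolding q_tensor_square_def by blast
qed

lemma q_tensor_square_universal:
  assumes "q_pairing G H q t k" and k0: "\<And>g. q = 0 \<Longrightarrow> g \<in> carrier G \<Longrightarrow> k g = \<one>\<^bsub>H\<^esub>"
  obtains \<phi> where "\<phi> \<in> hom (q_tensor_square G q) H"
    "\<And>g h. g \<in> carrier G \<Longrightarrow> h \<in> carrier G \<Longrightarrow> \<phi> (q_tensor G q g h) = t g h"
    "\<And>g. g \<in> carrier G \<Longrightarrow> \<phi> (q_tensor_hat G q g) = k g"
proof -
  interpret P: presentation "qt_symbols G q" "qt_relations G q" by (rule presentation_tensor)
  interpret H: q_pairing G H q t k by fact
  define f where "f s = (case s of Tens g h \<Rightarrow> t g h | Hat g \<Rightarrow> k g)" for s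
  have "f ` qt_symbols G q \<subseteq> carrier H"
    by (auto simp: qt_symbols_def f_def split: if_splits)
  from free_group_extend[OF H.T.group_axioms this] obtain h
    where h: "h \<in> hom P.F H" and gen: "\<And>s. s \<in> qt_symbols G q \<Longrightarrow> h (free_gen s) = f s" by blast
  interpret h: group_hom P.F H h
    using h by unfold_locales
  have ht: "h (free_gen (Tens a b)) = t a b" and tc: "free_gen (Tens a b) \<in> carrier P.F"
    if "a \<in> carrier G" "b \<in> carrier G" for a b
    using that by (auto simp: gen qt_symbols_def f_def intro!: free_gen_in_carrier)
  have hk: "h (free_gen (Hat a)) = k a" and kc: "free_gen (Hat a) \<in> carrier P.F" if "a \<in> carrier G" "q \<noteq> 0" for a
    using that by (auto simp: gen qt_symbols_def f_def intro!: free_gen_in_carrier)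
  have "h l = h r" if "(l, r) \<in> qt_relations G q" for l r
  proof (cases "q = 0")
    case True
    show ?thesis
      using that unfolding qt_relations_def Let_def if_P[OF True]
      by (auto simp: ht tc H.tens_mult_left H.tens_mult_right)
  next
    case False
    have list: "h (list_prod P.F (power_factors G q (\<lambda>g h. free_gen (Tens g h)) a b))
        = list_prod H (power_factors G q t a b)"
      and lc: "list_prod P.F (power_factors G q (\<lambda>g h. free_gen (Tens g h)) a b) \<in> carrier P.F"
      if "a \<in> carrier G" "b \<in> carrier G" for a b
    proof -
      have l: "set (power_factors G q (\<lambda>g h. free_gen (Tens g h)) a b) \<subseteq> carrier P.F"
        using that tc by auto
      show "h (list_prod P.F (power_factors G q (\<lambda>g h. free_gen (Tens g h)) a b))
        = list_prod H (power_factors G q t a b)"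
        using h.hom_list_prod[OF l] that by (simp add: ht comp_def)
      show "list_prod P.F (power_factors G q (\<lambda>g h. free_gen (Tens g h)) a b) \<in> carrier P.F"
        using P.F.list_prod_closed[OF l] .
    qed
    show ?thesis
      using that unfolding qt_relations_def Let_def if_not_P[OF False]
      by (elim UnE; clarsimp simp only: mem_Collect_eq prod.inject)
        (simp_all only: ht tc hk[OF _ False] kc[OF _ False] list lc h.hom_mult h.hom_conj_by h.hom_commutator
          h.hom_nat_pow P.F.m_closed m_closed conj_by_closed commutator_closed nat_pow_closed inv_closed
          H.tens_mult_left H.tens_mult_right H.tens_conj_hat H.hat_mult H.hat_commutator H.hat_of_commutator)
  qed
  from P.presented_universal[OF H.T.group_axioms h this] obtain \<phi>
    where \<phi>: "\<phi> \<in> hom (presented_group (qt_symbols G q) (qt_relations G q)) H"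
      "\<And>w. w \<in> carrier P.F \<Longrightarrow> \<phi> (P.N #>\<^bsub>P.F\<^esub> w) = h w" by blast
  show thesis
  proof
    show "\<phi> \<in> hom (q_tensor_square G q) H" using \<phi> by (simp add: q_tensor_square_def)
    show "\<phi> (q_tensor G q a b) = t a b" if "a \<in> carrier G" "b \<in> carrier G" for a b
      using that \<phi>(2) by (simp add: q_tensor_def Let_def ht tc)
    show "\<phi> (q_tensor_hat G q a) = k a" if "a \<in> carrier G" for a
    proof (cases "q = 0")
      case True
      have "q_tensor_hat G q a = P.N #>\<^bsub>P.F\<^esub> \<one>\<^bsub>P.F\<^esub>"
        unfolding q_tensor_hat_def Let_def if_P[OF True] by (rule P.F.coset_mult_one[OF P.N.subset, symmetric])
      then have "\<phi> (q_tensor_hat G q a) = h \<one>\<^bsub>P.F\<^esub>"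
        using \<phi>(2)[OF P.F.one_closed] by (simp only:)
      then show ?thesis using h.hom_one k0[OF True that] by (simp only:)
    qed (use that \<phi>(2) in \<open>simp add: q_tensor_hat_def Let_def hk kc\<close>)
  qed
qed

lemma nabla_q_normal: "nabla_q G q \<lhd> q_tensor_square G q"
proof -
  interpret T: q_pairing G "q_tensor_square G q" q "q_tensor G q" "q_tensor_hat G q"
    by (rule q_tensor_square_pairing)
  show ?thesis
    unfolding nabla_q_def by (rule T.diagonal_normal[OF q_tensor_square_generated])
qed

lemma wedge_hom:
  "(\<lambda>t. nabla_q G q #>\<^bsub>q_tensor_square G q\<^esub> t) \<in> hom (q_tensor_square G q) (q_exterior_square G q)"
  unfolding q_exterior_square_def by (rule normal.r_coset_hom_Mod[OF nabla_q_normal])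

lemma group_q_exterior_square: "group (q_exterior_square G q)"
  unfolding q_exterior_square_def by (rule normal.factorgroup_is_group[OF nabla_q_normal])

lemma q_exterior_square_pairing:
  "q_pairing G (q_exterior_square G q) q (q_wedge G q) (q_wedge_hat G q)"
  using q_pairing.hom_compose[OF q_tensor_square_pairing group_q_exterior_square wedge_hom]
  by (simp add: q_wedge_def[abs_def] q_wedge_hat_def[abs_def])

lemma q_wedge_self:
  assumes "g \<in> carrier G"
  shows "q_wedge G q g g = \<one>\<^bsub>q_exterior_square G q\<^esub>"
proof -
  interpret T: q_pairing G "q_tensor_square G q" q "q_tensor G q" "q_tensor_hat G q"
    by (rule q_tensor_square_pairing)
  have "q_tensor G q g g \<in> nabla_q G q"
    unfolding nabla_q_def using assms by (intro generate.incl) auto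
  then show ?thesis
    using T.T.coset_join2[OF _ normal_imp_subgroup[OF nabla_q_normal]] assms
    by (simp add: q_wedge_def q_exterior_square_def)
qed

lemma q_exterior_square_generated:
  "carrier (q_exterior_square G q) = generate (q_exterior_square G q)
     ({q_wedge G q g h | g h. g \<in> carrier G \<and> h \<in> carrier G} \<union> q_wedge_hat G q ` carrier G)"
proof -
  interpret T: q_pairing G "q_tensor_square G q" q "q_tensor G q" "q_tensor_hat G q"
    by (rule q_tensor_square_pairing)
  interpret \<kappa>: group_hom "q_tensor_square G q" "q_exterior_square G q" "\<lambda>t. nabla_q G q #>\<^bsub>q_tensor_square G q\<^esub> t"
    using wedge_hom group_q_exterior_square by (simp add: group_hom_def group_hom_axioms_def T.T.group_axioms)
  let ?S = "{q_tensor G q g h | g h. g \<in> carrier G \<and> h \<in> carrier G} \<union> q_tensor_hat G q ` carrier G"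
  have "carrier (q_exterior_square G q)
      = (\<lambda>t. nabla_q G q #>\<^bsub>q_tensor_square G q\<^esub> t) ` generate (q_tensor_square G q) ?S"
    by (simp add: q_exterior_square_def carrier_FactGroup flip: q_tensor_square_generated)
  also have "\<dots> = generate (q_exterior_square G q) ((\<lambda>t. nabla_q G q #>\<^bsub>q_tensor_square G q\<^esub> t) ` ?S)"
    by (rule \<kappa>.generate_img[symmetric]) auto
  also have "(\<lambda>t. nabla_q G q #>\<^bsub>q_tensor_square G q\<^esub> t) ` ?S
      = {q_wedge G q g h | g h. g \<in> carrier G \<and> h \<in> carrier G} \<union> q_wedge_hat G q ` carrier G"
    by (auto simp: q_wedge_def q_wedge_hat_def image_Un image_image)
  finally show ?thesis .
qed

theorem q_exterior_square_universal:
  assumes pair: "q_pairing G H q t k" and k0: "\<And>g. q = 0 \<Longrightarrow> g \<in> carrier G \<Longrightarrow> k g = \<one>\<^bsub>H\<^esub>"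
    and self: "\<And>g. g \<in> carrier G \<Longrightarrow> t g g = \<one>\<^bsub>H\<^esub>"
  obtains \<phi> where "\<phi> \<in> hom (q_exterior_square G q) H"
    "\<And>g h. g \<in> carrier G \<Longrightarrow> h \<in> carrier G \<Longrightarrow> \<phi> (q_wedge G q g h) = t g h"
    "\<And>g. g \<in> carrier G \<Longrightarrow> \<phi> (q_wedge_hat G q g) = k g"
proof -
  interpret T: q_pairing G "q_tensor_square G q" q "q_tensor G q" "q_tensor_hat G q"
    by (rule q_tensor_square_pairing)
  interpret H: q_pairing G H q t k by fact
  obtain \<phi> where \<phi>: "\<phi> \<in> hom (q_tensor_square G q) H"
    "\<And>g h. g \<in> carrier G \<Longrightarrow> h \<in> carrier G \<Longrightarrow> \<phi> (q_tensor G q g h) = t g h"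
    "\<And>g. g \<in> carrier G \<Longrightarrow> \<phi> (q_tensor_hat G q g) = k g"
    using q_tensor_square_universal[OF pair k0] by blast
  interpret \<phi>: group_hom "q_tensor_square G q" H \<phi>
    using \<phi>(1) by unfold_locales
  have "nabla_q G q \<subseteq> kernel (q_tensor_square G q) H \<phi>"
    unfolding nabla_q_def
    by (rule T.T.generate_subgroup_incl[OF _ \<phi>.subgroup_kernel]) (auto simp: kernel_def \<phi>(2) self)
  from \<phi>.FactGroup_universal_kernel[OF nabla_q_normal this] obtain \<psi>
    where \<psi>: "\<psi> \<in> hom (q_exterior_square G q) H"
      "\<And>x. x \<in> carrier (q_tensor_square G q) \<Longrightarrow> \<psi> (nabla_q G q #>\<^bsub>q_tensor_square G q\<^esub> x) = \<phi> x"
    unfolding q_exterior_square_def by blast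
  show thesis
    by (rule that[OF \<psi>(1)]) (simp_all add: q_wedge_def q_wedge_hat_def \<psi>(2) \<phi>(2,3))
qed

lemma q_wedge_hat_trivial:
  assumes "q = 0" "k \<in> carrier G"
  shows "q_wedge_hat G q k = \<one>\<^bsub>q_exterior_square G q\<^esub>"
proof -
  interpret T: q_pairing G "q_tensor_square G q" q "q_tensor G q" "q_tensor_hat G q"
    by (rule q_tensor_square_pairing)
  interpret \<kappa>: group_hom "q_tensor_square G q" "q_exterior_square G q" "\<lambda>t. nabla_q G q #>\<^bsub>q_tensor_square G q\<^esub> t"
    using wedge_hom group_q_exterior_square by (simp add: group_hom_def group_hom_axioms_def T.T.group_axioms)
  have "q_tensor_hat G q k = \<one>\<^bsub>q_tensor_square G q\<^esub>"
    using assms by (simp add: q_tensor_hat_def q_tensor_square_def presented_group_def Let_def)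
  then show ?thesis by (simp add: q_wedge_hat_def)
qed

text \<open>Conjugation by an element of \<open>G\<close> permutes the relations and so induces the action; the boundary comes
  from commutators and powers in \<open>G\<close> itself.\<close>

theorem q_exterior_square_crossed_module:
  "\<exists>act del. q_exterior G (q_exterior_square G q) q (q_wedge G q) (q_wedge_hat G q) act del"
proof -
  let ?T = "q_exterior_square G q"
  interpret T: q_pairing G ?T q "q_wedge G q" "q_wedge_hat G q"
    by (rule q_exterior_square_pairing)
  have "\<exists>\<alpha>. \<alpha> \<in> hom ?T ?T \<and>
      (\<forall>g\<in>carrier G. \<forall>h\<in>carrier G. \<alpha> (q_wedge G q g h) = q_wedge G q (conj_by G g x) (conj_by G h x)) \<and>
      (\<forall>g\<in>carrier G. \<alpha> (q_wedge_hat G q g) = q_wedge_hat G q (conj_by G g x))" if x: "x \<in> carrier G" for x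
  proof -
    obtain \<alpha> where "\<alpha> \<in> hom ?T ?T"
      "\<And>g h. g \<in> carrier G \<Longrightarrow> h \<in> carrier G \<Longrightarrow> \<alpha> (q_wedge G q g h) = q_wedge G q (conj_by G g x) (conj_by G h x)"
      "\<And>g. g \<in> carrier G \<Longrightarrow> \<alpha> (q_wedge_hat G q g) = q_wedge_hat G q (conj_by G g x)"
      using q_exterior_square_universal[OF T.compose_hom[OF group_axioms conj_by_hom[OF x]]] x
      by (auto simp: q_wedge_self q_wedge_hat_trivial)
    then show ?thesis by blast
  qed
  then obtain act where act: "\<And>x. x \<in> carrier G \<Longrightarrow> act x \<in> hom ?T ?T \<and>
      (\<forall>g\<in>carrier G. \<forall>h\<in>carrier G. act x (q_wedge G q g h) = q_wedge G q (conj_by G g x) (conj_by G h x)) \<and>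
      (\<forall>g\<in>carrier G. act x (q_wedge_hat G q g) = q_wedge_hat G q (conj_by G g x))"
    by metis
  obtain del where del: "del \<in> hom ?T G"
      "\<And>g h. g \<in> carrier G \<Longrightarrow> h \<in> carrier G \<Longrightarrow> del (q_wedge G q g h) = commutator G g h"
      "\<And>g. g \<in> carrier G \<Longrightarrow> del (q_wedge_hat G q g) = g [^] q"
    using q_exterior_square_universal[OF commutator_power_pairing[of q]]
    by (auto simp: commutator_def word_simps)
  have "q_exterior G ?T q (q_wedge G q) (q_wedge_hat G q) act del"
    by unfold_locales
      (use act del q_exterior_square_generated q_wedge_self q_wedge_hat_trivial in auto)
  then show ?thesis by blast
qed

end

section \<open>Central extensions of exponent \<open>q\<close>\<close>

locale central_q_extension = p: group_hom E G p
  for E :: "('e, 'k) monoid_scheme" (structure) and G :: "('g, 'm) monoid_scheme" and p +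
  fixes q :: nat and s :: "'g \<Rightarrow> 'e"
  assumes s_closed [simp]: "g \<in> carrier G \<Longrightarrow> s g \<in> carrier E"
    and p_s [simp]: "g \<in> carrier G \<Longrightarrow> p (s g) = g"
    and central: "k \<in> kernel E G p \<Longrightarrow> x \<in> carrier E \<Longrightarrow> k \<otimes> x = x \<otimes> k"
    and exponent: "k \<in> kernel E G p \<Longrightarrow> k [^] q = \<one>"
begin

lemma same_image:
  assumes "a \<in> carrier E" "b \<in> carrier E" "p a = p b"
  obtains k where "k \<in> kernel E G p" "b = k \<otimes> a"
proof
  show "b \<otimes> inv a \<in> kernel E G p"
    using assms by (simp add: kernel_def)
  show "b = b \<otimes> inv a \<otimes> a"
    using assms by (simp add: p.G.m_assoc)
qed

text \<open>Arguments with the same image differ by a central factor, which cancels in a commutator; in a \<open>q\<close>-th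
  power, below, it contributes its \<open>q\<close>-th power, which is trivial.\<close>

lemma commutator_cong_right:
  assumes "a \<in> carrier E" "b \<in> carrier E" "b' \<in> carrier E" "p b = p b'"
  shows "commutator E a b = commutator E a b'"
proof -
  obtain k where k: "k \<in> kernel E G p" "b' = k \<otimes> b"
    using same_image assms by blast
  have kc: "k \<in> carrier E" using k by (simp add: kernel_def)
  have "commutator E a b' = inv a \<otimes> inv b \<otimes> (inv k \<otimes> (a \<otimes> k)) \<otimes> b"
    using assms kc k by (simp add: commutator_def p.G.word_simps)
  also have "a \<otimes> k = k \<otimes> a" using central[OF k(1) assms(1)] by simp
  finally show ?thesis
    using assms kc by (simp add: commutator_def p.G.word_simps)
qed

lemma commutator_cong:
  assumes "a \<in> carrier E" "a' \<in> carrier E" "b \<in> carrier E" "b' \<in> carrier E" "p a = p a'" "p b = p b'"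
  shows "commutator E a b = commutator E a' b'"
proof -
  have "commutator E a b = inv commutator E b a"
    using assms by (simp add: commutator_def p.G.word_simps)
  also have "\<dots> = inv commutator E b a'"
    using commutator_cong_right[of b a a'] assms by simp
  also have "\<dots> = commutator E a' b"
    using assms by (simp add: commutator_def p.G.word_simps)
  also have "\<dots> = commutator E a' b'"
    by (rule commutator_cong_right[OF assms(2,3,4,6)])
  finally show ?thesis .
qed

lemma power_cong:
  assumes "a \<in> carrier E" "b \<in> carrier E" "p a = p b"
  shows "a [^] q = b [^] q"
proof -
  obtain k where k: "k \<in> kernel E G p" "b = k \<otimes> a"
    using same_image assms by blast
  then have kc: "k \<in> carrier E" by (simp add: kernel_def)
  have "b [^] q = k [^] q \<otimes> a [^] q"
    unfolding k(2) by (rule p.G.pow_mult_distrib[OF central[OF k(1) assms(1)] kc assms(1)])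
  then show ?thesis using exponent[OF k(1)] assms(1) by simp
qed

text \<open>The section need not be a homomorphism, but by the congruence lemmas \<open>s (g \<otimes> h)\<close> may be replaced by
  \<open>s g \<otimes> s h\<close> inside commutators and \<open>q\<close>-th powers, so the relations reduce to identities in \<open>E\<close>.\<close>

theorem section_pairing:
  "q_pairing G E q (\<lambda>g h. commutator E (s g) (s h)) (\<lambda>k. s k [^] q)"
proof -
  interpret E: q_pairing E E q "commutator E" "\<lambda>k. k [^] q"
    by (rule p.G.commutator_power_pairing)
  note cong = commutator_cong
  show ?thesis
  proof unfold_locales
    fix g h h1 assume c: "g \<in> carrier G" "h \<in> carrier G" "h1 \<in> carrier G"
    have "commutator E (s g) (s (h \<otimes>\<^bsub>G\<^esub> h1)) = commutator E (s g) (s h \<otimes> s h1)"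
      using c by (intro cong) simp_all
    also have "\<dots> = commutator E (s g) (s h1)
        \<otimes> commutator E (conj_by E (s g) (s h1)) (conj_by E (s h) (s h1))"
      using c by (intro E.tens_mult_right) simp_all
    also have "commutator E (conj_by E (s g) (s h1)) (conj_by E (s h) (s h1))
        = commutator E (s (conj_by G g h1)) (s (conj_by G h h1))"
      using c by (intro cong) (simp_all add: p.hom_conj_by)
    finally show "commutator E (s g) (s (h \<otimes>\<^bsub>G\<^esub> h1)) = commutator E (s g) (s h1)
        \<otimes> commutator E (s (conj_by G g h1)) (s (conj_by G h h1))" .
  next
    fix g g1 h assume c: "g \<in> carrier G" "g1 \<in> carrier G" "h \<in> carrier G"
    have "commutator E (s (g \<otimes>\<^bsub>G\<^esub> g1)) (s h) = commutator E (s g \<otimes> s g1) (s h)"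
      using c by (intro cong) simp_all
    also have "\<dots> = commutator E (conj_by E (s g) (s g1)) (conj_by E (s h) (s g1))
        \<otimes> commutator E (s g1) (s h)"
      using c by (intro E.tens_mult_left) simp_all
    also have "commutator E (conj_by E (s g) (s g1)) (conj_by E (s h) (s g1))
        = commutator E (s (conj_by G g g1)) (s (conj_by G h g1))"
      using c by (intro cong) (simp_all add: p.hom_conj_by)
    finally show "commutator E (s (g \<otimes>\<^bsub>G\<^esub> g1)) (s h)
        = commutator E (s (conj_by G g g1)) (s (conj_by G h g1)) \<otimes> commutator E (s g1) (s h)" .
  next
    fix g h k assume c: "g \<in> carrier G" "h \<in> carrier G" "k \<in> carrier G"
    have "conj_by E (commutator E (s g) (s h)) (s k [^] q)
        = commutator E (conj_by E (s g) ((s k [^] q) [^] (1::nat))) (conj_by E (s h) ((s k [^] q) [^] (1::nat)))"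
      using c by (simp add: conj_by_def commutator_def p.G.word_simps)
    also have "\<dots> = commutator E (s (conj_by G g (k [^]\<^bsub>G\<^esub> q))) (s (conj_by G h (k [^]\<^bsub>G\<^esub> q)))"
      using c by (intro cong) (simp_all add: p.hom_conj_by p.hom_nat_pow)
    finally show "conj_by E (commutator E (s g) (s h)) (s k [^] q)
        = commutator E (s (conj_by G g (k [^]\<^bsub>G\<^esub> q))) (s (conj_by G h (k [^]\<^bsub>G\<^esub> q)))" .
  next
    fix k k1 assume c: "k \<in> carrier G" "k1 \<in> carrier G"
    have "s (k \<otimes>\<^bsub>G\<^esub> k1) [^] q = (s k \<otimes> s k1) [^] q"
      using c by (intro power_cong) simp_all
    also have "\<dots> = s k [^] q \<otimes> list_prod E (map (\<lambda>i. commutator E (conj_by E (s k) (s k [^] (q - 1 - i)))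
           (conj_by E (inv (s k1 [^] i)) (s k [^] (q - 1 - i)))) [1..<q]) \<otimes> s k1 [^] q"
      using c by (intro p.G.power_of_product) simp_all
    also have "map (\<lambda>i. commutator E (conj_by E (s k) (s k [^] (q - 1 - i)))
           (conj_by E (inv (s k1 [^] i)) (s k [^] (q - 1 - i)))) [1..<q]
        = power_factors G q (\<lambda>g h. commutator E (s g) (s h)) k k1"
      using c by (intro map_cong refl cong) (simp_all add: p.hom_conj_by p.hom_nat_pow)
    finally show "s (k \<otimes>\<^bsub>G\<^esub> k1) [^] q = s k [^] q
        \<otimes> list_prod E (power_factors G q (\<lambda>g h. commutator E (s g) (s h)) k k1) \<otimes> s k1 [^] q" .
    show "commutator E (s k [^] q) (s k1 [^] q) = commutator E (s (k [^]\<^bsub>G\<^esub> q)) (s (k1 [^]\<^bsub>G\<^esub> q))"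
      using c by (intro cong) (simp_all add: p.hom_nat_pow)
    show "s (commutator G k k1) [^] q = commutator E (s k) (s k1) [^] q"
      using c by (intro power_cong) (simp_all add: p.hom_commutator)
  qed simp_all
qed

end

section \<open>The subgroups generated by \<open>q\<close>-th powers and commutators\<close>

context group
begin

lemma set_mult_normal:
  assumes A: "A \<lhd> G" and B: "B \<lhd> G"
  shows "A <#> B \<lhd> G"
proof (rule normal_invI)
  show "subgroup (A <#> B) G"
    by (rule mult_norm_subgroup[OF A normal_imp_subgroup[OF B]])
  fix x h assume x: "x \<in> carrier G" and "h \<in> A <#> B"
  then obtain a b where ab: "a \<in> A" "b \<in> B" "h = a \<otimes> b" by (auto simp: set_mult_def)
  have c: "a \<in> carrier G" "b \<in> carrier G"
    using ab normal_imp_subgroup[OF A] normal_imp_subgroup[OF B] subgroup.subset by blast+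
  have "x \<otimes> h \<otimes> inv x = (x \<otimes> a \<otimes> inv x) \<otimes> (x \<otimes> b \<otimes> inv x)"
    using x c ab by (simp add: word_simps)
  moreover have "x \<otimes> a \<otimes> inv x \<in> A" "x \<otimes> b \<otimes> inv x \<in> B"
    using x ab normal.inv_op_closed2[OF A] normal.inv_op_closed2[OF B] by auto
  ultimately show "x \<otimes> h \<otimes> inv x \<in> A <#> B"
    unfolding set_mult_def by blast
qed

lemma set_mult_contains:
  assumes "subgroup A G" "subgroup B G"
  shows "A \<subseteq> A <#> B" "B \<subseteq> A <#> B"
proof -
  have "a = a \<otimes> \<one>" if "a \<in> A" for a using that subgroup.mem_carrier[OF assms(1)] by simp
  then show "A \<subseteq> A <#> B"
    unfolding set_mult_def using subgroup.one_closed[OF assms(2)] by blast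
  have "b = \<one> \<otimes> b" if "b \<in> B" for b using that subgroup.mem_carrier[OF assms(2)] by simp
  then show "B \<subseteq> A <#> B"
    unfolding set_mult_def using subgroup.one_closed[OF assms(1)] by blast
qed

lemma set_mult_least:
  assumes "subgroup H G" "A \<subseteq> H" "B \<subseteq> H"
  shows "A <#> B \<subseteq> H"
  using assms subgroup.m_closed[OF assms(1)] by (auto simp: set_mult_def)

lemma conj_nat_pow:
  assumes "g \<in> carrier G" "r \<in> carrier G"
  shows "g \<otimes> r [^] (q::nat) \<otimes> inv g = (g \<otimes> r \<otimes> inv g) [^] q"
proof -
  interpret c: group_hom G G "\<lambda>y. conj_by G y (inv g)"
    using conj_by_hom[of "inv g"] assms by unfold_locales simp
  show ?thesis using c.hom_nat_pow[of r q] assms by (simp add: conj_by_def)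
qed

lemma power_subgroup_normal:
  assumes R: "R \<lhd> G"
  shows "power_subgroup G R q \<lhd> G"
  unfolding power_subgroup_def
proof (rule normal_generateI)
  have Rc: "R \<subseteq> carrier G" using normal_imp_subgroup[OF R] subgroup.subset by blast
  then show "{x [^] q | x. x \<in> R} \<subseteq> carrier G" by auto
  fix h g assume "h \<in> {x [^] q | x. x \<in> R}" and g: "g \<in> carrier G"
  then obtain r where r: "r \<in> R" "h = r [^] q" by auto
  have "g \<otimes> h \<otimes> inv g = (g \<otimes> r \<otimes> inv g) [^] q"
    using r g Rc by (auto simp: conj_nat_pow)
  moreover have "g \<otimes> r \<otimes> inv g \<in> R" using r g normal.inv_op_closed2[OF R] by simp
  ultimately show "g \<otimes> h \<otimes> inv g \<in> {x [^] q | x. x \<in> R}" by blast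
qed

lemma commutator_subgroup_normal:
  assumes R: "R \<lhd> G"
  shows "commutator_subgroup G (carrier G) R \<lhd> G"
  unfolding commutator_subgroup_def
proof (rule normal_generateI)
  have Rc: "R \<subseteq> carrier G" using normal_imp_subgroup[OF R] subgroup.subset by blast
  then show "{commutator G a b | a b. a \<in> carrier G \<and> b \<in> R} \<subseteq> carrier G" by auto
  fix h g assume "h \<in> {commutator G a b | a b. a \<in> carrier G \<and> b \<in> R}" and g: "g \<in> carrier G"
  then obtain a b where ab: "a \<in> carrier G" "b \<in> R" "h = commutator G a b" by auto
  have "g \<otimes> h \<otimes> inv g = commutator G (g \<otimes> a \<otimes> inv g) (g \<otimes> b \<otimes> inv g)"
    using ab g Rc by (auto simp: commutator_def word_simps)
  moreover have "g \<otimes> b \<otimes> inv g \<in> R" using ab g normal.inv_op_closed2[OF R] by simp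
  moreover have "g \<otimes> a \<otimes> inv g \<in> carrier G" using ab g by simp
  ultimately show "g \<otimes> h \<otimes> inv g \<in> {commutator G a b | a b. a \<in> carrier G \<and> b \<in> R}" by blast
qed

lemma Eq_kernel_normal: "R \<lhd> G \<Longrightarrow> Eq_kernel G R q \<lhd> G"
  unfolding Eq_kernel_def
  by (intro set_mult_normal power_subgroup_normal commutator_subgroup_normal)

lemma Eq_kernel_contains:
  assumes R: "R \<lhd> G" and r: "r \<in> R"
  shows "r [^] q \<in> Eq_kernel G R q" "f \<in> carrier G \<Longrightarrow> commutator G f r \<in> Eq_kernel G R q"
proof -
  note contains = set_mult_contains[OF normal_imp_subgroup[OF power_subgroup_normal[OF R]]
      normal_imp_subgroup[OF commutator_subgroup_normal[OF R]], folded Eq_kernel_def]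
  have "r [^] q \<in> power_subgroup G R q"
    unfolding power_subgroup_def using r by (intro generate.incl) auto
  then show "r [^] q \<in> Eq_kernel G R q" using contains by blast
  show "commutator G f r \<in> Eq_kernel G R q" if "f \<in> carrier G"
  proof -
    have "commutator G f r \<in> commutator_subgroup G (carrier G) R"
      unfolding commutator_subgroup_def using r that by (intro generate.incl) auto
    then show ?thesis using contains by blast
  qed
qed

lemma Eq_kernel_least:
  assumes H: "subgroup H G" and "\<And>r. r \<in> R \<Longrightarrow> r [^] q \<in> H"
    and "\<And>f r. f \<in> carrier G \<Longrightarrow> r \<in> R \<Longrightarrow> commutator G f r \<in> H"
  shows "Eq_kernel G R q \<subseteq> H"
  unfolding Eq_kernel_def power_subgroup_def commutator_subgroup_def
  by (intro set_mult_least[OF H] generate_subgroup_incl[OF _ H]) (use assms in auto)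

lemma derived_power_subgroup_is_subgroup: "subgroup (derived_power_subgroup G q) G"
  unfolding derived_power_subgroup_def
  using power_subgroup_normal[of "carrier G" q] normal_self
  by (intro mult_norm_subgroup derived_self_is_normal normal_imp_subgroup) auto

lemma derived_power_contains:
  shows "a \<in> carrier G \<Longrightarrow> b \<in> carrier G \<Longrightarrow> commutator G a b \<in> derived_power_subgroup G q"
    and "a \<in> carrier G \<Longrightarrow> a [^] q \<in> derived_power_subgroup G q"
proof -
  note contains = set_mult_contains[OF normal_imp_subgroup[OF derived_self_is_normal]
      normal_imp_subgroup[OF power_subgroup_normal[OF normal_self, of q]], folded derived_power_subgroup_def]
  show "commutator G a b \<in> derived_power_subgroup G q" if "a \<in> carrier G" "b \<in> carrier G"
  proof -
    have "commutator G a b = inv a \<otimes> inv b \<otimes> inv (inv a) \<otimes> inv (inv b)"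
      using that by (simp add: commutator_def)
    then have "commutator G a b \<in> derived_set G (carrier G)"
      using that by (blast intro: inv_closed)
    then have "commutator G a b \<in> derived G (carrier G)"
      unfolding derived_def by (rule generate.incl)
    then show ?thesis using contains by blast
  qed
  show "a [^] q \<in> derived_power_subgroup G q" if "a \<in> carrier G"
  proof -
    have "a [^] q \<in> power_subgroup G (carrier G) q"
      unfolding power_subgroup_def using that by (intro generate.incl) auto
    then show ?thesis using contains by blast
  qed
qed

lemma derived_power_least:
  assumes H: "subgroup H G" and "\<And>a b. a \<in> carrier G \<Longrightarrow> b \<in> carrier G \<Longrightarrow> commutator G a b \<in> H"
    and "\<And>a. a \<in> carrier G \<Longrightarrow> a [^] q \<in> H"
  shows "derived_power_subgroup G q \<subseteq> H"
proof -
  have "a \<otimes> b \<otimes> inv a \<otimes> inv b \<in> H" if "a \<in> carrier G" "b \<in> carrier G" for a b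
    using assms(2)[of "inv a" "inv b"] that by (simp add: commutator_def)
  then show ?thesis
    unfolding derived_power_subgroup_def derived_def power_subgroup_def
    by (intro set_mult_least[OF H] generate_subgroup_incl[OF _ H]) (use assms in auto)
qed

end

section \<open>The \<open>q\<close>-exterior square in terms of a free presentation\<close>

locale free_presentation = G: group G for G :: "('g, 'm) monoid_scheme" (structure) +
  fixes n q :: nat and F :: "nat word monoid" and R :: "nat word set" and \<pi> :: "nat word \<Rightarrow> 'g"
  assumes F_def: "F = free_group {1..n}"
    and R_def: "R = kernel F G \<pi>"
    and \<pi>_hom: "\<pi> \<in> hom F G"
    and \<pi>_surj: "\<pi> ` carrier F = carrier G"
begin

abbreviation "E \<equiv> Eq_group F R q"
abbreviation "N \<equiv> Eq_kernel F R q"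

definition \<nu> :: "nat word \<Rightarrow> nat word set" where
  "\<nu> f = N #>\<^bsub>F\<^esub> f"

sublocale \<pi>: group_hom F G \<pi>
  using \<pi>_hom group_free_group[of "{1..n}"] unfolding F_def
  by (simp add: group_hom_def group_hom_axioms_def G.group_axioms)

lemma \<pi>_lift:
  assumes "g \<in> carrier G"
  obtains f where "f \<in> carrier F" "g = \<pi> f"
proof -
  have "g \<in> \<pi> ` carrier F" unfolding \<pi>_surj by (rule assms)
  then show thesis using that by auto
qed

lemma mem_R: "r \<in> R \<longleftrightarrow> r \<in> carrier F \<and> \<pi> r = \<one>"
  by (simp add: R_def kernel_def)

lemma R_normal: "R \<lhd> F"
  unfolding R_def by (rule \<pi>.normal_kernel)

sublocale N: normal N F
  by (rule \<pi>.G.Eq_kernel_normal[OF R_normal])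

lemma group_E: "group E"
  unfolding Eq_group_def by (rule N.factorgroup_is_group)

lemma \<nu>_hom: "\<nu> \<in> hom F E"
  unfolding Eq_group_def \<nu>_def[abs_def] by (rule N.r_coset_hom_Mod)

sublocale \<nu>: group_hom F E \<nu>
  using \<nu>_hom group_E by (simp add: group_hom_def group_hom_axioms_def \<pi>.G.group_axioms)

lemma carrier_E: "carrier E = \<nu> ` carrier F"
  by (simp add: Eq_group_def carrier_FactGroup \<nu>_def[abs_def])

lemma \<nu>_eq_one: "f \<in> carrier F \<Longrightarrow> \<nu> f = \<one>\<^bsub>E\<^esub> \<longleftrightarrow> f \<in> N"
  using \<pi>.G.coset_join1[OF _ _ N.subgroup_axioms, of f] \<pi>.G.coset_join2[OF _ N.subgroup_axioms, of f]
  by (auto simp: \<nu>_def Eq_group_def)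

lemma N_subset_R: "N \<subseteq> R"
proof (rule \<pi>.G.Eq_kernel_least[OF normal_imp_subgroup[OF R_normal]])
  fix r assume "r \<in> R"
  then show "r [^]\<^bsub>F\<^esub> q \<in> R" by (simp add: mem_R \<pi>.hom_nat_pow)
  fix f assume "f \<in> carrier F"
  with \<open>r \<in> R\<close> show "commutator F f r \<in> R" by (simp add: mem_R \<pi>.hom_commutator)
qed

lemma exists_projection: "\<exists>p. p \<in> hom E G \<and> (\<forall>f\<in>carrier F. p (\<nu> f) = \<pi> f)"
proof -
  have "N \<subseteq> kernel F G \<pi>" using N_subset_R mem_R by (auto simp: kernel_def)
  from \<pi>.FactGroup_universal_kernel[OF N.normal_axioms this] show ?thesis
    unfolding Eq_group_def \<nu>_def by metis
qed

definition p :: "nat word set \<Rightarrow> 'g" where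
  "p = (SOME p. p \<in> hom E G \<and> (\<forall>f\<in>carrier F. p (\<nu> f) = \<pi> f))"

lemma p_hom: "p \<in> hom E G" and p_\<nu>: "f \<in> carrier F \<Longrightarrow> p (\<nu> f) = \<pi> f"
  using someI_ex[OF exists_projection] unfolding p_def by blast+

definition s :: "'g \<Rightarrow> nat word set" where
  "s g = \<nu> (SOME f. f \<in> carrier F \<and> \<pi> f = g)"

lemma s_properties:
  assumes "g \<in> carrier G"
  shows "s g \<in> carrier E" "p (s g) = g"
proof -
  have "\<exists>f. f \<in> carrier F \<and> \<pi> f = g" using \<pi>_lift[OF assms] by metis
  from someI_ex[OF this] have f: "(SOME f. f \<in> carrier F \<and> \<pi> f = g) \<in> carrier F" "\<pi> (SOME f. f \<in> carrier F \<and> \<pi> f = g) = g"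
    by simp_all
  show "s g \<in> carrier E" unfolding s_def by (rule \<nu>.hom_closed[OF f(1)])
  show "p (s g) = g" unfolding s_def p_\<nu>[OF f(1)] by (rule f(2))
qed

lemma kernel_p: "kernel E G p = \<nu> ` R"
  by (auto simp: kernel_def mem_R carrier_E p_\<nu>)

sublocale central_q_extension E G p q s
proof -
  interpret p: group_hom E G p
    using p_hom group_E by (simp add: group_hom_def group_hom_axioms_def G.group_axioms)
  show "central_q_extension E G p q s"
  proof
    fix k x assume k: "k \<in> kernel E G p" and x: "x \<in> carrier E"
    obtain r f where r: "r \<in> R" "k = \<nu> r" and f: "f \<in> carrier F" "x = \<nu> f"
      using k x kernel_p carrier_E by auto
    have rc: "r \<in> carrier F" using r by (simp add: mem_R)
    have "\<nu> (commutator F f r) = \<one>\<^bsub>E\<^esub>"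
      using \<nu>_eq_one[of "commutator F f r"] \<pi>.G.Eq_kernel_contains(2)[OF R_normal r(1) f(1)] f rc by simp
    then have "commutator E x k = \<one>\<^bsub>E\<^esub>"
      using f r rc by (simp add: \<nu>.hom_commutator)
    moreover have kx: "k \<in> carrier E" "x \<in> carrier E" using r rc f by simp_all
    then have "x \<otimes>\<^bsub>E\<^esub> k = k \<otimes>\<^bsub>E\<^esub> x \<otimes>\<^bsub>E\<^esub> commutator E x k"
      by (simp add: commutator_def \<nu>.H.word_simps)
    ultimately show "k \<otimes>\<^bsub>E\<^esub> x = x \<otimes>\<^bsub>E\<^esub> k" using kx by simp
  next
    fix k assume k: "k \<in> kernel E G p"
    obtain r where r: "r \<in> R" "k = \<nu> r"
      using k kernel_p by auto
    have rc: "r \<in> carrier F" using r by (simp add: mem_R)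
    then show "k [^]\<^bsub>E\<^esub> q = \<one>\<^bsub>E\<^esub>"
      using \<nu>_eq_one[of "r [^]\<^bsub>F\<^esub> q"] \<pi>.G.Eq_kernel_contains(1)[OF R_normal r(1), of q] r
      by (simp add: \<nu>.hom_nat_pow)
  qed (use s_properties in auto)
qed

text \<open>The map \<open>\<Phi>\<close> sends wedges to commutators and hats to \<open>q\<close>-th powers in \<open>E\<close>, so it is onto. For
  injectivity, \<open>lift\<close> shows that every \<open>u\<close> is related by \<open>S\<close> to some \<open>f\<close> above \<open>\<Phi> u\<close>, and \<open>N_S\<close> shows that
  elements of the kernel of \<open>\<nu>\<close> are related to \<open>\<one>\<close>; an element related to \<open>\<one>\<close> in \<open>F\<close> is trivial.\<close>

theorem q_exterior_square_iso:
  "q_exterior_square G q \<cong> E\<lparr>carrier := derived_power_subgroup E q\<rparr>"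
proof -
  let ?T = "q_exterior_square G q" and ?D = "derived_power_subgroup E q"
  obtain act del where ext: "q_exterior G ?T q (q_wedge G q) (q_wedge_hat G q) act del"
    using G.q_exterior_square_crossed_module by blast
  interpret T: generated_q_exterior G ?T q "q_wedge G q" "q_wedge_hat G q" act del n "\<lambda>i. \<pi> (free_gen i)"
  proof -
    interpret q_exterior G ?T q "q_wedge G q" "q_wedge_hat G q" act del by (rule ext)
    show "generated_q_exterior G ?T q (q_wedge G q) (q_wedge_hat G q) act del n (\<lambda>i. \<pi> (free_gen i))"
      by unfold_locales (simp add: F_def)
  qed
  obtain S where S: "subgroup S (F \<times>\<times> ?T)"
    and S_comm: "\<And>f h. f \<in> carrier F \<Longrightarrow> h \<in> carrier F \<Longrightarrow> (commutator F f h, q_wedge G q (\<pi> f) (\<pi> h)) \<in> S"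
    and S_hat: "\<And>f. f \<in> carrier F \<Longrightarrow> (f [^]\<^bsub>F\<^esub> q, q_wedge_hat G q (\<pi> f)) \<in> S"
    and S_one: "\<And>u. (\<one>\<^bsub>F\<^esub>, u) \<in> S \<Longrightarrow> u = \<one>\<^bsub>?T\<^esub>"
    using T.free_group_realisation[OF \<pi>_hom[unfolded F_def]] unfolding F_def by blast
  obtain \<Phi> where \<Phi>: "\<Phi> \<in> hom ?T E"
    "\<And>g h. g \<in> carrier G \<Longrightarrow> h \<in> carrier G \<Longrightarrow> \<Phi> (q_wedge G q g h) = commutator E (s g) (s h)"
    "\<And>g. g \<in> carrier G \<Longrightarrow> \<Phi> (q_wedge_hat G q g) = s g [^]\<^bsub>E\<^esub> q"
    using G.q_exterior_square_universal[OF section_pairing] by (auto simp: commutator_def \<nu>.H.word_simps)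
  interpret \<Phi>: group_hom ?T E \<Phi>
    using \<Phi>(1) by unfold_locales
  have \<Phi>_comm: "\<Phi> (q_wedge G q (p a) (p b)) = commutator E a b" if "a \<in> carrier E" "b \<in> carrier E" for a b
    using that by (simp add: \<Phi>(2)) (rule commutator_cong; simp)
  have \<Phi>_hat: "\<Phi> (q_wedge_hat G q (p a)) = a [^]\<^bsub>E\<^esub> q" if "a \<in> carrier E" for a
    using that by (simp add: \<Phi>(3)) (rule power_cong; simp)
  have image: "\<Phi> ` carrier ?T = ?D"
  proof
    have "subgroup {u \<in> carrier ?T. \<Phi> u \<in> ?D} ?T"
      using \<nu>.H.derived_power_subgroup_is_subgroup[of q]
      by unfold_locales (auto simp: subgroup.m_closed subgroup.one_closed subgroup.m_inv_closed)
    from T.subgroup_eq_carrierI[OF this] show "\<Phi> ` carrier ?T \<subseteq> ?D"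
      by (auto simp: \<Phi>(2,3) \<nu>.H.derived_power_contains)
    show "?D \<subseteq> \<Phi> ` carrier ?T"
    proof (rule \<nu>.H.derived_power_least[OF \<Phi>.img_is_subgroup])
      fix a assume a: "a \<in> carrier E"
      then have "q_wedge_hat G q (p a) \<in> carrier ?T" by simp
      then show "a [^]\<^bsub>E\<^esub> q \<in> \<Phi> ` carrier ?T" using \<Phi>_hat[OF a] by (metis imageI)
      fix b assume b: "b \<in> carrier E"
      then have "q_wedge G q (p a) (p b) \<in> carrier ?T" using a by simp
      then show "commutator E a b \<in> \<Phi> ` carrier ?T" using \<Phi>_comm[OF a b] by (metis imageI)
    qed
  qed
  have lift: "\<exists>f\<in>carrier F. (f, u) \<in> S \<and> \<Phi> u = \<nu> f" if u: "u \<in> carrier ?T" for u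
  proof -
    let ?H = "{u \<in> carrier ?T. \<exists>f\<in>carrier F. (f, u) \<in> S \<and> \<Phi> u = \<nu> f}"
    have "subgroup ?H ?T"
    proof
      show "?H \<subseteq> carrier ?T" by auto
      show "\<one>\<^bsub>?T\<^esub> \<in> ?H"
        using subgroup.one_closed[OF S] by (auto intro!: bexI[of _ "\<one>\<^bsub>F\<^esub>"])
      fix u assume "u \<in> ?H"
      then obtain f where f: "f \<in> carrier F" "(f, u) \<in> S" "\<Phi> u = \<nu> f" "u \<in> carrier ?T" by auto
      have "(inv\<^bsub>F\<^esub> f, inv\<^bsub>?T\<^esub> u) \<in> S"
        using subgroup.m_inv_closed[OF S f(2)] f
        by (simp add: inv_DirProd[OF \<pi>.G.group_axioms T.T.group_axioms])
      then show "inv\<^bsub>?T\<^esub> u \<in> ?H" using f by (auto intro!: bexI[of _ "inv\<^bsub>F\<^esub> f"])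
      fix v assume "v \<in> ?H"
      then obtain h where h: "h \<in> carrier F" "(h, v) \<in> S" "\<Phi> v = \<nu> h" "v \<in> carrier ?T" by auto
      have "(f \<otimes>\<^bsub>F\<^esub> h, u \<otimes>\<^bsub>?T\<^esub> v) \<in> S"
        using subgroup.m_closed[OF S f(2) h(2)] by simp
      then show "u \<otimes>\<^bsub>?T\<^esub> v \<in> ?H" using f h by (auto intro!: bexI[of _ "f \<otimes>\<^bsub>F\<^esub> h"])
    qed
    moreover have "q_wedge G q g h \<in> ?H" if "g \<in> carrier G" "h \<in> carrier G" for g h
    proof -
      obtain f f' where f: "f \<in> carrier F" "g = \<pi> f" "f' \<in> carrier F" "h = \<pi> f'"
        using \<pi>_lift[OF \<open>g \<in> carrier G\<close>] \<pi>_lift[OF \<open>h \<in> carrier G\<close>] by metis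
      have "\<Phi> (q_wedge G q (\<pi> f) (\<pi> f')) = \<nu> (commutator F f f')"
        using \<Phi>_comm[of "\<nu> f" "\<nu> f'"] f(1,3) by (simp add: \<nu>.hom_commutator p_\<nu>)
      moreover have "commutator F f f' \<in> carrier F" "q_wedge G q (\<pi> f) (\<pi> f') \<in> carrier ?T"
        using f(1,3) by simp_all
      ultimately show ?thesis
        using S_comm[OF f(1,3)] unfolding f(2,4) by blast
    qed
    moreover have "q_wedge_hat G q g \<in> ?H" if "g \<in> carrier G" for g
    proof -
      obtain f where f: "f \<in> carrier F" "g = \<pi> f"
        using \<pi>_lift[OF \<open>g \<in> carrier G\<close>] by metis
      have "\<Phi> (q_wedge_hat G q (\<pi> f)) = \<nu> (f [^]\<^bsub>F\<^esub> q)"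
        using \<Phi>_hat[of "\<nu> f"] f(1) by (simp add: \<nu>.hom_nat_pow p_\<nu>)
      moreover have "f [^]\<^bsub>F\<^esub> q \<in> carrier F" "q_wedge_hat G q (\<pi> f) \<in> carrier ?T"
        using f(1) by simp_all
      ultimately show ?thesis
        using S_hat[OF f(1)] unfolding f(2) by blast
    qed
    ultimately have "u \<in> ?H" using T.subgroup_eq_carrierI u by blast
    then show ?thesis by simp
  qed
  have N_S: "(f, \<one>\<^bsub>?T\<^esub>) \<in> S" if f: "f \<in> N" for f
  proof -
    let ?H = "{f \<in> carrier F. (f, \<one>\<^bsub>?T\<^esub>) \<in> S}"
    have "subgroup ?H F"
    proof
      show "?H \<subseteq> carrier F" by auto
      show "\<one>\<^bsub>F\<^esub> \<in> ?H" using subgroup.one_closed[OF S] by simp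
      fix f assume f: "f \<in> ?H"
      then show "inv\<^bsub>F\<^esub> f \<in> ?H"
        using subgroup.m_inv_closed[OF S, of "(f, \<one>\<^bsub>?T\<^esub>)"]
        by (simp add: inv_DirProd[OF \<pi>.G.group_axioms T.T.group_axioms])
      fix h assume "h \<in> ?H"
      then show "f \<otimes>\<^bsub>F\<^esub> h \<in> ?H"
        using subgroup.m_closed[OF S, of "(f, \<one>\<^bsub>?T\<^esub>)" "(h, \<one>\<^bsub>?T\<^esub>)"] f by simp
    qed
    moreover have "r [^]\<^bsub>F\<^esub> q \<in> ?H" if "r \<in> R" for r
      using S_hat[of r] that by (simp add: mem_R)
    moreover have "commutator F f r \<in> ?H" if "r \<in> R" "f \<in> carrier F" for f r
      using S_comm[of f r] that by (simp add: mem_R)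
    ultimately have "N \<subseteq> ?H" using \<pi>.G.Eq_kernel_least[of ?H R q] by blast
    then show ?thesis using f by auto
  qed
  have "u = \<one>\<^bsub>?T\<^esub>" if u: "u \<in> carrier ?T" "\<Phi> u = \<one>\<^bsub>E\<^esub>" for u
  proof -
    obtain f where f: "f \<in> carrier F" "(f, u) \<in> S" "\<Phi> u = \<nu> f" using lift u by blast
    have "f \<in> N" using \<nu>_eq_one[OF f(1)] u(2) f(3) by (metis (no_types))
    then have "inv\<^bsub>F\<^esub> f \<in> N" by (rule N.m_inv_closed)
    then have "(inv\<^bsub>F\<^esub> f, \<one>\<^bsub>?T\<^esub>) \<in> S" by (rule N_S)
    from subgroup.m_closed[OF S f(2) this] have "(\<one>\<^bsub>F\<^esub>, u) \<in> S" using f u by simp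
    then show ?thesis by (rule S_one)
  qed
  then have "inj_on \<Phi> (carrier ?T)"
    using \<Phi>.inj_on_one_iff by blast
  then have "\<Phi> \<in> iso ?T (E\<lparr>carrier := ?D\<rparr>)"
    using image by (auto simp: iso_def hom_def bij_betw_def)
  then show ?thesis by (auto simp: is_iso_def)
qed

end

section \<open>Chains with coefficients in \<open>\<int>\<^sub>q\<close>\<close>

lemma (in group) int_pow_mod:
  assumes b: "b \<in> carrier G" "b [^] q = \<one>"
  shows "b [^] (m mod int q) = b [^] (m :: int)"
proof -
  have "b [^] m = b [^] (int q * (m div int q) + m mod int q)"
    by simp
  also have "\<dots> = (b [^] int q) [^] (m div int q) \<otimes> b [^] (m mod int q)"
    using b(1) by (simp only: int_pow_mult int_pow_pow)
  also have "b [^] int q = \<one>" using b(2) by (simp add: int_pow_int)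
  finally show ?thesis using b(1) by simp
qed

abbreviation q_chains :: "nat \<Rightarrow> 'i set \<Rightarrow> ('i \<Rightarrow> int) monoid" where
  "q_chains q I \<equiv> chain_group I (integer_mod_group q)"

text \<open>The coefficient \<open>1 mod q\<close> makes this an element of the chain group for \<open>q = 1\<close> too, where it is \<open>0\<close>.\<close>

definition basis_chain :: "nat \<Rightarrow> 'i set \<Rightarrow> 'i \<Rightarrow> 'i \<Rightarrow> int" where
  "basis_chain q I i = (\<lambda>j\<in>I. if j = i then 1 mod int q else 0)"

text \<open>The linear extension of \<open>\<phi>\<close> from the basis to all chains.\<close>

definition chain_extend :: "('b, 'k) monoid_scheme \<Rightarrow> 'i set \<Rightarrow> ('i \<Rightarrow> 'b) \<Rightarrow> ('i \<Rightarrow> int) \<Rightarrow> 'b" where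
  "chain_extend B I \<phi> c = gfinprod B (\<lambda>i. \<phi> i [^]\<^bsub>B\<^esub> c i) I"

lemma carrier_chains:
  "c \<in> carrier (q_chains q I) \<longleftrightarrow> c \<in> I \<rightarrow>\<^sub>E carrier (integer_mod_group q) \<and> finite {i \<in> I. c i \<noteq> 0}"
  by (simp add: chain_group_def carrier_sum_group)

lemma mult_chains: "c \<otimes>\<^bsub>q_chains q I\<^esub> d = (\<lambda>i\<in>I. (c i + d i) mod int q)"
  by (simp add: chain_group_def)

lemma one_chains: "\<one>\<^bsub>q_chains q I\<^esub> = (\<lambda>i\<in>I. 0)"
  by (simp add: chain_group_def)

lemma comm_group_chains: "comm_group (q_chains q I)"
proof (rule group.group_comm_groupI)
  show "group (q_chains q I)" by (simp add: chain_group_def)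
qed (simp add: mult_chains add.commute)

lemma group_chains: "group (q_chains q I)"
  using comm_group_chains by (rule comm_group.axioms(2))

lemma one_mod_in_carrier: "1 mod int q \<in> carrier (integer_mod_group q)"
  by (simp add: carrier_integer_mod_group)

lemma basis_chain_closed: "basis_chain q I i \<in> carrier (q_chains q I)"
proof -
  have "{j \<in> I. basis_chain q I i j \<noteq> 0} \<subseteq> {i}"
    by (auto simp: basis_chain_def)
  then have "finite {j \<in> I. basis_chain q I i j \<noteq> 0}" by (rule finite_subset) simp
  then show ?thesis
    using one_mod_in_carrier by (auto simp: carrier_chains basis_chain_def)
qed

lemma evaluation_hom: "i \<in> I \<Longrightarrow> (\<lambda>c. c i) \<in> hom (q_chains q I) (integer_mod_group q)"
  by (rule homI) (auto simp: carrier_chains mult_chains)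

lemma chain_int_pow:
  assumes "c \<in> carrier (q_chains q I)" "i \<in> I"
  shows "(c [^]\<^bsub>q_chains q I\<^esub> (m::int)) i = (m * c i) mod int q"
proof -
  interpret e: group_hom "q_chains q I" "integer_mod_group q" "\<lambda>c. c i"
    using evaluation_hom[OF assms(2)] group_chains by (simp add: group_hom_def group_hom_axioms_def)
  show ?thesis using e.hom_int_pow[OF assms(1)] by (simp add: int_pow_integer_mod_group)
qed

lemma chains_exponent:
  assumes "c \<in> carrier (q_chains q I)"
  shows "c [^]\<^bsub>q_chains q I\<^esub> q = \<one>\<^bsub>q_chains q I\<^esub>"
proof
  interpret C: group "q_chains q I" by (rule group_chains)
  fix i
  have "c [^]\<^bsub>q_chains q I\<^esub> q \<in> carrier (q_chains q I)" using assms by simp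
  then have "(c [^]\<^bsub>q_chains q I\<^esub> q) i = undefined" if "i \<notin> I"
    using that by (auto simp: carrier_chains PiE_iff extensional_def)
  moreover have "(c [^]\<^bsub>q_chains q I\<^esub> q) i = 0" if "i \<in> I"
    using chain_int_pow[OF assms that, of "int q"] by (simp add: int_pow_int)
  ultimately show "(c [^]\<^bsub>q_chains q I\<^esub> q) i = \<one>\<^bsub>q_chains q I\<^esub> i"
    by (simp add: one_chains)
qed

lemma chains_subgroup_eq_carrier:
  assumes H: "subgroup H (q_chains q I)" and basis: "\<And>i. i \<in> I \<Longrightarrow> basis_chain q I i \<in> H"
    and c: "c \<in> carrier (q_chains q I)"
  shows "c \<in> H"
proof -
  interpret C: group "q_chains q I" by (rule group_chains)
  have "c \<in> H" if "finite S" "c \<in> carrier (q_chains q I)" "{i \<in> I. c i \<noteq> 0} \<subseteq> S" for S c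
    using that
  proof (induction S arbitrary: c rule: finite_induct)
    case empty
    then have "c = \<one>\<^bsub>q_chains q I\<^esub>"
      by (auto simp: one_chains carrier_chains PiE_iff extensional_def fun_eq_iff)
    then show ?case using subgroup.one_closed[OF H] by simp
  next
    case (insert i S)
    show ?case
    proof (cases "i \<in> I")
      case False
      then show ?thesis using insert by (intro insert.IH) auto
    next
      case True
      define d where "d = c(i := 0)"
      have sub: "{j \<in> I. d j \<noteq> 0} \<subseteq> {j \<in> I. c j \<noteq> 0}" by (auto simp: d_def)
      have dc: "d \<in> carrier (q_chains q I)"
        using insert.prems(1) True finite_subset[OF sub]
        by (auto simp: carrier_chains d_def PiE_iff extensional_def)
      have "{j \<in> I. d j \<noteq> 0} \<subseteq> S" using insert.prems(2) by (auto simp: d_def)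
      with dc have d: "d \<in> H" by (rule insert.IH)
      have pow: "basis_chain q I i [^]\<^bsub>q_chains q I\<^esub> c i \<in> H"
        using C.subgroup_int_pow_closed[OF H basis[OF True]] .
      have ci: "c j mod int q = c j" if "j \<in> I" for j
        using insert.prems(1) that by (cases "q = 0") (auto simp: carrier_chains carrier_integer_mod_group PiE_iff)
      have "(basis_chain q I i [^]\<^bsub>q_chains q I\<^esub> c i \<otimes>\<^bsub>q_chains q I\<^esub> d) j = c j" for j
      proof (cases "j \<in> I")
        case True
        have "(basis_chain q I i [^]\<^bsub>q_chains q I\<^esub> c i) j = (if j = i then c i mod int q else 0)"
          unfolding chain_int_pow[OF basis_chain_closed True]
          using True by (simp add: basis_chain_def mod_mult_right_eq)
        then show ?thesis
          using True ci[OF True] by (auto simp: mult_chains d_def)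
      next
        case False
        then show ?thesis
          using insert.prems(1) by (simp add: mult_chains carrier_chains PiE_iff extensional_def)
      qed
      then have "c = basis_chain q I i [^]\<^bsub>q_chains q I\<^esub> c i \<otimes>\<^bsub>q_chains q I\<^esub> d" by auto
      then show ?thesis using subgroup.m_closed[OF H pow d] by simp
    qed
  qed
  then show ?thesis using c by (auto simp: carrier_chains)
qed

lemma chains_hom_eqI:
  assumes "group B" "f1 \<in> hom (q_chains q I) B" "f2 \<in> hom (q_chains q I) B"
    and "\<And>i. i \<in> I \<Longrightarrow> f1 (basis_chain q I i) = f2 (basis_chain q I i)"
    and c: "c \<in> carrier (q_chains q I)"
  shows "f1 c = f2 c"
proof -
  interpret f1: group_hom "q_chains q I" B f1
    using assms by (simp add: group_hom_def group_hom_axioms_def group_chains)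
  interpret f2: group_hom "q_chains q I" B f2
    using assms by (simp add: group_hom_def group_hom_axioms_def group_chains)
  have "subgroup {c \<in> carrier (q_chains q I). f1 c = f2 c} (q_chains q I)"
    by unfold_locales auto
  from chains_subgroup_eq_carrier[OF this _ c] show ?thesis
    using assms(4) by (simp add: basis_chain_closed)
qed

lemma (in comm_group) chain_extend_hom:
  assumes \<phi>: "\<And>i. i \<in> I \<Longrightarrow> \<phi> i \<in> carrier G" "\<And>i. i \<in> I \<Longrightarrow> \<phi> i [^] q = \<one>"
  shows "chain_extend G I \<phi> \<in> hom (q_chains q I) G"
proof -
  have "(\<lambda>m. \<phi> i [^] (m::int)) \<in> hom (integer_mod_group q) G" if "i \<in> I" for i
    by (rule homI) (use \<phi> that in \<open>simp_all add: int_pow_mod int_pow_mult\<close>)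
  then show ?thesis
    unfolding chain_extend_def[abs_def] chain_group_def
    by (rule hom_group_sum) simp_all
qed

lemma (in comm_group) chain_extend_basis:
  assumes \<phi>: "\<And>i. i \<in> I \<Longrightarrow> \<phi> i \<in> carrier G" "\<And>i. i \<in> I \<Longrightarrow> \<phi> i [^] q = \<one>" and i: "i \<in> I"
  shows "chain_extend G I \<phi> (basis_chain q I i) = \<phi> i"
proof -
  have "chain_extend G I \<phi> (basis_chain q I i) = gfinprod G (\<lambda>j. \<phi> j [^] basis_chain q I i j) {i}"
    unfolding chain_extend_def
    by (rule gfinprod_mono_neutral_cong_right) (use \<phi> i in \<open>auto simp: basis_chain_def\<close>)
  also have "\<dots> = \<phi> i [^] (1 mod int q)"
    using \<phi> i by (simp add: basis_chain_def)
  also have "\<dots> = \<phi> i"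
    using int_pow_mod[of "\<phi> i" q 1] \<phi> i by simp
  finally show ?thesis .
qed

lemma chain_map_component:
  assumes "c \<in> carrier (q_chains q I)" "j \<in> J"
  shows "chain_map (integer_mod_group q) I J f c j = gfinprod (integer_mod_group q) c {i \<in> I. f i = j}"
proof -
  have "{i \<in> I. c i \<noteq> 0 \<and> f i = j} = {i \<in> {i \<in> I. f i = j}. c i \<noteq> 0}" by auto
  moreover have "finite {i \<in> {i \<in> I. f i = j}. c i \<noteq> 0}"
    using assms by (auto simp: carrier_chains elim: rev_finite_subset)
  ultimately show ?thesis
    using assms(2) by (simp add: chain_map_def gfinprod_def)
qed

lemma chain_map_hom:
  assumes f: "f ` I \<subseteq> J"
  shows "chain_map (integer_mod_group q) I J f \<in> hom (q_chains q I) (q_chains q J)"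
proof (rule homI)
  interpret A: comm_group "integer_mod_group q" by simp
  let ?m = "chain_map (integer_mod_group q) I J f"
  fix c assume c: "c \<in> carrier (q_chains q I)"
  then have cA: "c \<in> S \<rightarrow> carrier (integer_mod_group q)" if "S \<subseteq> I" for S
    using that by (auto simp: carrier_chains)
  have fin: "finite {i \<in> I. c i \<noteq> 0}" using c by (simp add: carrier_chains)
  have "?m c j = 0" if j: "j \<in> J" "j \<notin> f ` {i \<in> I. c i \<noteq> 0}" for j
  proof -
    have "{i \<in> I. c i \<noteq> 0 \<and> f i = j} = {}" using j by auto
    then have "?m c j = finprod (integer_mod_group q) c {}"
      using j(1) by (simp only: chain_map_def restrict_apply' one_integer_mod_group)
    then show ?thesis by simp
  qed
  then have "{j \<in> J. ?m c j \<noteq> 0} \<subseteq> f ` {i \<in> I. c i \<noteq> 0}" by blast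
  then have "finite {j \<in> J. ?m c j \<noteq> 0}" using finite_imageI[OF fin] by (rule finite_subset)
  moreover have "?m c j \<in> carrier (integer_mod_group q)" if "j \<in> J" for j
    unfolding chain_map_component[OF c that] by (rule A.gfinprod_closed[OF cA]) auto
  moreover have "?m c \<in> extensional J" by (simp add: chain_map_def)
  ultimately show "?m c \<in> carrier (q_chains q J)" by (simp add: carrier_chains PiE_iff)
  fix d assume d: "d \<in> carrier (q_chains q I)"
  then have dA: "d \<in> S \<rightarrow> carrier (integer_mod_group q)" if "S \<subseteq> I" for S
    using that by (auto simp: carrier_chains)
  interpret C: group "q_chains q I" by (rule group_chains)
  have cd: "c \<otimes>\<^bsub>q_chains q I\<^esub> d \<in> carrier (q_chains q I)" using c d by simp
  have "?m (c \<otimes>\<^bsub>q_chains q I\<^esub> d) j = (?m c j + ?m d j) mod int q" if j: "j \<in> J" for j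
  proof -
    let ?S = "{i \<in> I. f i = j}"
    have finS: "finite {i \<in> ?S. c i \<noteq> 0}" "finite {i \<in> ?S. d i \<noteq> 0}"
      using c d by (auto simp: carrier_chains elim: rev_finite_subset)
    have "gfinprod (integer_mod_group q) (c \<otimes>\<^bsub>q_chains q I\<^esub> d) ?S
        = gfinprod (integer_mod_group q) (\<lambda>i. c i \<otimes>\<^bsub>integer_mod_group q\<^esub> d i) ?S"
      using cA[of ?S] dA[of ?S]
      by (intro A.gfinprod_cong) (auto simp: mult_chains simp_implies_def intro!: A.m_closed[unfolded mult_integer_mod_group])
    also have "\<dots> = gfinprod (integer_mod_group q) c ?S \<otimes>\<^bsub>integer_mod_group q\<^esub> gfinprod (integer_mod_group q) d ?S"
      by (rule A.gfinprod_distrib) (use finS cA[of ?S] dA[of ?S] in auto)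
    finally show ?thesis
      by (simp add: chain_map_component[OF _ j] c d cd)
  qed
  then show "?m (c \<otimes>\<^bsub>q_chains q I\<^esub> d) = ?m c \<otimes>\<^bsub>q_chains q J\<^esub> ?m d"
    by (auto simp: mult_chains fun_eq_iff chain_map_def)
qed

lemma chain_map_basis:
  assumes f: "f ` I \<subseteq> J" and i: "i \<in> I"
  shows "chain_map (integer_mod_group q) I J f (basis_chain q I i) = basis_chain q J (f i)"
proof
  interpret A: comm_group "integer_mod_group q" by simp
  fix j
  show "chain_map (integer_mod_group q) I J f (basis_chain q I i) j = basis_chain q J (f i) j"
  proof (cases "j \<in> J")
    case True
    let ?S = "{i' \<in> I. basis_chain q I i i' \<noteq> 0 \<and> f i' = j}"
    have S: "?S = (if 1 mod int q \<noteq> 0 \<and> f i = j then {i} else {})"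
      using i by (auto simp: basis_chain_def)
    have "finprod (integer_mod_group q) (basis_chain q I i) ?S = (if f i = j then 1 mod int q else 0)"
      unfolding S using i one_mod_in_carrier[of q] by (auto simp: basis_chain_def)
    then show ?thesis using True by (auto simp: chain_map_def basis_chain_def)
  qed (simp add: chain_map_def basis_chain_def)
qed

lemma (in comm_group) hom_mult_hom:
  assumes "f \<in> hom H G" "h \<in> hom H G"
  shows "(\<lambda>c. f c \<otimes> h c) \<in> hom H G"
  using assms by (auto simp: hom_def m_ac Pi_iff)

lemma (in comm_group) hom_inv_hom:
  assumes "f \<in> hom H G"
  shows "(\<lambda>c. inv f c) \<in> hom H G"
  using assms by (auto simp: hom_def inv_mult Pi_iff)

context group
begin

lemma bar_d2_hom: "bar_d2 G (integer_mod_group q) \<in> hom (q_chains q (bar2 G)) (q_chains q (bar1 G))"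
proof -
  interpret C: comm_group "q_chains q (bar1 G)" by (rule comm_group_chains)
  show ?thesis
    unfolding bar_d2_def[abs_def] Let_def
    by (intro C.hom_mult_hom C.hom_inv_hom chain_map_hom) auto
qed

lemma bar_d2_basis:
  assumes "g \<in> carrier G" "h \<in> carrier G"
  shows "bar_d2 G (integer_mod_group q) (basis_chain q (bar2 G) (g, h))
    = basis_chain q (bar1 G) h \<otimes>\<^bsub>q_chains q (bar1 G)\<^esub> inv\<^bsub>q_chains q (bar1 G)\<^esub> basis_chain q (bar1 G) (g \<otimes> h)
      \<otimes>\<^bsub>q_chains q (bar1 G)\<^esub> basis_chain q (bar1 G) g"
  unfolding bar_d2_def Let_def using assms
  by (subst (1 2 3) chain_map_basis) auto

lemma bar_d3_hom: "bar_d3 G (integer_mod_group q) \<in> hom (q_chains q (bar3 G)) (q_chains q (bar2 G))"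
proof -
  interpret C: comm_group "q_chains q (bar2 G)" by (rule comm_group_chains)
  show ?thesis
    unfolding bar_d3_def[abs_def] Let_def
    by (intro C.hom_mult_hom C.hom_inv_hom chain_map_hom) auto
qed

lemma bar_d3_basis:
  assumes "g \<in> carrier G" "h \<in> carrier G" "k \<in> carrier G"
  shows "bar_d3 G (integer_mod_group q) (basis_chain q (bar3 G) (g, h, k))
    = basis_chain q (bar2 G) (h, k)
      \<otimes>\<^bsub>q_chains q (bar2 G)\<^esub> inv\<^bsub>q_chains q (bar2 G)\<^esub> basis_chain q (bar2 G) (g \<otimes> h, k)
      \<otimes>\<^bsub>q_chains q (bar2 G)\<^esub> basis_chain q (bar2 G) (g, h \<otimes> k)
      \<otimes>\<^bsub>q_chains q (bar2 G)\<^esub> inv\<^bsub>q_chains q (bar2 G)\<^esub> basis_chain q (bar2 G) (g, h)"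
  unfolding bar_d3_def Let_def using assms
  by (subst (1 2 3 4) chain_map_basis) auto

end

text \<open>Only basis chains have to be checked, and there the factors of the boundary cancel by the cocycle
  identity.\<close>

lemma (in group) cocycle_kills_boundaries:
  assumes "comm_group B" and f: "f \<in> hom (q_chains q (bar2 G)) B"
    and cocycle: "\<And>g h k. g \<in> carrier G \<Longrightarrow> h \<in> carrier G \<Longrightarrow> k \<in> carrier G \<Longrightarrow>
      f (basis_chain q (bar2 G) (h, k)) \<otimes>\<^bsub>B\<^esub> f (basis_chain q (bar2 G) (g, h \<otimes> k))
      = f (basis_chain q (bar2 G) (g, h)) \<otimes>\<^bsub>B\<^esub> f (basis_chain q (bar2 G) (g \<otimes> h, k))"
    and c: "c \<in> carrier (q_chains q (bar3 G))"
  shows "f (bar_d3 G (integer_mod_group q) c) = \<one>\<^bsub>B\<^esub>"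
proof (rule chains_hom_eqI[OF _ _ _ _ c])
  interpret B: comm_group B by fact
  interpret f: group_hom "q_chains q (bar2 G)" B f
    using f by (simp add: group_hom_def group_hom_axioms_def group_chains B.group_axioms)
  show "group B" by (rule B.group_axioms)
  show "(\<lambda>c. f (bar_d3 G (integer_mod_group q) c)) \<in> hom (q_chains q (bar3 G)) B"
    using Group.hom_compose[OF bar_d3_hom f] by (simp add: comp_def)
  show "(\<lambda>_. \<one>\<^bsub>B\<^esub>) \<in> hom (q_chains q (bar3 G)) B" by (simp add: hom_def)
  fix t assume "t \<in> bar3 G"
  then obtain g h k where t: "t = (g, h, k)" "g \<in> carrier G" "h \<in> carrier G" "k \<in> carrier G" by auto
  let ?f = "\<lambda>g h. f (basis_chain q (bar2 G) (g, h))"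
  have fc: "?f a b \<in> carrier B" for a b by (simp add: basis_chain_closed)
  have "f (bar_d3 G (integer_mod_group q) (basis_chain q (bar3 G) t))
      = ?f h k \<otimes>\<^bsub>B\<^esub> inv\<^bsub>B\<^esub> ?f (g \<otimes> h) k \<otimes>\<^bsub>B\<^esub> ?f g (h \<otimes> k) \<otimes>\<^bsub>B\<^esub> inv\<^bsub>B\<^esub> ?f g h"
    using t by (simp add: bar_d3_basis basis_chain_closed)
  also have "\<dots> = (?f h k \<otimes>\<^bsub>B\<^esub> ?f g (h \<otimes> k)) \<otimes>\<^bsub>B\<^esub> (inv\<^bsub>B\<^esub> ?f (g \<otimes> h) k \<otimes>\<^bsub>B\<^esub> inv\<^bsub>B\<^esub> ?f g h)"
    using fc by (simp add: B.m_ac)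
  also have "\<dots> = \<one>\<^bsub>B\<^esub>"
    unfolding cocycle[OF t(2-4)] using fc by (simp add: B.inv_mult_group[symmetric])
  finally show "f (bar_d3 G (integer_mod_group q) (basis_chain q (bar3 G) t)) = \<one>\<^bsub>B\<^esub>" .
qed

lemma (in comm_group) coboundary_identity:
  assumes "u \<in> carrier G" "v \<in> carrier G" "w \<in> carrier G" "x \<in> carrier G" "y \<in> carrier G" "z \<in> carrier G"
  shows "(w \<otimes> inv y \<otimes> v) \<otimes> (y \<otimes> inv z \<otimes> u) = (v \<otimes> inv x \<otimes> u) \<otimes> (w \<otimes> inv z \<otimes> x)"
proof -
  have "(w \<otimes> inv y \<otimes> v) \<otimes> (y \<otimes> inv z \<otimes> u) = (inv y \<otimes> y) \<otimes> (w \<otimes> v \<otimes> u \<otimes> inv z)"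
    using assms by (simp only: m_ac m_closed inv_closed)
  also have "\<dots> = (inv x \<otimes> x) \<otimes> (w \<otimes> v \<otimes> u \<otimes> inv z)"
    using assms by simp
  also have "\<dots> = (v \<otimes> inv x \<otimes> u) \<otimes> (w \<otimes> inv z \<otimes> x)"
    using assms by (simp only: m_ac m_closed inv_closed)
  finally show ?thesis .
qed

text \<open>The differential of \<open>[g|h]\<close> is the coboundary of the function \<open>g \<mapsto> [g]\<close>, hence a 2-cocycle.\<close>

lemma (in group) bar_d2_bar_d3:
  assumes c: "c \<in> carrier (q_chains q (bar3 G))"
  shows "bar_d2 G (integer_mod_group q) (bar_d3 G (integer_mod_group q) c) = \<one>\<^bsub>q_chains q (bar1 G)\<^esub>"
proof (rule cocycle_kills_boundaries[OF comm_group_chains bar_d2_hom _ c])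
  interpret C: comm_group "q_chains q (bar1 G)" by (rule comm_group_chains)
  fix g h k assume "g \<in> carrier G" "h \<in> carrier G" "k \<in> carrier G"
  then show "bar_d2 G (integer_mod_group q) (basis_chain q (bar2 G) (h, k))
      \<otimes>\<^bsub>q_chains q (bar1 G)\<^esub> bar_d2 G (integer_mod_group q) (basis_chain q (bar2 G) (g, h \<otimes> k))
    = bar_d2 G (integer_mod_group q) (basis_chain q (bar2 G) (g, h))
      \<otimes>\<^bsub>q_chains q (bar1 G)\<^esub> bar_d2 G (integer_mod_group q) (basis_chain q (bar2 G) (g \<otimes> h, k))"
    by (simp add: bar_d2_basis m_assoc C.coboundary_identity basis_chain_closed)
qed

section \<open>Two-cocycles split over free groups\<close>

locale two_cocycle = Q?: comm_group Q + G: group G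
  for Q (structure) and G :: "('g, 'm) monoid_scheme" and \<gamma> :: "'g \<Rightarrow> 'g \<Rightarrow> 'a" +
  assumes \<gamma>_closed [simp]: "g \<in> carrier G \<Longrightarrow> h \<in> carrier G \<Longrightarrow> \<gamma> g h \<in> carrier Q"
    and cocycle: "g \<in> carrier G \<Longrightarrow> h \<in> carrier G \<Longrightarrow> k \<in> carrier G \<Longrightarrow>
      \<gamma> h k \<otimes> \<gamma> g (h \<otimes>\<^bsub>G\<^esub> k) = \<gamma> g h \<otimes> \<gamma> (g \<otimes>\<^bsub>G\<^esub> h) k"
begin

lemma \<gamma>_one_left: "g \<in> carrier G \<Longrightarrow> \<gamma> \<one>\<^bsub>G\<^esub> g = \<gamma> \<one>\<^bsub>G\<^esub> \<one>\<^bsub>G\<^esub>"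
  using cocycle[of "\<one>\<^bsub>G\<^esub>" "\<one>\<^bsub>G\<^esub>" g] by simp

lemma \<gamma>_one_right: "g \<in> carrier G \<Longrightarrow> \<gamma> g \<one>\<^bsub>G\<^esub> = \<gamma> \<one>\<^bsub>G\<^esub> \<one>\<^bsub>G\<^esub>"
  using cocycle[of g "\<one>\<^bsub>G\<^esub>" "\<one>\<^bsub>G\<^esub>"] by simp

text \<open>The central extension of \<open>G\<close> by \<open>Q\<close> with factor set \<open>\<gamma>\<close>. Since \<open>\<gamma>\<close> need not be normalised, the identity
  element is \<open>(inv \<gamma> \<one> \<one>, \<one>)\<close>.\<close>

definition M :: "('a \<times> 'g) monoid" where
  "M = \<lparr>carrier = carrier Q \<times> carrier G,
        monoid.mult = (\<lambda>(u, g) (v, h). (u \<otimes> v \<otimes> \<gamma> g h, g \<otimes>\<^bsub>G\<^esub> h)),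
        one = (inv \<gamma> \<one>\<^bsub>G\<^esub> \<one>\<^bsub>G\<^esub>, \<one>\<^bsub>G\<^esub>)\<rparr>"

lemma group_M: "group M"
proof (rule groupI)
  show "\<one>\<^bsub>M\<^esub> \<in> carrier M" by (simp add: M_def)
  fix a assume "a \<in> carrier M"
  then obtain u g where a: "a = (u, g)" "u \<in> carrier Q" "g \<in> carrier G" by (auto simp: M_def)
  show "\<one>\<^bsub>M\<^esub> \<otimes>\<^bsub>M\<^esub> a = a"
  proof -
    let ?c = "\<gamma> \<one>\<^bsub>G\<^esub> \<one>\<^bsub>G\<^esub>"
    have "inv ?c \<otimes> u \<otimes> ?c = ?c \<otimes> (inv ?c \<otimes> u)"
      using a by (intro m_comm) simp_all
    also have "\<dots> = u"
      using a by (intro inv_cancel_left') simp_all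
    finally show ?thesis using a by (simp add: M_def \<gamma>_one_left[OF a(3)])
  qed
  let ?b = "(inv (u \<otimes> \<gamma> (inv\<^bsub>G\<^esub> g) g \<otimes> \<gamma> \<one>\<^bsub>G\<^esub> \<one>\<^bsub>G\<^esub>), inv\<^bsub>G\<^esub> g)"
  have "inv (u \<otimes> \<gamma> (inv\<^bsub>G\<^esub> g) g \<otimes> \<gamma> \<one>\<^bsub>G\<^esub> \<one>\<^bsub>G\<^esub>) \<otimes> u \<otimes> \<gamma> (inv\<^bsub>G\<^esub> g) g
      = inv (u \<otimes> \<gamma> (inv\<^bsub>G\<^esub> g) g) \<otimes> (u \<otimes> \<gamma> (inv\<^bsub>G\<^esub> g) g) \<otimes> inv \<gamma> \<one>\<^bsub>G\<^esub> \<one>\<^bsub>G\<^esub>"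
    using a by (simp add: inv_mult) (simp only: m_ac m_closed inv_closed \<gamma>_closed G.inv_closed G.one_closed)
  then have "?b \<otimes>\<^bsub>M\<^esub> a = \<one>\<^bsub>M\<^esub>"
    using a by (simp add: M_def)
  moreover have "?b \<in> carrier M" using a by (simp add: M_def)
  ultimately show "\<exists>b\<in>carrier M. b \<otimes>\<^bsub>M\<^esub> a = \<one>\<^bsub>M\<^esub>" by blast
  fix b assume "b \<in> carrier M"
  then obtain v h where b: "b = (v, h)" "v \<in> carrier Q" "h \<in> carrier G" by (auto simp: M_def)
  show "a \<otimes>\<^bsub>M\<^esub> b \<in> carrier M" using a b by (simp add: M_def)
  fix c assume "c \<in> carrier M"
  then obtain w k where c: "c = (w, k)" "w \<in> carrier Q" "k \<in> carrier G" by (auto simp: M_def)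
  have "u \<otimes> v \<otimes> \<gamma> g h \<otimes> w \<otimes> \<gamma> (g \<otimes>\<^bsub>G\<^esub> h) k = u \<otimes> v \<otimes> w \<otimes> (\<gamma> g h \<otimes> \<gamma> (g \<otimes>\<^bsub>G\<^esub> h) k)"
    using a b c by (simp add: m_ac)
  also have "\<dots> = u \<otimes> v \<otimes> w \<otimes> (\<gamma> h k \<otimes> \<gamma> g (h \<otimes>\<^bsub>G\<^esub> k))"
    using a b c by (simp add: cocycle)
  also have "\<dots> = u \<otimes> (v \<otimes> w \<otimes> \<gamma> h k) \<otimes> \<gamma> g (h \<otimes>\<^bsub>G\<^esub> k)"
    using a b c by (simp add: m_ac)
  finally show "a \<otimes>\<^bsub>M\<^esub> b \<otimes>\<^bsub>M\<^esub> c = a \<otimes>\<^bsub>M\<^esub> (b \<otimes>\<^bsub>M\<^esub> c)"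
    using a b c by (simp add: M_def G.m_assoc)
qed

text \<open>The homomorphism \<open>\<pi>\<close> lifts to the extension \<open>M\<close> since the group is free, and \<open>\<mu>\<close> is the first component
  of the lift.\<close>

theorem free_group_splitting:
  assumes \<pi>: "\<pi> \<in> hom (free_group X) G"
  obtains \<mu> where "\<And>x. x \<in> carrier (free_group X) \<Longrightarrow> \<mu> x \<in> carrier Q"
    and "\<And>x y. x \<in> carrier (free_group X) \<Longrightarrow> y \<in> carrier (free_group X) \<Longrightarrow>
      \<mu> (x \<otimes>\<^bsub>free_group X\<^esub> y) = \<mu> x \<otimes> \<mu> y \<otimes> \<gamma> (\<pi> x) (\<pi> y)"
proof -
  let ?F = "free_group X"
  have "\<pi> (free_gen x) \<in> carrier G" if "x \<in> X" for x
    using hom_in_carrier[OF \<pi>] that by simp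
  then have "(\<lambda>x. (\<one>, \<pi> (free_gen x))) ` X \<subseteq> carrier M" by (auto simp: M_def)
  from free_group_extend[OF group_M this] obtain \<Lambda> where \<Lambda>: "\<Lambda> \<in> hom ?F M"
    and gen: "\<And>x. x \<in> X \<Longrightarrow> \<Lambda> (free_gen x) = (\<one>, \<pi> (free_gen x))" by blast
  have snd: "snd (\<Lambda> x) = \<pi> x" if "x \<in> carrier ?F" for x
  proof (rule free_group_hom_eqI[OF G.group_axioms _ \<pi> _ that])
    have "snd \<in> hom M G" by (auto simp: hom_def M_def)
    then show "(\<lambda>x. snd (\<Lambda> x)) \<in> hom ?F G"
      using Group.hom_compose[OF \<Lambda>] by (simp add: comp_def)
  qed (simp add: gen)
  show thesis
  proof (rule that[of "\<lambda>x. fst (\<Lambda> x)"])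
    fix x assume x: "x \<in> carrier ?F"
    then have x': "\<Lambda> x \<in> carrier M" using hom_in_carrier[OF \<Lambda>] by blast
    then show "fst (\<Lambda> x) \<in> carrier Q" by (auto simp: M_def)
    fix y assume y: "y \<in> carrier ?F"
    then have "\<Lambda> y \<in> carrier M" using hom_in_carrier[OF \<Lambda>] by blast
    then show "fst (\<Lambda> (x \<otimes>\<^bsub>?F\<^esub> y)) = fst (\<Lambda> x) \<otimes> fst (\<Lambda> y) \<otimes> \<gamma> (\<pi> x) (\<pi> y)"
      using hom_mult[OF \<Lambda> x y] snd[OF x] snd[OF y]
      by (cases "\<Lambda> x"; cases "\<Lambda> y") (simp add: M_def)
  qed
qed

end

section \<open>The Hopf formula with coefficients in \<open>\<int>\<^sub>q\<close>\<close>

lemma derived_power_killed: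
  assumes "group A" "comm_group B" "f \<in> hom A B"
    and exponent: "\<And>b. b \<in> carrier B \<Longrightarrow> b [^]\<^bsub>B\<^esub> q = \<one>\<^bsub>B\<^esub>"
    and x: "x \<in> derived_power_subgroup A q"
  shows "f x = \<one>\<^bsub>B\<^esub>"
proof -
  interpret B: comm_group B by fact
  interpret f: group_hom A B f
    using assms by (simp add: group_hom_def group_hom_axioms_def B.group_axioms)
  have "derived_power_subgroup A q \<subseteq> kernel A B f"
  proof (rule f.G.derived_power_least[OF f.subgroup_kernel])
    fix a assume a: "a \<in> carrier A"
    then show "a [^]\<^bsub>A\<^esub> q \<in> kernel A B f"
      by (simp add: kernel_def f.hom_nat_pow exponent)
    fix b assume b: "b \<in> carrier A"
    have "commutator B (f a) (f b) = inv\<^bsub>B\<^esub> f a \<otimes>\<^bsub>B\<^esub> inv\<^bsub>B\<^esub> f b \<otimes>\<^bsub>B\<^esub> (f b \<otimes>\<^bsub>B\<^esub> f a)"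
      using a b by (simp add: commutator_def B.m_assoc B.m_comm[of "f a" "f b"])
    also have "\<dots> = \<one>\<^bsub>B\<^esub>"
      using a b by (simp add: B.word_simps)
    finally show "commutator A a b \<in> kernel A B f"
      using a b by (simp add: kernel_def f.hom_commutator)
  qed
  then show ?thesis using x by (auto simp: kernel_def)
qed

lemma (in group) derived_power_normal: "derived_power_subgroup G q \<lhd> G"
  unfolding derived_power_subgroup_def
  by (intro set_mult_normal derived_self_is_normal power_subgroup_normal normal_self)

lemma (in group) derived_power_quotient:
  fixes q :: nat
  defines "D \<equiv> derived_power_subgroup G q"
  shows "comm_group (G Mod D)" and "v \<in> carrier (G Mod D) \<Longrightarrow> v [^]\<^bsub>G Mod D\<^esub> q = \<one>\<^bsub>G Mod D\<^esub>"
proof -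
  interpret D: normal D G unfolding D_def by (rule derived_power_normal)
  interpret V: group "G Mod D" by (rule D.factorgroup_is_group)
  interpret h: group_hom G "G Mod D" "\<lambda>x. D #> x"
    using D.r_coset_hom_Mod by unfold_locales
  have one: "D #> x = \<one>\<^bsub>G Mod D\<^esub>" if "x \<in> D" for x
    using coset_join2[OF _ D.subgroup_axioms that] D.subset that by auto
  show "comm_group (G Mod D)"
  proof (rule V.group_comm_groupI)
    fix v w assume "v \<in> carrier (G Mod D)" "w \<in> carrier (G Mod D)"
    then obtain x y where xy: "x \<in> carrier G" "v = D #> x" "y \<in> carrier G" "w = D #> y"
      by (auto simp: carrier_FactGroup)
    have "D #> (y \<otimes> x \<otimes> commutator G x y) = (D #> (y \<otimes> x)) \<otimes>\<^bsub>G Mod D\<^esub> \<one>\<^bsub>G Mod D\<^esub>"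
      using xy one[of "commutator G x y"] derived_power_contains(1)[of x y q]
      by (subst h.hom_mult) (simp_all del: h.hom_mult one_FactGroup add: D_def)
    also have "y \<otimes> x \<otimes> commutator G x y = x \<otimes> y"
      using xy by (simp add: commutator_def word_simps)
    also have "(D #> (y \<otimes> x)) \<otimes>\<^bsub>G Mod D\<^esub> \<one>\<^bsub>G Mod D\<^esub> = D #> (y \<otimes> x)"
      using xy by (intro V.r_one h.hom_closed) simp
    finally have "D #> (x \<otimes> y) = D #> (y \<otimes> x)" .
    then show "v \<otimes>\<^bsub>G Mod D\<^esub> w = w \<otimes>\<^bsub>G Mod D\<^esub> v"
      using xy h.hom_mult[of x y] h.hom_mult[of y x] by (simp only:)
  qed
  show "v [^]\<^bsub>G Mod D\<^esub> q = \<one>\<^bsub>G Mod D\<^esub>" if "v \<in> carrier (G Mod D)"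
  proof -
    obtain x where x: "x \<in> carrier G" "v = D #> x"
      using \<open>v \<in> carrier (G Mod D)\<close> by (auto simp: carrier_FactGroup)
    have "(D #> x) [^]\<^bsub>G Mod D\<^esub> q = D #> (x [^] q)"
      using h.hom_nat_pow[OF x(1)] by simp
    also have "\<dots> = \<one>\<^bsub>G Mod D\<^esub>"
      by (rule one) (use x derived_power_contains(2) in \<open>simp add: D_def\<close>)
    finally show ?thesis by (simp only: x(2))
  qed
qed

context free_presentation
begin

abbreviation "C1 \<equiv> q_chains q (bar1 G)"
abbreviation "C2 \<equiv> q_chains q (bar2 G)"
abbreviation "C3 \<equiv> q_chains q (bar3 G)"
abbreviation "d2 \<equiv> bar_d2 G (integer_mod_group q)"
abbreviation "d3 \<equiv> bar_d3 G (integer_mod_group q)"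

definition b1 where "b1 g = basis_chain q (bar1 G) g"
definition b2 where "b2 g h = basis_chain q (bar2 G) (g, h)"
definition B2 where "B2 = d3 ` carrier C3"
definition K where "K = kernel E G p"
definition KE where "KE = E\<lparr>carrier := K\<rparr>"
definition Q where "Q = C2 Mod B2"
definition cls where "cls c = B2 #>\<^bsub>C2\<^esub> c"
definition rep where "rep g = (SOME f. f \<in> carrier F \<and> \<pi> f = g)"

sublocale C1: comm_group C1 by (rule comm_group_chains)
sublocale C2: comm_group C2 by (rule comm_group_chains)
sublocale C3: comm_group C3 by (rule comm_group_chains)

sublocale d2: group_hom C2 C1 d2
  using G.bar_d2_hom by unfold_locales

sublocale d3: group_hom C3 C2 d3
  using G.bar_d3_hom by unfold_locales

lemma b1_closed [simp]: "b1 g \<in> carrier C1" and b2_closed [simp]: "b2 g h \<in> carrier C2"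
  by (simp_all add: b1_def b2_def basis_chain_closed)

lemma d2_b2:
  "g \<in> carrier G \<Longrightarrow> h \<in> carrier G \<Longrightarrow>
    d2 (b2 g h) = b1 h \<otimes>\<^bsub>C1\<^esub> inv\<^bsub>C1\<^esub> b1 (g \<otimes> h) \<otimes>\<^bsub>C1\<^esub> b1 g"
  unfolding b1_def b2_def by (rule G.bar_d2_basis)

lemma subgroup_B2: "subgroup B2 C2"
  unfolding B2_def by (rule d3.img_is_subgroup)

sublocale B2: normal B2 C2
  by (rule C2.subgroup_imp_normal[OF subgroup_B2])

sublocale Q: comm_group Q
  unfolding Q_def by (rule C2.abelian_FactGroup[OF subgroup_B2])

sublocale cls: group_hom C2 Q cls
proof unfold_locales
  show "cls \<in> hom C2 Q"
    unfolding cls_def[abs_def] Q_def by (rule B2.r_coset_hom_Mod)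
qed

lemma carrier_Q: "carrier Q = cls ` carrier C2"
  by (simp add: Q_def carrier_FactGroup cls_def[abs_def])

lemma cls_eq_one: "c \<in> carrier C2 \<Longrightarrow> cls c = \<one>\<^bsub>Q\<^esub> \<longleftrightarrow> c \<in> B2"
  using C2.coset_join1[OF _ _ subgroup_B2, of c] C2.coset_join2[OF _ subgroup_B2, of c]
  by (auto simp: cls_def Q_def)

lemma Q_exponent: "u \<in> carrier Q \<Longrightarrow> u [^]\<^bsub>Q\<^esub> q = \<one>\<^bsub>Q\<^esub>"
  by (auto simp: carrier_Q chains_exponent simp flip: cls.hom_nat_pow)

lemma subgroup_K: "subgroup K E"
  unfolding K_def by (rule p.subgroup_kernel)

lemma K_in_E [simp]: "k \<in> K \<Longrightarrow> k \<in> carrier E"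
  using subgroup.subset[OF subgroup_K] by auto

sublocale KE: comm_group KE
proof (rule group.group_comm_groupI)
  show "group KE" unfolding KE_def by (rule subgroup.subgroup_is_group[OF subgroup_K \<nu>.H.group_axioms])
  fix k k' assume "k \<in> carrier KE" "k' \<in> carrier KE"
  then show "k \<otimes>\<^bsub>KE\<^esub> k' = k' \<otimes>\<^bsub>KE\<^esub> k"
  proof -
    have "k \<in> kernel E G p" "k' \<in> carrier E"
      using \<open>k \<in> carrier KE\<close> \<open>k' \<in> carrier KE\<close> subgroup.subset[OF subgroup_K]
      by (auto simp: KE_def simp flip: K_def)
    then have "k \<otimes>\<^bsub>E\<^esub> k' = k' \<otimes>\<^bsub>E\<^esub> k" by (rule central)
    then show ?thesis unfolding KE_def by simp
  qed
qed

lemma KE_simps [simp]: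
  "carrier KE = K" "x \<otimes>\<^bsub>KE\<^esub> y = x \<otimes>\<^bsub>E\<^esub> y" "\<one>\<^bsub>KE\<^esub> = \<one>\<^bsub>E\<^esub>" "x [^]\<^bsub>KE\<^esub> (m::nat) = x [^]\<^bsub>E\<^esub> m"
  by (simp_all add: KE_def nat_pow_def)

lemma KE_exponent: "k \<in> K \<Longrightarrow> k [^]\<^bsub>KE\<^esub> q = \<one>\<^bsub>KE\<^esub>"
  using exponent by (simp add: K_def)

lemma K_central: "k \<in> K \<Longrightarrow> x \<in> carrier E \<Longrightarrow> k \<otimes>\<^bsub>E\<^esub> x = x \<otimes>\<^bsub>E\<^esub> k"
  using central by (simp add: K_def)

lemma K_eq: "K = \<nu> ` R"
  by (simp add: K_def kernel_p)

lemma rep [simp]: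
  assumes "g \<in> carrier G"
  shows "rep g \<in> carrier F" "\<pi> (rep g) = g"
proof -
  have "\<exists>f. f \<in> carrier F \<and> \<pi> f = g" using \<pi>_lift[OF assms] by metis
  from someI_ex[OF this] show "rep g \<in> carrier F" "\<pi> (rep g) = g"
    unfolding rep_def by simp_all
qed

lemma s_rep: "s g = \<nu> (rep g)"
  by (simp add: s_def rep_def)

text \<open>Words for the factor set of the extension \<open>E\<close> of \<open>G\<close>, relative to the section \<open>s\<close>.\<close>

definition factor :: "'g \<Rightarrow> 'g \<Rightarrow> nat word" where
  "factor g h = rep g \<otimes>\<^bsub>F\<^esub> rep h \<otimes>\<^bsub>F\<^esub> inv\<^bsub>F\<^esub> rep (g \<otimes> h)"

lemma factor_R [simp]: "g \<in> carrier G \<Longrightarrow> h \<in> carrier G \<Longrightarrow> factor g h \<in> R"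
  by (simp add: factor_def mem_R)

lemma R_in_F [simp]: "r \<in> R \<Longrightarrow> r \<in> carrier F"
  by (simp add: mem_R)

lemma \<nu>_factor_K [simp]: "g \<in> carrier G \<Longrightarrow> h \<in> carrier G \<Longrightarrow> \<nu> (factor g h) \<in> K"
  unfolding K_eq by simp

lemma \<nu>_factor:
  "g \<in> carrier G \<Longrightarrow> h \<in> carrier G \<Longrightarrow> s g \<otimes>\<^bsub>E\<^esub> s h = \<nu> (factor g h) \<otimes>\<^bsub>E\<^esub> s (g \<otimes> h)"
  by (simp add: s_rep factor_def \<pi>.G.m_assoc flip: \<nu>.hom_mult)

lemma factor_cocycle:
  assumes g: "g \<in> carrier G" and h: "h \<in> carrier G" and k: "k \<in> carrier G"
  shows "\<nu> (factor h k) \<otimes>\<^bsub>E\<^esub> \<nu> (factor g (h \<otimes> k)) = \<nu> (factor g h) \<otimes>\<^bsub>E\<^esub> \<nu> (factor (g \<otimes> h) k)"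
proof -
  have c: "\<nu> (factor a b) \<in> carrier E" if "a \<in> carrier G" "b \<in> carrier G" for a b
    using that by simp
  have "\<nu> (factor h k) \<otimes>\<^bsub>E\<^esub> \<nu> (factor g (h \<otimes> k)) \<otimes>\<^bsub>E\<^esub> s (g \<otimes> (h \<otimes> k))
      = \<nu> (factor h k) \<otimes>\<^bsub>E\<^esub> s g \<otimes>\<^bsub>E\<^esub> s (h \<otimes> k)"
    using g h k c \<nu>_factor[of g "h \<otimes> k"] by (simp add: \<nu>.H.m_assoc)
  also have "\<nu> (factor h k) \<otimes>\<^bsub>E\<^esub> s g = s g \<otimes>\<^bsub>E\<^esub> \<nu> (factor h k)"
    using g h k by (intro K_central) simp_all
  also have "s g \<otimes>\<^bsub>E\<^esub> \<nu> (factor h k) \<otimes>\<^bsub>E\<^esub> s (h \<otimes> k) = s g \<otimes>\<^bsub>E\<^esub> s h \<otimes>\<^bsub>E\<^esub> s k"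
    using g h k c by (simp add: \<nu>.H.m_assoc \<nu>_factor[OF h k])
  also have "\<dots> = \<nu> (factor g h) \<otimes>\<^bsub>E\<^esub> (s (g \<otimes> h) \<otimes>\<^bsub>E\<^esub> s k)"
    using g h k c by (simp add: \<nu>.H.m_assoc \<nu>_factor[OF g h])
  also have "\<dots> = \<nu> (factor g h) \<otimes>\<^bsub>E\<^esub> \<nu> (factor (g \<otimes> h) k) \<otimes>\<^bsub>E\<^esub> s (g \<otimes> (h \<otimes> k))"
    using g h k c by (simp add: \<nu>_factor[of "g \<otimes> h" k] \<nu>.H.m_assoc G.m_assoc)
  finally show ?thesis
    using g h k c by (simp del: \<nu>.hom_mult)
qed

definition \<Psi> :: "('g \<times> 'g \<Rightarrow> int) \<Rightarrow> nat word set" where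
  "\<Psi> = chain_extend KE (bar2 G) (\<lambda>(g, h). \<nu> (factor g h))"

lemma \<Psi>_hom: "\<Psi> \<in> hom C2 KE"
  unfolding \<Psi>_def by (rule KE.chain_extend_hom) (auto simp: KE_exponent[simplified])

sublocale \<Psi>: group_hom C2 KE \<Psi>
  using \<Psi>_hom by unfold_locales

lemma \<Psi>_b2: "g \<in> carrier G \<Longrightarrow> h \<in> carrier G \<Longrightarrow> \<Psi> (b2 g h) = \<nu> (factor g h)"
  unfolding \<Psi>_def b2_def
  by (subst KE.chain_extend_basis) (auto simp: KE_exponent[simplified])

lemma \<Psi>_B2:
  assumes "b \<in> B2"
  shows "\<Psi> b = \<one>\<^bsub>E\<^esub>"
proof -
  obtain c where c: "c \<in> carrier C3" "b = d3 c" using assms by (auto simp: B2_def)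
  have "\<Psi> (d3 c) = \<one>\<^bsub>KE\<^esub>"
    by (rule G.cocycle_kills_boundaries[OF KE.comm_group_axioms \<Psi>_hom _ c(1)])
      (simp add: \<Psi>_b2[unfolded b2_def] factor_cocycle)
  then show ?thesis using c by simp
qed

lemma d2_B2:
  assumes "b \<in> B2"
  shows "d2 b = \<one>\<^bsub>C1\<^esub>"
  using assms G.bar_d2_bar_d3 by (auto simp: B2_def)

text \<open>The tautological 2-cocycle of \<open>G\<close>, with values in chains modulo boundaries.\<close>

definition \<gamma> :: "'g \<Rightarrow> 'g \<Rightarrow> ('g \<times> 'g \<Rightarrow> int) set" where
  "\<gamma> g h = cls (b2 g h)"

sublocale \<gamma>: two_cocycle Q G \<gamma>
proof unfold_locales
  show "\<gamma> g h \<in> carrier Q" if "g \<in> carrier G" "h \<in> carrier G" for g h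
    by (simp add: \<gamma>_def)
  fix g h k assume c: "g \<in> carrier G" "h \<in> carrier G" "k \<in> carrier G"
  have "d3 (basis_chain q (bar3 G) (g, h, k)) \<in> B2"
    unfolding B2_def by (intro imageI basis_chain_closed)
  then have "cls (d3 (basis_chain q (bar3 G) (g, h, k))) = \<one>\<^bsub>Q\<^esub>"
    using cls_eq_one[OF subsetD[OF B2.subset]] by simp
  then have "\<gamma> h k \<otimes>\<^bsub>Q\<^esub> inv\<^bsub>Q\<^esub> \<gamma> (g \<otimes> h) k \<otimes>\<^bsub>Q\<^esub> \<gamma> g (h \<otimes> k) \<otimes>\<^bsub>Q\<^esub> inv\<^bsub>Q\<^esub> \<gamma> g h = \<one>\<^bsub>Q\<^esub>"
    using c by (simp add: G.bar_d3_basis \<gamma>_def flip: b2_def)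
  moreover have "\<gamma> h k \<otimes>\<^bsub>Q\<^esub> inv\<^bsub>Q\<^esub> \<gamma> (g \<otimes> h) k \<otimes>\<^bsub>Q\<^esub> \<gamma> g (h \<otimes> k) \<otimes>\<^bsub>Q\<^esub> inv\<^bsub>Q\<^esub> \<gamma> g h
      = (\<gamma> h k \<otimes>\<^bsub>Q\<^esub> \<gamma> g (h \<otimes> k)) \<otimes>\<^bsub>Q\<^esub> inv\<^bsub>Q\<^esub> (\<gamma> g h \<otimes>\<^bsub>Q\<^esub> \<gamma> (g \<otimes> h) k)"
    unfolding \<gamma>_def by (simp add: Q.inv_mult) (simp add: Q.m_ac)
  ultimately show "\<gamma> h k \<otimes>\<^bsub>Q\<^esub> \<gamma> g (h \<otimes> k) = \<gamma> g h \<otimes>\<^bsub>Q\<^esub> \<gamma> (g \<otimes> h) k"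
    unfolding \<gamma>_def by (simp add: Q.inv_solve_right')
qed


lemma K_I: "x \<in> carrier E \<Longrightarrow> p x = \<one> \<Longrightarrow> x \<in> K"
  by (simp add: K_def kernel_def del: K_in_E)

lemma p_K: "k \<in> K \<Longrightarrow> p k = \<one>"
  by (simp add: K_def kernel_def del: K_in_E)

lemma \<mu>_exists: "\<exists>\<mu>. (\<forall>x\<in>carrier F. \<mu> x \<in> carrier Q) \<and>
    (\<forall>x\<in>carrier F. \<forall>y\<in>carrier F. \<mu> (x \<otimes>\<^bsub>F\<^esub> y) = \<mu> x \<otimes>\<^bsub>Q\<^esub> \<mu> y \<otimes>\<^bsub>Q\<^esub> \<gamma> (\<pi> x) (\<pi> y))"
proof -
  obtain \<mu> where "\<And>x. x \<in> carrier F \<Longrightarrow> \<mu> x \<in> carrier Q"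
    "\<And>x y. x \<in> carrier F \<Longrightarrow> y \<in> carrier F \<Longrightarrow> \<mu> (x \<otimes>\<^bsub>F\<^esub> y) = \<mu> x \<otimes>\<^bsub>Q\<^esub> \<mu> y \<otimes>\<^bsub>Q\<^esub> \<gamma> (\<pi> x) (\<pi> y)"
    using \<gamma>.free_group_splitting[OF \<pi>_hom[unfolded F_def]] unfolding F_def by blast
  then show ?thesis by blast
qed

definition \<mu> :: "nat word \<Rightarrow> ('g \<times> 'g \<Rightarrow> int) set" where
  "\<mu> = (SOME \<mu>. (\<forall>x\<in>carrier F. \<mu> x \<in> carrier Q) \<and>
    (\<forall>x\<in>carrier F. \<forall>y\<in>carrier F. \<mu> (x \<otimes>\<^bsub>F\<^esub> y) = \<mu> x \<otimes>\<^bsub>Q\<^esub> \<mu> y \<otimes>\<^bsub>Q\<^esub> \<gamma> (\<pi> x) (\<pi> y)))"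

lemma \<mu>_closed [simp]: "x \<in> carrier F \<Longrightarrow> \<mu> x \<in> carrier Q"
  and \<mu>_mult: "x \<in> carrier F \<Longrightarrow> y \<in> carrier F \<Longrightarrow>
    \<mu> (x \<otimes>\<^bsub>F\<^esub> y) = \<mu> x \<otimes>\<^bsub>Q\<^esub> \<mu> y \<otimes>\<^bsub>Q\<^esub> \<gamma> (\<pi> x) (\<pi> y)"
  using someI_ex[OF \<mu>_exists] unfolding \<mu>_def by blast+

text \<open>Since \<open>\<gamma>\<close> is not normalised, \<open>\<mu>\<close> has to be corrected by a constant to become a homomorphism on \<open>R\<close>.\<close>

definition \<kappa> :: "nat word \<Rightarrow> ('g \<times> 'g \<Rightarrow> int) set" where
  "\<kappa> r = \<mu> r \<otimes>\<^bsub>Q\<^esub> \<gamma> \<one> \<one>"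

lemma \<kappa>_closed [simp]: "r \<in> carrier F \<Longrightarrow> \<kappa> r \<in> carrier Q"
  by (simp add: \<kappa>_def)

lemma \<mu>_mult_R:
  assumes r: "r \<in> R" and x: "x \<in> carrier F"
  shows "\<mu> (r \<otimes>\<^bsub>F\<^esub> x) = \<kappa> r \<otimes>\<^bsub>Q\<^esub> \<mu> x" "\<mu> (x \<otimes>\<^bsub>F\<^esub> r) = \<kappa> r \<otimes>\<^bsub>Q\<^esub> \<mu> x"
proof -
  have \<pi>r: "\<pi> r = \<one>" using r by (simp add: mem_R)
  have "\<gamma> \<one> (\<pi> x) = \<gamma> \<one> \<one>" "\<gamma> (\<pi> x) \<one> = \<gamma> \<one> \<one>"
    using \<gamma>.\<gamma>_one_left[of "\<pi> x"] \<gamma>.\<gamma>_one_right[of "\<pi> x"] x by simp_all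
  then have "\<mu> (r \<otimes>\<^bsub>F\<^esub> x) = \<mu> r \<otimes>\<^bsub>Q\<^esub> \<mu> x \<otimes>\<^bsub>Q\<^esub> \<gamma> \<one> \<one>" "\<mu> (x \<otimes>\<^bsub>F\<^esub> r) = \<mu> x \<otimes>\<^bsub>Q\<^esub> \<mu> r \<otimes>\<^bsub>Q\<^esub> \<gamma> \<one> \<one>"
    using r x by (simp_all add: \<mu>_mult \<pi>r)
  then show "\<mu> (r \<otimes>\<^bsub>F\<^esub> x) = \<kappa> r \<otimes>\<^bsub>Q\<^esub> \<mu> x" "\<mu> (x \<otimes>\<^bsub>F\<^esub> r) = \<kappa> r \<otimes>\<^bsub>Q\<^esub> \<mu> x"
    using r x by (simp_all add: \<kappa>_def Q.m_ac)
qed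

lemma R_closed:
  "\<one>\<^bsub>F\<^esub> \<in> R" "r \<in> R \<Longrightarrow> inv\<^bsub>F\<^esub> r \<in> R" "r \<in> R \<Longrightarrow> r' \<in> R \<Longrightarrow> r \<otimes>\<^bsub>F\<^esub> r' \<in> R"
  by (auto simp: mem_R)

lemma \<kappa>_mult: "r \<in> R \<Longrightarrow> r' \<in> R \<Longrightarrow> \<kappa> (r \<otimes>\<^bsub>F\<^esub> r') = \<kappa> r \<otimes>\<^bsub>Q\<^esub> \<kappa> r'"
  using \<mu>_mult_R(1)[of r r'] by (simp add: \<kappa>_def[of "r \<otimes>\<^bsub>F\<^esub> r'"] \<kappa>_def[of r'] Q.m_assoc)

lemma \<kappa>_one: "\<kappa> \<one>\<^bsub>F\<^esub> = \<one>\<^bsub>Q\<^esub>"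
  using \<kappa>_mult[of "\<one>\<^bsub>F\<^esub>" "\<one>\<^bsub>F\<^esub>"] R_closed(1) by simp

lemma \<kappa>_inv: "r \<in> R \<Longrightarrow> \<kappa> (inv\<^bsub>F\<^esub> r) = inv\<^bsub>Q\<^esub> \<kappa> r"
  using \<kappa>_mult[of "inv\<^bsub>F\<^esub> r" r] R_closed(2)[of r] \<kappa>_one
  by (intro Q.inv_equality[symmetric]) simp_all

lemma \<kappa>_pow: "r \<in> R \<Longrightarrow> r [^]\<^bsub>F\<^esub> (m::nat) \<in> R \<and> \<kappa> (r [^]\<^bsub>F\<^esub> m) = \<kappa> r [^]\<^bsub>Q\<^esub> m"
  by (induction m) (simp_all add: R_closed \<kappa>_one \<kappa>_mult)

text \<open>Values in \<open>Q\<close> have exponent \<open>q\<close>, which settles the \<open>q\<close>-th powers. For commutators, comparing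
  \<open>\<mu> (r \<otimes> f)\<close> with \<open>\<mu> (f \<otimes> conj_by F r f)\<close> shows that \<open>\<kappa>\<close> is invariant under conjugation.\<close>

lemma \<kappa>_N:
  assumes "x \<in> N"
  shows "\<kappa> x = \<one>\<^bsub>Q\<^esub>"
proof -
  let ?H = "{r \<in> R. \<kappa> r = \<one>\<^bsub>Q\<^esub>}"
  have "subgroup ?H F"
    by unfold_locales (auto simp: R_closed \<kappa>_one \<kappa>_mult \<kappa>_inv)
  moreover have "r [^]\<^bsub>F\<^esub> q \<in> ?H" if "r \<in> R" for r
    using \<kappa>_pow[OF that, of q] that by (simp add: Q_exponent)
  moreover have "commutator F f r \<in> ?H" if f: "f \<in> carrier F" and r: "r \<in> R" for f r
  proof -
    let ?c = "conj_by F r f"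
    have c: "?c \<in> R" using f r by (simp add: mem_R \<pi>.hom_conj_by)
    have "f \<otimes>\<^bsub>F\<^esub> ?c = r \<otimes>\<^bsub>F\<^esub> f"
      using f r by (simp add: conj_by_def \<pi>.G.word_simps)
    then have "\<kappa> ?c \<otimes>\<^bsub>Q\<^esub> \<mu> f = \<kappa> r \<otimes>\<^bsub>Q\<^esub> \<mu> f"
      using \<mu>_mult_R(1)[OF r f] \<mu>_mult_R(2)[OF c f] by simp
    then have "\<kappa> ?c = \<kappa> r"
      using f r c by simp
    moreover have "commutator F f r = inv\<^bsub>F\<^esub> ?c \<otimes>\<^bsub>F\<^esub> r"
      using f r by (simp add: commutator_def conj_by_def \<pi>.G.word_simps)
    ultimately show ?thesis
      using r c by (simp add: \<kappa>_mult \<kappa>_inv R_closed)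
  qed
  ultimately have "N \<subseteq> ?H" using \<pi>.G.Eq_kernel_least[of ?H R q] by blast
  then show ?thesis using assms by auto
qed

text \<open>The homomorphism that \<open>\<kappa>\<close> induces on \<open>K\<close>, the image of \<open>R\<close> in \<open>E\<close>.\<close>

definition \<kappa>_bar :: "nat word set \<Rightarrow> ('g \<times> 'g \<Rightarrow> int) set" where
  "\<kappa>_bar k = \<kappa> (SOME r. r \<in> R \<and> \<nu> r = k)"

lemma \<kappa>_bar_\<nu>:
  assumes r: "r \<in> R"
  shows "\<kappa>_bar (\<nu> r) = \<kappa> r"
proof -
  define t where "t = (SOME t. t \<in> R \<and> \<nu> t = \<nu> r)"
  have "\<exists>t. t \<in> R \<and> \<nu> t = \<nu> r" using r by blast
  from someI_ex[OF this] have t: "t \<in> R" "\<nu> t = \<nu> r" by (simp_all add: t_def)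
  have "\<nu> (t \<otimes>\<^bsub>F\<^esub> inv\<^bsub>F\<^esub> r) = \<one>\<^bsub>E\<^esub>" using t r by simp
  then have "t \<otimes>\<^bsub>F\<^esub> inv\<^bsub>F\<^esub> r \<in> N"
    using \<nu>_eq_one[of "t \<otimes>\<^bsub>F\<^esub> inv\<^bsub>F\<^esub> r"] t r by simp
  then have "\<kappa> t \<otimes>\<^bsub>Q\<^esub> inv\<^bsub>Q\<^esub> \<kappa> r = \<one>\<^bsub>Q\<^esub>"
    using \<kappa>_N t r \<kappa>_mult[of t "inv\<^bsub>F\<^esub> r"] by (simp add: \<kappa>_inv R_closed)
  then show ?thesis
    using t r by (simp add: \<kappa>_bar_def Q.inv_solve_right' flip: t_def)
qed

lemma \<kappa>_bar_hom: "\<kappa>_bar \<in> hom KE Q"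
proof (rule homI)
  fix k k' assume "k \<in> carrier KE" "k' \<in> carrier KE"
  then obtain r r' where r: "r \<in> R" "k = \<nu> r" "r' \<in> R" "k' = \<nu> r'" by (auto simp: K_eq)
  then show "\<kappa>_bar k \<in> carrier Q" by (simp add: \<kappa>_bar_\<nu>)
  have "k \<otimes>\<^bsub>KE\<^esub> k' = \<nu> (r \<otimes>\<^bsub>F\<^esub> r')" using r by simp
  then show "\<kappa>_bar (k \<otimes>\<^bsub>KE\<^esub> k') = \<kappa>_bar k \<otimes>\<^bsub>Q\<^esub> \<kappa>_bar k'"
    using r by (simp only: \<kappa>_bar_\<nu> R_closed \<kappa>_mult)
qed

text \<open>Both sides arise from \<open>\<mu>\<close> of \<open>rep g \<otimes> rep h = factor g h \<otimes> rep (g \<otimes> h)\<close>.\<close>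

lemma \<kappa>_factor:
  assumes g: "g \<in> carrier G" and h: "h \<in> carrier G"
  shows "\<kappa> (factor g h) = \<gamma> g h \<otimes>\<^bsub>Q\<^esub> (\<mu> (rep h) \<otimes>\<^bsub>Q\<^esub> inv\<^bsub>Q\<^esub> \<mu> (rep (g \<otimes> h)) \<otimes>\<^bsub>Q\<^esub> \<mu> (rep g))"
proof -
  have c: "factor g h \<in> R" "rep (g \<otimes> h) \<in> carrier F" "rep g \<in> carrier F" "rep h \<in> carrier F" using g h by simp_all
  have "factor g h \<otimes>\<^bsub>F\<^esub> rep (g \<otimes> h) = rep g \<otimes>\<^bsub>F\<^esub> rep h"
    using c by (simp add: factor_def \<pi>.G.m_assoc)
  then have "\<kappa> (factor g h) \<otimes>\<^bsub>Q\<^esub> \<mu> (rep (g \<otimes> h)) = \<mu> (rep g) \<otimes>\<^bsub>Q\<^esub> \<mu> (rep h) \<otimes>\<^bsub>Q\<^esub> \<gamma> g h"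
    using \<mu>_mult_R(1)[OF c(1,2)] \<mu>_mult[OF c(3,4)] g h by simp
  then have "\<kappa> (factor g h) = \<mu> (rep g) \<otimes>\<^bsub>Q\<^esub> \<mu> (rep h) \<otimes>\<^bsub>Q\<^esub> \<gamma> g h \<otimes>\<^bsub>Q\<^esub> inv\<^bsub>Q\<^esub> \<mu> (rep (g \<otimes> h))"
    using c g h by (subst Q.inv_solve_right) simp_all
  then show ?thesis
    using c g h by (simp add: Q.m_ac)
qed

text \<open>By \<open>\<kappa>_factor\<close>, \<open>\<kappa>_bar\<close> inverts \<open>\<Psi>\<close> up to a term that depends on \<open>d2 c\<close> only and so vanishes on cycles.\<close>

lemma \<kappa>_bar_\<Psi>:
  assumes c: "c \<in> carrier C2"
  shows "\<kappa>_bar (\<Psi> c) = cls c \<otimes>\<^bsub>Q\<^esub> chain_extend Q (bar1 G) (\<lambda>g. \<mu> (rep g)) (d2 c)"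
proof -
  let ?\<eta> = "chain_extend Q (bar1 G) (\<lambda>g. \<mu> (rep g))"
  have \<eta>: "?\<eta> \<in> hom C1 Q"
    by (rule Q.chain_extend_hom) (simp_all add: Q_exponent)
  have \<eta>_b1: "?\<eta> (b1 g) = \<mu> (rep g)" if "g \<in> carrier G" for g
    unfolding b1_def using that by (intro Q.chain_extend_basis) (simp_all add: Q_exponent)
  interpret \<eta>: group_hom C1 Q ?\<eta> using \<eta> by unfold_locales
  show ?thesis
  proof (rule chains_hom_eqI[OF Q.group_axioms _ _ _ c])
    show "(\<lambda>c. \<kappa>_bar (\<Psi> c)) \<in> hom C2 Q"
      using Group.hom_compose[OF \<Psi>_hom \<kappa>_bar_hom] by (simp add: comp_def)
    have "(\<lambda>c. ?\<eta> (d2 c)) \<in> hom C2 Q"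
      using Group.hom_compose[OF G.bar_d2_hom \<eta>] by (simp add: comp_def)
    then show "(\<lambda>c. cls c \<otimes>\<^bsub>Q\<^esub> ?\<eta> (d2 c)) \<in> hom C2 Q"
      using cls.homh by (intro Q.hom_mult_hom) simp_all
    fix t assume "t \<in> bar2 G"
    then obtain g h where t: "t = (g, h)" "g \<in> carrier G" "h \<in> carrier G" by auto
    have "\<kappa>_bar (\<Psi> (b2 g h)) = cls (b2 g h) \<otimes>\<^bsub>Q\<^esub> ?\<eta> (d2 (b2 g h))"
      using t by (simp add: \<Psi>_b2 \<kappa>_bar_\<nu> \<kappa>_factor d2_b2 \<eta>_b1 \<gamma>_def)
    then show "\<kappa>_bar (\<Psi> (basis_chain q (bar2 G) t)) = cls (basis_chain q (bar2 G) t) \<otimes>\<^bsub>Q\<^esub> ?\<eta> (d2 (basis_chain q (bar2 G) t))"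
      by (simp add: b2_def t)
  qed
qed

lemma \<Psi>_injective:
  assumes z: "z \<in> carrier C2" "d2 z = \<one>\<^bsub>C1\<^esub>" "\<Psi> z = \<one>\<^bsub>E\<^esub>"
  shows "z \<in> B2"
proof -
  interpret \<kappa>_bar: group_hom KE Q \<kappa>_bar using \<kappa>_bar_hom by unfold_locales
  have "chain_extend Q (bar1 G) (\<lambda>g. \<mu> (rep g)) \<in> hom C1 Q"
    by (rule Q.chain_extend_hom) (simp_all add: Q_exponent)
  then have "chain_extend Q (bar1 G) (\<lambda>g. \<mu> (rep g)) \<one>\<^bsub>C1\<^esub> = \<one>\<^bsub>Q\<^esub>"
    using C1.group_axioms Q.group_axioms by (rule hom_one)
  moreover have "\<kappa>_bar \<one>\<^bsub>E\<^esub> = \<one>\<^bsub>Q\<^esub>" using \<kappa>_bar.hom_one by simp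
  ultimately have "cls z = \<one>\<^bsub>Q\<^esub>"
    using \<kappa>_bar_\<Psi>[OF z(1)] z by simp
  then show ?thesis using cls_eq_one[OF z(1)] by simp
qed

abbreviation "D \<equiv> derived_power_subgroup E q"

text \<open>In \<open>E\<close> modulo \<open>D\<close>, which is abelian of exponent \<open>q\<close>, the factor set becomes the coboundary of the
  section, so \<open>\<Psi>\<close> factors through \<open>d2\<close> there.\<close>

lemma \<Psi>_cycle_in_D:
  assumes z: "z \<in> carrier C2" "d2 z = \<one>\<^bsub>C1\<^esub>"
  shows "\<Psi> z \<in> D"
proof -
  interpret D: normal D E by (rule \<nu>.H.derived_power_normal)
  interpret V: comm_group "E Mod D" by (rule \<nu>.H.derived_power_quotient)
  define \<theta> where "\<theta> x = D #>\<^bsub>E\<^esub> x" for x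
  interpret \<theta>: group_hom E "E Mod D" \<theta>
    using D.r_coset_hom_Mod unfolding \<theta>_def[abs_def] by unfold_locales
  let ?\<sigma> = "chain_extend (E Mod D) (bar1 G) (\<lambda>g. \<theta> (s g))"
  have \<theta>q: "\<theta> x [^]\<^bsub>E Mod D\<^esub> q = \<one>\<^bsub>E Mod D\<^esub>" if "x \<in> carrier E" for x
    using that by (intro \<nu>.H.derived_power_quotient(2)) simp
  have \<sigma>: "?\<sigma> \<in> hom C1 (E Mod D)"
    by (rule V.chain_extend_hom) (simp_all add: \<theta>q)
  interpret \<sigma>: group_hom C1 "E Mod D" ?\<sigma> using \<sigma> by unfold_locales
  have \<sigma>_b1: "?\<sigma> (b1 g) = \<theta> (s g)" if "g \<in> carrier G" for g
    unfolding b1_def using that by (intro V.chain_extend_basis) (simp_all add: \<theta>q)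
  have "\<theta> (\<Psi> z) = ?\<sigma> (d2 z)"
  proof (rule chains_hom_eqI[OF V.group_axioms _ _ _ z(1)])
    have "\<Psi> \<in> hom C2 E"
      using \<Psi>_hom by (auto simp: hom_def Pi_iff)
    then show "(\<lambda>c. \<theta> (\<Psi> c)) \<in> hom C2 (E Mod D)"
      using Group.hom_compose[OF _ \<theta>.homh] by (auto simp: comp_def)
    show "(\<lambda>c. ?\<sigma> (d2 c)) \<in> hom C2 (E Mod D)"
      using Group.hom_compose[OF G.bar_d2_hom \<sigma>] by (simp add: comp_def)
    fix t assume "t \<in> bar2 G"
    then obtain g h where t: "t = (g, h)" "g \<in> carrier G" "h \<in> carrier G" by auto
    have tc: "\<theta> (s g) \<in> carrier (E Mod D)" "\<theta> (s h) \<in> carrier (E Mod D)" "\<theta> (s (g \<otimes> h)) \<in> carrier (E Mod D)"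
      using t by (simp_all del: mult_FactGroup)
    have fc: "\<theta> (\<nu> (factor g h)) \<in> carrier (E Mod D)" using t by (intro \<theta>.hom_closed) simp
    have "\<theta> (s g \<otimes>\<^bsub>E\<^esub> s h) = \<theta> (\<nu> (factor g h) \<otimes>\<^bsub>E\<^esub> s (g \<otimes> h))"
      using t by (simp only: \<nu>_factor)
    then have "\<theta> (\<nu> (factor g h)) \<otimes>\<^bsub>E Mod D\<^esub> \<theta> (s (g \<otimes> h)) = \<theta> (s g) \<otimes>\<^bsub>E Mod D\<^esub> \<theta> (s h)"
      using t \<theta>.hom_mult[of "s g" "s h"] \<theta>.hom_mult[of "\<nu> (factor g h)" "s (g \<otimes> h)"] by (simp del: mult_FactGroup \<theta>.hom_mult)
    then have "\<theta> (\<nu> (factor g h)) = \<theta> (s g) \<otimes>\<^bsub>E Mod D\<^esub> \<theta> (s h) \<otimes>\<^bsub>E Mod D\<^esub> inv\<^bsub>E Mod D\<^esub> \<theta> (s (g \<otimes> h))"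
      using tc fc V.inv_solve_right[of "\<theta> (\<nu> (factor g h))" "\<theta> (s g) \<otimes>\<^bsub>E Mod D\<^esub> \<theta> (s h)" "\<theta> (s (g \<otimes> h))"]
        V.m_closed[OF tc(1,2)] by (simp only:)
    also have "\<dots> = \<theta> (s h) \<otimes>\<^bsub>E Mod D\<^esub> inv\<^bsub>E Mod D\<^esub> \<theta> (s (g \<otimes> h)) \<otimes>\<^bsub>E Mod D\<^esub> \<theta> (s g)"
      using tc by (simp only: V.m_ac V.m_closed V.inv_closed)
    also have "\<dots> = ?\<sigma> (d2 (b2 g h))"
      using t by (simp add: d2_b2 \<sigma>_b1 del: mult_FactGroup)
    finally show "\<theta> (\<Psi> (basis_chain q (bar2 G) t)) = ?\<sigma> (d2 (basis_chain q (bar2 G) t))"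
      using t by (simp add: \<Psi>_b2 flip: b2_def)
  qed
  also have "\<dots> = D"
    using z(2) \<sigma>.hom_one by simp
  finally have "D #>\<^bsub>E\<^esub> \<Psi> z = D" by (simp add: \<theta>_def)
  moreover have "\<Psi> z \<in> carrier E" using \<Psi>.hom_closed[OF z(1)] by simp
  ultimately show ?thesis
    by (intro \<nu>.H.coset_join1[OF _ _ D.subgroup_axioms])
qed

lemma D_lift:
  assumes "k \<in> D"
  obtains x where "x \<in> derived_power_subgroup F q" "k = \<nu> x"
proof -
  have "subgroup (\<nu> ` derived_power_subgroup F q) E"
    by (rule \<nu>.subgroup_img_is_subgroup[OF \<pi>.G.derived_power_subgroup_is_subgroup])
  moreover have "a [^]\<^bsub>E\<^esub> q \<in> \<nu> ` derived_power_subgroup F q" if "a \<in> carrier E" for a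
  proof -
    obtain f where f: "f \<in> carrier F" "a = \<nu> f" using \<open>a \<in> carrier E\<close> by (auto simp: carrier_E)
    then have "a [^]\<^bsub>E\<^esub> q = \<nu> (f [^]\<^bsub>F\<^esub> q)" by (simp add: \<nu>.hom_nat_pow)
    then show ?thesis using \<pi>.G.derived_power_contains(2)[OF f(1), of q] by simp
  qed
  moreover have "commutator E a b \<in> \<nu> ` derived_power_subgroup F q" if "a \<in> carrier E" "b \<in> carrier E" for a b
  proof -
    obtain f h where f: "f \<in> carrier F" "a = \<nu> f" "h \<in> carrier F" "b = \<nu> h"
      using \<open>a \<in> carrier E\<close> \<open>b \<in> carrier E\<close> by (auto simp: carrier_E)
    then have "commutator E a b = \<nu> (commutator F f h)" by (simp add: \<nu>.hom_commutator)
    then show ?thesis using \<pi>.G.derived_power_contains(1)[OF f(1,3), of q] by simp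
  qed
  ultimately have "D \<subseteq> \<nu> ` derived_power_subgroup F q"
    by (intro \<nu>.H.derived_power_least)
  then show thesis using assms that by blast
qed

text \<open>Let \<open>\<Psi>'\<close> and \<open>\<delta>\<close> be the maps that \<open>\<Psi>\<close> and \<open>d2\<close> induce on chains modulo boundaries. The maps
  \<open>x \<mapsto> \<Psi>' (\<mu> x) \<otimes> s (\<pi> x) \<otimes> inv (\<nu> x)\<close> and \<open>x \<mapsto> \<delta> (\<mu> x) \<otimes> b1 (\<pi> x)\<close> are homomorphisms from \<open>F\<close> to abelian
  groups of exponent \<open>q\<close>, hence trivial on \<open>F'F\<^sup>q\<close>. Evaluated at a preimage \<open>x\<close> of \<open>k\<close> in \<open>F'F\<^sup>q\<close>, they
  say that a chain representing \<open>\<kappa> x\<close> is mapped to \<open>k\<close> and is a cycle.\<close>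

lemma \<Psi>_surjective:
  assumes k: "k \<in> D" "k \<in> K"
  obtains z where "z \<in> carrier C2" "d2 z = \<one>\<^bsub>C1\<^esub>" "\<Psi> z = k"
proof -
  have "B2 \<subseteq> kernel C2 KE \<Psi>" using \<Psi>_B2 B2.subset by (auto simp: kernel_def)
  from \<Psi>.FactGroup_universal_kernel[OF B2.normal_axioms this] obtain \<Psi>'
    where \<Psi>': "\<Psi>' \<in> hom Q KE" "\<And>c. c \<in> carrier C2 \<Longrightarrow> \<Psi>' (cls c) = \<Psi> c"
    unfolding Q_def cls_def by blast
  interpret \<Psi>': group_hom Q KE \<Psi>' using \<Psi>'(1) by unfold_locales
  have "B2 \<subseteq> kernel C2 C1 d2" using d2_B2 B2.subset by (auto simp: kernel_def)
  from d2.FactGroup_universal_kernel[OF B2.normal_axioms this] obtain \<delta>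
    where \<delta>: "\<delta> \<in> hom Q C1" "\<And>c. c \<in> carrier C2 \<Longrightarrow> \<delta> (cls c) = d2 c"
    unfolding Q_def cls_def by blast
  interpret \<delta>: group_hom Q C1 \<delta> using \<delta>(1) by unfold_locales
  have \<Psi>'_\<gamma>: "\<Psi>' (\<gamma> g h) = \<nu> (factor g h)" if "g \<in> carrier G" "h \<in> carrier G" for g h
    using that by (simp add: \<gamma>_def \<Psi>' \<Psi>_b2)
  have \<delta>_\<gamma>: "\<delta> (\<gamma> g h) = b1 h \<otimes>\<^bsub>C1\<^esub> inv\<^bsub>C1\<^esub> b1 (g \<otimes> h) \<otimes>\<^bsub>C1\<^esub> b1 g" if "g \<in> carrier G" "h \<in> carrier G" for g h
    using that by (simp add: \<gamma>_def \<delta> d2_b2)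
  have \<Psi>'_E: "\<Psi>' u \<in> carrier E" "\<Psi>' u \<in> K" if "u \<in> carrier Q" for u
    using \<Psi>'.hom_closed[OF that] by simp_all
  define \<chi> where "\<chi> x = \<Psi>' (\<mu> x) \<otimes>\<^bsub>E\<^esub> s (\<pi> x) \<otimes>\<^bsub>E\<^esub> inv\<^bsub>E\<^esub> \<nu> x" for x
  have \<chi>_K: "\<chi> x \<in> K" if x: "x \<in> carrier F" for x
  proof -
    have "\<Psi>' (\<mu> x) \<in> K" using \<Psi>'_E(2) x by simp
    moreover have "s (\<pi> x) \<otimes>\<^bsub>E\<^esub> inv\<^bsub>E\<^esub> \<nu> x \<in> K"
      using x by (intro K_I) (simp_all add: p_\<nu>)
    ultimately show ?thesis
      using subgroup.m_closed[OF subgroup_K] x by (simp add: \<chi>_def \<nu>.H.m_assoc)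
  qed
  have \<chi>_hom: "\<chi> \<in> hom F KE"
  proof (rule homI)
    show "\<chi> x \<in> carrier KE" if "x \<in> carrier F" for x using \<chi>_K[OF that] by simp
    fix x y assume x: "x \<in> carrier F" and y: "y \<in> carrier F"
    have m: "\<Psi>' (\<mu> x) \<in> carrier E" "\<Psi>' (\<mu> y) \<in> carrier E" "\<Psi>' (\<mu> y) \<in> K" using \<Psi>'_E x y by simp_all
    have sc: "s (\<pi> x) \<in> carrier E" "s (\<pi> y) \<in> carrier E" "s (\<pi> x \<otimes> \<pi> y) \<in> carrier E" "\<nu> x \<in> carrier E" "\<nu> y \<in> carrier E"
      using x y by simp_all
    have fc: "\<nu> (factor (\<pi> x) (\<pi> y)) \<in> carrier E" using x y by simp
    have "\<Psi>' (\<mu> (x \<otimes>\<^bsub>F\<^esub> y)) = \<Psi>' (\<mu> x) \<otimes>\<^bsub>E\<^esub> \<Psi>' (\<mu> y) \<otimes>\<^bsub>E\<^esub> \<nu> (factor (\<pi> x) (\<pi> y))"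
      using x y by (simp add: \<mu>_mult \<Psi>'_\<gamma>)
    then have "\<chi> (x \<otimes>\<^bsub>F\<^esub> y) = \<Psi>' (\<mu> x) \<otimes>\<^bsub>E\<^esub> \<Psi>' (\<mu> y) \<otimes>\<^bsub>E\<^esub> (\<nu> (factor (\<pi> x) (\<pi> y)) \<otimes>\<^bsub>E\<^esub> s (\<pi> x \<otimes> \<pi> y))
        \<otimes>\<^bsub>E\<^esub> inv\<^bsub>E\<^esub> (\<nu> x \<otimes>\<^bsub>E\<^esub> \<nu> y)"
      using x y m sc fc by (simp add: \<chi>_def \<nu>.H.m_assoc)
    also have "\<dots> = \<Psi>' (\<mu> x) \<otimes>\<^bsub>E\<^esub> (\<Psi>' (\<mu> y) \<otimes>\<^bsub>E\<^esub> s (\<pi> x)) \<otimes>\<^bsub>E\<^esub> s (\<pi> y) \<otimes>\<^bsub>E\<^esub> (inv\<^bsub>E\<^esub> \<nu> y \<otimes>\<^bsub>E\<^esub> inv\<^bsub>E\<^esub> \<nu> x)"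
      using x y m sc by (simp add: \<nu>.H.m_assoc \<nu>.H.inv_mult_group flip: \<nu>_factor)
    also have "\<Psi>' (\<mu> y) \<otimes>\<^bsub>E\<^esub> s (\<pi> x) = s (\<pi> x) \<otimes>\<^bsub>E\<^esub> \<Psi>' (\<mu> y)"
      by (rule K_central[OF m(3) sc(1)])
    also have "\<Psi>' (\<mu> x) \<otimes>\<^bsub>E\<^esub> (s (\<pi> x) \<otimes>\<^bsub>E\<^esub> \<Psi>' (\<mu> y)) \<otimes>\<^bsub>E\<^esub> s (\<pi> y) \<otimes>\<^bsub>E\<^esub> (inv\<^bsub>E\<^esub> \<nu> y \<otimes>\<^bsub>E\<^esub> inv\<^bsub>E\<^esub> \<nu> x)
        = \<Psi>' (\<mu> x) \<otimes>\<^bsub>E\<^esub> s (\<pi> x) \<otimes>\<^bsub>E\<^esub> (\<chi> y \<otimes>\<^bsub>E\<^esub> inv\<^bsub>E\<^esub> \<nu> x)"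
      using m sc by (simp add: \<chi>_def \<nu>.H.m_assoc)
    also have "\<chi> y \<otimes>\<^bsub>E\<^esub> inv\<^bsub>E\<^esub> \<nu> x = inv\<^bsub>E\<^esub> \<nu> x \<otimes>\<^bsub>E\<^esub> \<chi> y"
      using sc by (intro K_central[OF \<chi>_K[OF y]]) simp
    also have "\<Psi>' (\<mu> x) \<otimes>\<^bsub>E\<^esub> s (\<pi> x) \<otimes>\<^bsub>E\<^esub> (inv\<^bsub>E\<^esub> \<nu> x \<otimes>\<^bsub>E\<^esub> \<chi> y) = \<chi> x \<otimes>\<^bsub>E\<^esub> \<chi> y"
      using m sc K_in_E[OF \<chi>_K[OF y]] by (simp add: \<chi>_def[of x] \<nu>.H.m_assoc)
    finally show "\<chi> (x \<otimes>\<^bsub>F\<^esub> y) = \<chi> x \<otimes>\<^bsub>KE\<^esub> \<chi> y" by simp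
  qed
  have \<chi>_D: "\<chi> x = \<one>\<^bsub>KE\<^esub>" if "x \<in> derived_power_subgroup F q" for x
    by (rule derived_power_killed[OF \<pi>.G.group_axioms KE.comm_group_axioms \<chi>_hom _ that])
      (rule KE_exponent, simp only: KE_simps(1))
  define \<omega> where "\<omega> x = \<delta> (\<mu> x) \<otimes>\<^bsub>C1\<^esub> b1 (\<pi> x)" for x
  have \<omega>_hom: "\<omega> \<in> hom F C1"
  proof (rule homI)
    show "\<omega> x \<in> carrier C1" if "x \<in> carrier F" for x using that by (simp add: \<omega>_def)
    fix x y assume x: "x \<in> carrier F" and y: "y \<in> carrier F"
    have c: "\<delta> (\<mu> x) \<in> carrier C1" "\<delta> (\<mu> y) \<in> carrier C1" using x y by simp_all
    have "\<omega> (x \<otimes>\<^bsub>F\<^esub> y) = \<delta> (\<mu> x) \<otimes>\<^bsub>C1\<^esub> \<delta> (\<mu> y)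
        \<otimes>\<^bsub>C1\<^esub> (b1 (\<pi> y) \<otimes>\<^bsub>C1\<^esub> inv\<^bsub>C1\<^esub> b1 (\<pi> x \<otimes> \<pi> y) \<otimes>\<^bsub>C1\<^esub> b1 (\<pi> x)) \<otimes>\<^bsub>C1\<^esub> b1 (\<pi> x \<otimes> \<pi> y)"
      using x y by (simp add: \<omega>_def \<mu>_mult \<delta>_\<gamma>)
    also have "\<dots> = (inv\<^bsub>C1\<^esub> b1 (\<pi> x \<otimes> \<pi> y) \<otimes>\<^bsub>C1\<^esub> b1 (\<pi> x \<otimes> \<pi> y)) \<otimes>\<^bsub>C1\<^esub> (\<omega> x \<otimes>\<^bsub>C1\<^esub> \<omega> y)"
      using c by (simp only: \<omega>_def C1.m_ac C1.m_closed C1.inv_closed b1_closed)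
    also have "\<dots> = \<omega> x \<otimes>\<^bsub>C1\<^esub> \<omega> y"
      using c by (simp add: \<omega>_def)
    finally show "\<omega> (x \<otimes>\<^bsub>F\<^esub> y) = \<omega> x \<otimes>\<^bsub>C1\<^esub> \<omega> y" .
  qed
  have \<omega>_D: "\<omega> x = \<one>\<^bsub>C1\<^esub>" if "x \<in> derived_power_subgroup F q" for x
    by (rule derived_power_killed[OF \<pi>.G.group_axioms C1.comm_group_axioms \<omega>_hom chains_exponent that])
  obtain x where x: "x \<in> derived_power_subgroup F q" "k = \<nu> x" using D_lift[OF k(1)] by blast
  have xF: "x \<in> carrier F"
    using x(1) subgroup.subset[OF \<pi>.G.derived_power_subgroup_is_subgroup] by blast
  have \<pi>x: "\<pi> x = \<one>" using p_K[OF k(2)] x(2) xF by (simp add: p_\<nu>)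
  have mx: "\<Psi>' (\<mu> x) \<in> carrier E" using \<Psi>'_E xF by simp
  have "\<kappa> x \<in> carrier Q" using xF by simp
  then have "\<kappa> x \<in> cls ` carrier C2" by (simp only: carrier_Q)
  then obtain c where c': "\<kappa> x = cls c" "c \<in> carrier C2" by (rule imageE)
  note c = c'(2) c'(1)[symmetric]
  have factor_one: "\<nu> (factor \<one> \<one>) = s \<one>"
    by (simp add: factor_def s_rep \<pi>.G.m_assoc)
  have "\<Psi> c = \<Psi>' (\<kappa> x)" unfolding c'(1) by (rule \<Psi>'(2)[OF c'(2), symmetric])
  also have "\<dots> = \<Psi>' (\<mu> x) \<otimes>\<^bsub>E\<^esub> s \<one>"
    using xF by (simp add: \<kappa>_def \<Psi>'_\<gamma> factor_one)
  also have "\<dots> = \<chi> x \<otimes>\<^bsub>E\<^esub> \<nu> x"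
    using xF mx by (simp add: \<chi>_def \<pi>x \<nu>.H.m_assoc)
  also have "\<dots> = k"
    using \<chi>_D[OF x(1)] x(2) xF by simp
  finally have "\<Psi> c = k" .
  moreover have "d2 c = \<one>\<^bsub>C1\<^esub>"
  proof -
    have "d2 c = \<delta> (\<kappa> x)" unfolding c'(1) by (rule \<delta>(2)[OF c'(2), symmetric])
    also have "\<dots> = \<delta> (\<mu> x) \<otimes>\<^bsub>C1\<^esub> (b1 \<one> \<otimes>\<^bsub>C1\<^esub> inv\<^bsub>C1\<^esub> b1 \<one> \<otimes>\<^bsub>C1\<^esub> b1 \<one>)"
      using xF by (simp add: \<kappa>_def \<delta>_\<gamma>)
    also have "\<dots> = \<omega> x" by (simp add: \<omega>_def \<pi>x)
    finally show ?thesis using \<omega>_D[OF x(1)] by simp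
  qed
  ultimately show thesis using c(1) that by blast
qed

theorem H2_iso:
  "H2 G (integer_mod_group q)
    \<cong> E\<lparr>carrier := derived_power_subgroup E q \<inter> Tq_subgroup F R q\<rparr>"
proof -
  define Z2 where "Z2 = kernel C2 C1 d2"
  have mem_Z2: "z \<in> Z2 \<longleftrightarrow> z \<in> carrier C2 \<and> d2 z = \<one>\<^bsub>C1\<^esub>" for z
    by (auto simp: Z2_def kernel_def)
  let ?Z = "C2\<lparr>carrier := Z2\<rparr>" and ?K = "E\<lparr>carrier := D \<inter> K\<rparr>"
  have "Tq_subgroup F R q = K"
    by (simp add: K_eq Tq_subgroup_def \<nu>_def[abs_def])
  moreover have "H2 G (integer_mod_group q) = ?Z Mod B2"
    by (simp add: H2_def Z2_def B2_def)
  moreover have "?Z Mod B2 \<cong> ?K"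
  proof -
    have "group ?Z"
      unfolding Z2_def by (rule subgroup.subgroup_is_group[OF d2.subgroup_kernel C2.group_axioms])
    moreover have "group ?K"
      by (rule subgroup.subgroup_is_group[OF subgroup_Int[OF \<nu>.H.derived_power_subgroup_is_subgroup subgroup_K] \<nu>.H.group_axioms])
    moreover have "\<Psi> \<in> hom ?Z ?K"
    proof (rule homI)
      fix z assume "z \<in> carrier ?Z"
      then have z: "z \<in> carrier C2" "d2 z = \<one>\<^bsub>C1\<^esub>" by (simp_all add: mem_Z2)
      then show "\<Psi> z \<in> carrier ?K" using \<Psi>_cycle_in_D[OF z] \<Psi>.hom_closed[OF z(1)] by simp
      fix y assume "y \<in> carrier ?Z"
      then show "\<Psi> (z \<otimes>\<^bsub>?Z\<^esub> y) = \<Psi> z \<otimes>\<^bsub>?K\<^esub> \<Psi> y" using z by (simp add: mem_Z2)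
    qed
    ultimately interpret \<Psi>Z: group_hom ?Z ?K \<Psi>
      by (simp add: group_hom_def group_hom_axioms_def)
    have "\<Psi> ` carrier ?Z = carrier ?K"
    proof
      show "\<Psi> ` carrier ?Z \<subseteq> carrier ?K" using \<Psi>Z.hom_closed by blast
      show "carrier ?K \<subseteq> \<Psi> ` carrier ?Z"
      proof
        fix k assume "k \<in> carrier ?K"
        then have "k \<in> D" "k \<in> K" by simp_all
        then obtain z where "z \<in> carrier C2" "d2 z = \<one>\<^bsub>C1\<^esub>" "\<Psi> z = k" by (rule \<Psi>_surjective)
        then have "z \<in> carrier ?Z" "k = \<Psi> z" by (simp_all add: mem_Z2)
        then show "k \<in> \<Psi> ` carrier ?Z" by blast
      qed
    qed
    moreover have "kernel ?Z ?K \<Psi> = B2"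
    proof
      show "kernel ?Z ?K \<Psi> \<subseteq> B2"
        using \<Psi>_injective by (auto simp: kernel_def mem_Z2)
      show "B2 \<subseteq> kernel ?Z ?K \<Psi>"
        using \<Psi>_B2 d2_B2 B2.subset by (auto simp: kernel_def mem_Z2)
    qed
    ultimately show ?thesis using \<Psi>Z.FactGroup_iso by simp
  qed
  ultimately show ?thesis by simp
qed

end

section \<open>Groups given by a polycyclic presentation\<close>

lemma pc_kernel_normal:
  assumes "I \<subseteq> {1..n}"
  shows "pc_kernel n I e \<alpha> \<beta> \<gamma> \<lhd> free_group {1..n}"
proof -
  define F where "F = free_group {1..n}"
  interpret F: group F unfolding F_def by (rule group_free_group)
  have gen: "free_gen i \<in> carrier F" if "1 \<le> i" "i \<le> n" for i
    unfolding F_def using that by simp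
  have powers: "gen_powers n (Suc m) f \<in> carrier F" for m and f :: "nat \<Rightarrow> int"
    unfolding gen_powers_def F_def[symmetric] using gen by (intro F.list_prod_closed) auto
  have "pc_relations n I e \<alpha> \<beta> \<gamma> \<subseteq> carrier F \<times> carrier F"
    unfolding pc_relations_def Let_def F_def[symmetric] using assms gen powers by auto
  then have "relators F (pc_relations n I e \<alpha> \<beta> \<gamma>) \<subseteq> carrier F"
    by (auto simp: relators_def)
  then show ?thesis
    unfolding pc_kernel_def F_def[symmetric] by (rule F.normal_closure_normal)
qed

theorem corollary4p1:
  fixes G :: "('g, 'm) monoid_scheme"
    and q n :: nat
    and I :: "nat set"
    and e :: "nat \<Rightarrow> nat"
    and \<alpha> :: "nat \<Rightarrow> nat \<Rightarrow> int"
    and \<beta> \<gamma> :: "nat \<Rightarrow> nat \<Rightarrow> nat \<Rightarrow> int"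
  defines "F \<equiv> free_group {1..n}"
    and "R \<equiv> pc_kernel n I e \<alpha> \<beta> \<gamma>"
  assumes "I \<subseteq> {1..n}"
    and "consistent_pc_presentation n I e \<alpha> \<beta> \<gamma>"
    and "group G"
    and "G \<cong> F Mod R"
  shows "q_exterior_square G q
           \<cong> (Eq_group F R q)\<lparr>carrier := derived_power_subgroup (Eq_group F R q) q\<rparr>
         \<and> H2 G (integer_mod_group q)
           \<cong> (Eq_group F R q)
               \<lparr>carrier := derived_power_subgroup (Eq_group F R q) q \<inter> Tq_subgroup F R q\<rparr>"
proof -
  interpret G: group G by fact
  interpret R: normal R F
    unfolding R_def F_def by (rule pc_kernel_normal) fact
  obtain \<psi> where \<psi>: "\<psi> \<in> iso (F Mod R) G"
    using G.iso_sym \<open>G \<cong> F Mod R\<close> by (auto simp: is_iso_def)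
  then have \<psi>_hom: "\<psi> \<in> hom (F Mod R) G" and bij: "bij_betw \<psi> (carrier (F Mod R)) (carrier G)"
    by (simp_all add: iso_def)
  \<comment> \<open>the free presentation of \<open>G\<close> that the isomorphism transports from \<open>F Mod R\<close>\<close>
  define \<pi> where "\<pi> f = \<psi> (R #>\<^bsub>F\<^esub> f)" for f
  have \<pi>_hom: "\<pi> \<in> hom F G"
    using Group.hom_compose[OF R.r_coset_hom_Mod \<psi>_hom] by (simp add: \<pi>_def[abs_def] comp_def)
  have surj: "\<pi> ` carrier F = carrier G"
    using bij by (simp add: \<pi>_def[abs_def] bij_betw_def carrier_FactGroup image_image)
  have "\<pi> r = \<one>\<^bsub>G\<^esub> \<longleftrightarrow> r \<in> R" if r: "r \<in> carrier F" for r
  proof -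
    have quotient: "group (F Mod R)" by (rule R.factorgroup_is_group)
    have "\<psi> R = \<one>\<^bsub>G\<^esub>"
      using hom_one[OF \<psi>_hom quotient G.group_axioms] by simp
    moreover have "R \<in> carrier (F Mod R)" "R #>\<^bsub>F\<^esub> r \<in> carrier (F Mod R)"
      using monoid.one_closed[OF group.is_monoid[OF quotient]] r by (simp_all add: carrier_FactGroup)
    ultimately have "\<pi> r = \<one>\<^bsub>G\<^esub> \<longleftrightarrow> R #>\<^bsub>F\<^esub> r = R"
      using bij_betw_imp_inj_on[OF bij] by (metis \<pi>_def inj_on_def)
    then show ?thesis
      using R.coset_join1[OF _ r R.subgroup_axioms] R.coset_join2[OF r R.subgroup_axioms] by blast
  qed
  then have "R = kernel F G \<pi>"
    using R.subset by (auto simp: kernel_def)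
  then interpret free_presentation G n q F R \<pi>
    using \<pi>_hom surj by unfold_locales (simp_all add: F_def)
  show ?thesis
    using q_exterior_square_iso H2_iso by blast
qed

end
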